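(* Let $\{(x^k,y^k,z^k)\}_{k\ge0}$ be the sequence generated by Sto-SiPBA with $$\alpha_k=\alpha_0(k+1)^{-9t-s},\ \ \beta_k=\beta_0(k+1)^{-4t-s},\ \ \eta_k=\eta_0(k+1)^{-5t-s},\ \ \sigma_k=\sigma_0(k+1)^{-t},\ \ \delta_k=\delta_0(k+1)^{-t},\ \ \rho_k=\rho_0(k+1)^{t},$$ where $\alpha_0,\beta_0,\sigma_0,\delta_0,\rho_0>0$ and $0<\eta_0\le1$. Suppose that $\phi$ is bounded below on $X$. Assume further that $0<2t<s<1$, $11t+s<1$ and $9t+2s\neq1$. If $\beta_0/\sigma_0$ is sufficiently small (below a positive threshold depending on the problem data and the other parameter constants), then, as $K\to\infty$, $$\min_{0\le k\le K}\mathbb E\bigl[\|\mathcal G_k(x^k)\|^2\bigr]=O\!\left(\frac1{K^{1-11t-s}}\right)+O\!\left(\frac1{K^{s-2t}}\right),$$ $$\min_{0\le k\le K}\mathbb E\bigl[\|u^k-u_k^*(x^k)\|^2\bigr]=O\!\left(\frac1{K^{1-8t-s}}\right)+O\!\left(\frac1{K^{s+t}}\right).$$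
   Context: $X\subseteq\mathbb R^n$ and $Y\subseteq\mathbb R^m$ are nonempty, closed and convex; $F(x,y)=\mathbb E_{\xi\sim D}[F(x,y;\xi)]$ and $f(x,y)=\mathbb E_{\xi\sim D}[f(x,y;\xi)]$ are functions $\mathbb R^n\times\mathbb R^m\to\mathbb R$. For $x\in X$ let $\mathcal S(x):=\arg\min_{y\in Y}f(x,y)$ and $\phi(x):=\max_{y\in\mathcal S(x)}F(x,y)$. Standing assumptions. (A1) $F$ is continuously differentiable and $\nabla F$ is Lipschitz continuous on $X\times Y$. For every $x\in X$, $F(x,\cdot)$ is concave on $Y$ and $-F(x,\cdot)$ is coercive on $Y$, i.e. $\lim_{\|y\|\to\infty,\,y\in Y}F(x,y)=-\infty$. (A2) $f$ is continuously differentiable and $\nabla f$ is Lipschitz continuous on $X\times Y$. For every $x\in X$, $f(x,\cdot)$ is convex on $Y$ and $\mathcal S(x)\neq\emptyset$. For every bounded set $D_x\subseteq X$ there is a bounded set $D_y\subseteq Y$ with $\mathcal S(x)\cap D_y\neq\emptyset$ for every $x\in D_x$. (A4) $X$ is compact. (A5) Let $\mathcal F_k=\sigma\{\xi_0^u,\xi_0^x,\dots,\xi_{k-1}^u,\xi_{k-1}^x\}$ and $\mathcal F_{k+1/2}=\sigma\{\mathcal F_k,\xi_k^u\}$. For every $k\ge0$, $\xi_k^u$ is independent of $\mathcal F_k$ and $\xi_k^x$ is independent of $\mathcal F_{k+1/2}$. There is $\Delta>0$ such that for each $h\in\{F,f\}$: for all square-integrable $\mathcal F_k$-measurable random vectors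 $x\in X$, $v\in Y$, $\mathbb E[\nabla_yh(x,v;\xi_k^u)\mid\mathcal F_k]=\nabla_yh(x,v)$ and $\mathbb E[\|\nabla_yh(x,v;\xi_k^u)-\nabla_yh(x,v)\|^2\mid\mathcal F_k]\le\Delta^2$; and for all square-integrable $\mathcal F_{k+1/2}$-measurable $x\in X$, $v\in Y$, $\mathbb E[\nabla_xh(x,v;\xi_k^x)\mid\mathcal F_{k+1/2}]=\nabla_xh(x,v)$ and $\mathbb E[\|\nabla_xh(x,v;\xi_k^x)-\nabla_xh(x,v)\|^2\mid\mathcal F_{k+1/2}]\le\Delta^2$. (A6) The oracle permits two-point queries with the same sample $\xi_k^x$, and there are $\bar L_F,\bar L_f>0$ such that for each $h\in\{F,f\}$ and all $(x_1,y_1),(x_2,y_2)\in X\times Y$, $\mathbb E_\xi[\|\nabla_xh(x_1,y_1;\xi)-\nabla_xh(x_2,y_2;\xi)\|^2]\le\bar L_h^2(\|x_1-x_2\|^2+\|y_1-y_2\|^2)$. Smooth approximation. For positive $\rho_k,\sigma_k,\delta_k$, $$\psi_k(x,y,z):=F(x,y)-\rho_k\bigl(f(x,y)-f(x,z)\bigr)+\tfrac{\sigma_k}{2}\|z\|^2-\sigma_k\langle y,z\rangle-\tfrac{\delta_k}{2}\|y\|^2,\quad \phi_k(x):=\min_{z\in Y}\max_{y\in Y}\psi_k(x,y,z);$$ $\psi_k(x,y,z;\xi)$ is the same expression with $F(\cdot;\xi),f(\cdot;\xi)$ in place of $F,f$. For each $x\in X$ the minimax problem has a unique saddle point $u_k^*(x):=(y_k^*(x),z_k^*(x))\in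 Y\times Y$, and $\phi_k$ is differentiable with $\nabla\phi_k(x)=\nabla_x\psi_k(x,y_k^*(x),z_k^*(x))$. Sto-SiPBA. From $(x^0,y^0,z^0)\in X\times Y\times Y$, for $k=0,1,\dots$: draw $\xi_k^u$; $y^{k+1}=\operatorname{Proj}_Y(y^k+\beta_k\nabla_y\psi_k(x^k,y^k,z^k;\xi_k^u))$, $z^{k+1}=\operatorname{Proj}_Y(z^k-\beta_k\nabla_z\psi_k(x^k,y^k,z^k;\xi_k^u))$; draw $\xi_k^x$; $d_x^0=\nabla_x\psi_0(x^0,y^1,z^1;\xi_0^x)$ and, for $k\ge1$, $d_x^k=\nabla_x\psi_k(x^k,y^{k+1},z^{k+1};\xi_k^x)+(1-\eta_k)\bigl(d_x^{k-1}-\nabla_x\psi_{k-1}(x^{k-1},y^k,z^k;\xi_k^x)\bigr)$; $x^{k+1}=\operatorname{Proj}_X(x^k-\alpha_kd_x^k)$. Write $u^k:=(y^k,z^k)$. Projected-gradient mapping: $\mathcal G_k(x):=\frac1{\alpha_k}\bigl(x-\operatorname{Proj}_X(x-\alpha_k\nabla\phi_k(x))\bigr)$. *)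

theory Defs
  imports "HOL-Probability.Probability" "HOL-Library.Landau_Symbols"
begin

text \<open>
  Gradient of \<open>f\<close> at \<open>x\<close> relative to \<open>S\<close>. For \<open>S = UNIV\<close> it is the usual (unique) gradient.
  For a convex \<open>S\<close> with empty interior it is determined only up to vectors orthogonal to
  the affine hull of \<open>S\<close>; for \<open>x \<in> S\<close> such vectors do not change the projection of
  \<open>x - a *\<^sub>R v\<close> onto \<open>S\<close>, so \<open>proj_grad_map\<close> below does not depend on the choice.
\<close>

definition grad_within :: "'a::real_inner set \<Rightarrow> ('a \<Rightarrow> real) \<Rightarrow> 'a \<Rightarrow> 'a" where
  "grad_within S f x = (SOME v. (f has_derivative (\<lambda>h. h \<bullet> v)) (at x within S))"

abbreviation grad :: "('a::real_inner \<Rightarrow> real) \<Rightarrow> 'a \<Rightarrow> 'a" where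
  "grad \<equiv> grad_within UNIV"

definition grad_x :: "('a::real_inner \<Rightarrow> 'b \<Rightarrow> real) \<Rightarrow> 'a \<Rightarrow> 'b \<Rightarrow> 'a" where
  "grad_x h x y = grad (\<lambda>x'. h x' y) x"

definition grad_y :: "('a \<Rightarrow> 'b::real_inner \<Rightarrow> real) \<Rightarrow> 'a \<Rightarrow> 'b \<Rightarrow> 'b" where
  "grad_y h x y = grad (\<lambda>y'. h x y') y"


subsection \<open>The bilevel problem\<close>

definition mean_fun :: "'w measure \<Rightarrow> ('a \<Rightarrow> 'b \<Rightarrow> 'w \<Rightarrow> real) \<Rightarrow> 'a \<Rightarrow> 'b \<Rightarrow> real" where
  "mean_fun D h x y = (\<integral>w. h x y w \<partial>D)"

definition lower_sol :: "('a \<Rightarrow> 'b \<Rightarrow> real) \<Rightarrow> 'b set \<Rightarrow> 'a \<Rightarrow> 'b set" where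
  "lower_sol f Y x = {y. is_arg_min (f x) (\<lambda>y'. y' \<in> Y) y}"

text \<open>Under the standing assumptions the supremum below is attained.\<close>

definition value_fun :: "('a \<Rightarrow> 'b \<Rightarrow> real) \<Rightarrow> ('a \<Rightarrow> 'b \<Rightarrow> real) \<Rightarrow> 'b set \<Rightarrow> 'a \<Rightarrow> real" where
  "value_fun F f Y x = (SUP y\<in>lower_sol f Y x. F x y)"

definition C1_lipschitz_grad ::
  "'a::real_inner set \<Rightarrow> 'b::real_inner set \<Rightarrow> ('a \<Rightarrow> 'b \<Rightarrow> real) \<Rightarrow> bool" where
  "C1_lipschitz_grad X Y h \<longleftrightarrow>
     (\<forall>p\<in>X \<times> Y. (\<lambda>(x, y). h x y) differentiable (at p)) \<and>
     continuous_on (X \<times> Y) (grad (\<lambda>(x, y). h x y)) \<and>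
     (\<exists>L. L-lipschitz_on (X \<times> Y) (grad (\<lambda>(x, y). h x y)))"

definition upper_level_assm ::
  "'a::real_inner set \<Rightarrow> 'b::real_inner set \<Rightarrow> ('a \<Rightarrow> 'b \<Rightarrow> real) \<Rightarrow> bool" where
  "upper_level_assm X Y F \<longleftrightarrow>
     C1_lipschitz_grad X Y F \<and>
     (\<forall>x\<in>X. concave_on Y (F x) \<and>
        filterlim (F x) at_bot (inf at_infinity (principal Y)))"

definition lower_level_assm ::
  "'a::real_inner set \<Rightarrow> 'b::real_inner set \<Rightarrow> ('a \<Rightarrow> 'b \<Rightarrow> real) \<Rightarrow> bool" where
  "lower_level_assm X Y f \<longleftrightarrow>
     C1_lipschitz_grad X Y f \<and>
     (\<forall>x\<in>X. convex_on Y (f x) \<and> lower_sol f Y x \<noteq> {}) \<and>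
     (\<forall>Dx\<subseteq>X. bounded Dx \<longrightarrow>
        (\<exists>Dy\<subseteq>Y. bounded Dy \<and> (\<forall>x\<in>Dx. lower_sol f Y x \<inter> Dy \<noteq> {})))"


subsection \<open>Smooth approximation\<close>

definition psi ::
  "('a \<Rightarrow> 'b::real_inner \<Rightarrow> real) \<Rightarrow> ('a \<Rightarrow> 'b \<Rightarrow> real) \<Rightarrow> real \<Rightarrow> real \<Rightarrow> real
     \<Rightarrow> 'a \<Rightarrow> 'b \<Rightarrow> 'b \<Rightarrow> real" where
  "psi F f \<rho> \<sigma> \<delta> x y z =
     F x y - \<rho> * (f x y - f x z) + \<sigma> / 2 * (norm z)\<^sup>2 - \<sigma> * (y \<bullet> z) - \<delta> / 2 * (norm y)\<^sup>2"

definition min_max :: "'b set \<Rightarrow> ('a \<Rightarrow> 'b \<Rightarrow> 'b \<Rightarrow> real) \<Rightarrow> 'a \<Rightarrow> real" where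
  "min_max Y \<psi> x = (INF z\<in>Y. SUP y\<in>Y. \<psi> x y z)"

definition is_saddle :: "'b set \<Rightarrow> ('b \<Rightarrow> 'b \<Rightarrow> real) \<Rightarrow> 'b \<times> 'b \<Rightarrow> bool" where
  "is_saddle Y g u \<longleftrightarrow>
     fst u \<in> Y \<and> snd u \<in> Y \<and>
     (\<forall>y\<in>Y. g y (snd u) \<le> g (fst u) (snd u)) \<and>
     (\<forall>z\<in>Y. g (fst u) (snd u) \<le> g (fst u) z)"

definition saddle :: "'b set \<Rightarrow> ('a \<Rightarrow> 'b \<Rightarrow> 'b \<Rightarrow> real) \<Rightarrow> 'a \<Rightarrow> 'b \<times> 'b" where
  "saddle Y \<psi> x = (THE u. is_saddle Y (\<psi> x) u)"

definition proj_grad_map ::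
  "'a::euclidean_space set \<Rightarrow> real \<Rightarrow> ('a \<Rightarrow> real) \<Rightarrow> 'a \<Rightarrow> 'a" where
  "proj_grad_map X a \<phi> x =
     (1 / a) *\<^sub>R (x - closest_point X (x - a *\<^sub>R grad_within X \<phi> x))"


subsection \<open>Stochastic oracle\<close>

text \<open>
  Regularity that is implicit in writing expectations and conditional expectations of
  \<open>h(x,y;\<xi>)\<close> and of its partial gradients at random points.
\<close>

definition sample_fun ::
  "'w measure \<Rightarrow> 'a::euclidean_space set \<Rightarrow> 'b::euclidean_space set
     \<Rightarrow> ('a \<Rightarrow> 'b \<Rightarrow> 'w \<Rightarrow> real) \<Rightarrow> bool" where
  "sample_fun D X Y h \<longleftrightarrow>
     (\<forall>x y. integrable D (h x y)) \<and>
     (\<forall>x\<in>X. \<forall>y\<in>Y. \<forall>w\<in>space D.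
        (\<lambda>x'. h x' y w) differentiable (at x) \<and> (\<lambda>y'. h x y' w) differentiable (at y)) \<and>
     (\<lambda>((x, y), w). grad_x (\<lambda>x y. h x y w) x y)
        \<in> borel_measurable (restrict_space borel (X \<times> Y) \<Otimes>\<^sub>M D) \<and>
     (\<lambda>((x, y), w). grad_y (\<lambda>x y. h x y w) x y)
        \<in> borel_measurable (restrict_space borel (X \<times> Y) \<Otimes>\<^sub>M D)"

definition gen_alg :: "'o measure \<Rightarrow> 'w measure \<Rightarrow> ('o \<Rightarrow> 'w) set \<Rightarrow> 'o measure" where
  "gen_alg M D V = sigma (space M) (\<Union>\<xi>\<in>V. sets (vimage_algebra (space M) \<xi> D))"

definition filt ::
  "'o measure \<Rightarrow> 'w measure \<Rightarrow> (nat \<Rightarrow> 'o \<Rightarrow> 'w) \<Rightarrow> (nat \<Rightarrow> 'o \<Rightarrow> 'w) \<Rightarrow> nat \<Rightarrow> 'o measure" where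
  "filt M D \<xi>u \<xi>x k = gen_alg M D (\<xi>u ` {..<k} \<union> \<xi>x ` {..<k})"

definition filt_half ::
  "'o measure \<Rightarrow> 'w measure \<Rightarrow> (nat \<Rightarrow> 'o \<Rightarrow> 'w) \<Rightarrow> (nat \<Rightarrow> 'o \<Rightarrow> 'w) \<Rightarrow> nat \<Rightarrow> 'o measure" where
  "filt_half M D \<xi>u \<xi>x k = gen_alg M D (\<xi>u ` {..k} \<union> \<xi>x ` {..<k})"

definition samples ::
  "'o measure \<Rightarrow> 'w measure \<Rightarrow> (nat \<Rightarrow> 'o \<Rightarrow> 'w) \<Rightarrow> (nat \<Rightarrow> 'o \<Rightarrow> 'w) \<Rightarrow> bool" where
  "samples M D \<xi>u \<xi>x \<longleftrightarrow>
     (\<forall>k. \<xi>u k \<in> measurable M D \<and> distr M D (\<xi>u k) = D \<and>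
          \<xi>x k \<in> measurable M D \<and> distr M D (\<xi>x k) = D \<and>
          prob_space.indep_set M (sets (vimage_algebra (space M) (\<xi>u k) D))
            (sets (filt M D \<xi>u \<xi>x k)) \<and>
          prob_space.indep_set M (sets (vimage_algebra (space M) (\<xi>x k) D))
            (sets (filt_half M D \<xi>u \<xi>x k)))"

text \<open>
  Given the sigma-algebra \<open>G\<close>, \<open>gS(\<cdot>,\<cdot>;\<xi>)\<close> is an unbiased estimator of \<open>g\<close> with conditional
  variance at most \<open>\<Delta>\<^sup>2\<close>. The conditional expectation of a vector is taken componentwise. The
  variance uses \<open>nn_cond_exp\<close>, which takes values in \<open>ennreal\<close>, since \<open>real_cond_exp\<close> would
  silently be finite for a non-integrable square.
\<close>

definition unbiased_oracle ::
  "'o measure \<Rightarrow> 'o measure \<Rightarrow> ('o \<Rightarrow> 'w) \<Rightarrow> (real^'n) set \<Rightarrow> (real^'m) set \<Rightarrow> real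
     \<Rightarrow> (real^'n \<Rightarrow> real^'m \<Rightarrow> 'w \<Rightarrow> real^'l) \<Rightarrow> (real^'n \<Rightarrow> real^'m \<Rightarrow> real^'l) \<Rightarrow> bool" where
  "unbiased_oracle M G \<xi> X Y \<Delta> gS g \<longleftrightarrow>
     (\<forall>x v. x \<in> borel_measurable G \<and> v \<in> borel_measurable G \<and>
        (\<forall>\<omega>\<in>space M. x \<omega> \<in> X \<and> v \<omega> \<in> Y) \<and>
        integrable M (\<lambda>\<omega>. (norm (x \<omega>))\<^sup>2) \<and> integrable M (\<lambda>\<omega>. (norm (v \<omega>))\<^sup>2) \<longrightarrow>
        (\<forall>i. AE \<omega> in M.
           real_cond_exp M G (\<lambda>\<omega>. gS (x \<omega>) (v \<omega>) (\<xi> \<omega>) $ i) \<omega> = g (x \<omega>) (v \<omega>) $ i) \<and>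
        (AE \<omega> in M.
           nn_cond_exp M G
             (\<lambda>\<omega>. ennreal ((norm (gS (x \<omega>) (v \<omega>) (\<xi> \<omega>) - g (x \<omega>) (v \<omega>)))\<^sup>2)) \<omega>
           \<le> ennreal (\<Delta>\<^sup>2)))"

definition gradient_oracle ::
  "'o measure \<Rightarrow> 'w measure \<Rightarrow> (nat \<Rightarrow> 'o \<Rightarrow> 'w) \<Rightarrow> (nat \<Rightarrow> 'o \<Rightarrow> 'w)
     \<Rightarrow> (real^'n) set \<Rightarrow> (real^'m) set \<Rightarrow> real \<Rightarrow> (real^'n \<Rightarrow> real^'m \<Rightarrow> 'w \<Rightarrow> real) \<Rightarrow> bool" where
  "gradient_oracle M D \<xi>u \<xi>x X Y \<Delta> h \<longleftrightarrow>
     (\<forall>k. unbiased_oracle M (filt M D \<xi>u \<xi>x k) (\<xi>u k) X Y \<Delta>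
            (\<lambda>x y w. grad_y (\<lambda>x y. h x y w) x y) (grad_y (mean_fun D h)) \<and>
          unbiased_oracle M (filt_half M D \<xi>u \<xi>x k) (\<xi>x k) X Y \<Delta>
            (\<lambda>x y w. grad_x (\<lambda>x y. h x y w) x y) (grad_x (mean_fun D h)))"

definition mean_square_lipschitz ::
  "'w measure \<Rightarrow> 'a::euclidean_space set \<Rightarrow> 'b::euclidean_space set \<Rightarrow> real
     \<Rightarrow> ('a \<Rightarrow> 'b \<Rightarrow> 'w \<Rightarrow> real) \<Rightarrow> bool" where
  "mean_square_lipschitz D X Y L h \<longleftrightarrow>
     (\<forall>x1\<in>X. \<forall>y1\<in>Y. \<forall>x2\<in>X. \<forall>y2\<in>Y.
        (\<integral>\<^sup>+w. ennreal ((norm (grad_x (\<lambda>x y. h x y w) x1 y1 - grad_x (\<lambda>x y. h x y w) x2 y2))\<^sup>2) \<partial>D)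
        \<le> ennreal (L\<^sup>2 * ((norm (x1 - x2))\<^sup>2 + (norm (y1 - y2))\<^sup>2)))"


subsection \<open>The algorithm\<close>

definition pow_seq :: "real \<Rightarrow> real \<Rightarrow> nat \<Rightarrow> real" where
  "pow_seq c e k = c * real (k + 1) powr e"

text \<open>\<open>\<psi>S k w x y z\<close> stands for \<open>\<psi>\<^sub>k(x,y,z;w)\<close>.\<close>

definition sto_sipba ::
  "'o measure \<Rightarrow> 'a::euclidean_space set \<Rightarrow> 'b::euclidean_space set
     \<Rightarrow> (nat \<Rightarrow> 'w \<Rightarrow> 'a \<Rightarrow> 'b \<Rightarrow> 'b \<Rightarrow> real) \<Rightarrow> (nat \<Rightarrow> 'o \<Rightarrow> 'w) \<Rightarrow> (nat \<Rightarrow> 'o \<Rightarrow> 'w)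
     \<Rightarrow> (nat \<Rightarrow> real) \<Rightarrow> (nat \<Rightarrow> real) \<Rightarrow> (nat \<Rightarrow> real) \<Rightarrow> 'a \<Rightarrow> 'b \<Rightarrow> 'b
     \<Rightarrow> (nat \<Rightarrow> 'o \<Rightarrow> 'a) \<Rightarrow> (nat \<Rightarrow> 'o \<Rightarrow> 'b) \<Rightarrow> (nat \<Rightarrow> 'o \<Rightarrow> 'b) \<Rightarrow> (nat \<Rightarrow> 'o \<Rightarrow> 'a) \<Rightarrow> bool" where
  "sto_sipba M X Y \<psi>S \<xi>u \<xi>x \<alpha> \<beta> \<eta> x0 y0 z0 x y z d \<longleftrightarrow>
     (\<forall>\<omega>\<in>space M.
        x 0 \<omega> = x0 \<and> y 0 \<omega> = y0 \<and> z 0 \<omega> = z0 \<and>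
        (\<forall>k. y (Suc k) \<omega> = closest_point Y
               (y k \<omega> + \<beta> k *\<^sub>R grad (\<lambda>v. \<psi>S k (\<xi>u k \<omega>) (x k \<omega>) v (z k \<omega>)) (y k \<omega>))) \<and>
        (\<forall>k. z (Suc k) \<omega> = closest_point Y
               (z k \<omega> - \<beta> k *\<^sub>R grad (\<lambda>v. \<psi>S k (\<xi>u k \<omega>) (x k \<omega>) (y k \<omega>) v) (z k \<omega>))) \<and>
        d 0 \<omega> = grad (\<lambda>v. \<psi>S 0 (\<xi>x 0 \<omega>) v (y 1 \<omega>) (z 1 \<omega>)) (x 0 \<omega>) \<and>
        (\<forall>k. d (Suc k) \<omega> =
               grad (\<lambda>v. \<psi>S (Suc k) (\<xi>x (Suc k) \<omega>) v (y (Suc (Suc k)) \<omega>) (z (Suc (Suc k)) \<omega>))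
                 (x (Suc k) \<omega>)
               + (1 - \<eta> (Suc k)) *\<^sub>R
                 (d k \<omega> - grad (\<lambda>v. \<psi>S k (\<xi>x (Suc k) \<omega>) v (y (Suc k) \<omega>) (z (Suc k) \<omega>)) (x k \<omega>))) \<and>
        (\<forall>k. x (Suc k) \<omega> = closest_point X (x k \<omega> - \<alpha> k *\<^sub>R d k \<omega>)))"

end

theory Submission
  imports Defs
begin

text \<open>
  For fixed parameters the saddle point is the solution of a variational inequality whose operator
  \<open>(- \<nabla>\<^sub>y \<psi>\<^sub>k, \<nabla>\<^sub>z \<psi>\<^sub>k)\<close> is strongly monotone with modulus of order \<open>k\<^sup>-\<^sup>t\<close> and Lipschitz with constant
  of order \<open>k\<^sup>t\<close>. Hence it exists and is unique by Banach's fixed point theorem, it is Lipschitz in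
  \<open>x\<close> with constant of order \<open>k\<^sup>2\<^sup>t\<close>, and \<open>\<phi>\<^sub>k\<close> differs from its linearization by at most a multiple
  of \<open>k\<^sup>3\<^sup>t \<parallel>x' - x\<parallel>\<^sup>2\<close>, which yields both the gradient formula and the descent inequality.
  Compactness of \<open>X\<close> makes the coercivity of \<open>- F\<close> uniform in \<open>x\<close>, so that the saddle points are
  uniformly bounded and \<open>\<phi>\<^sub>k\<close> is uniformly bounded below.

  Along the iteration three mean square errors are coupled: the distance to the saddle point
  contracts by \<open>1 - c \<beta>\<^sub>k \<sigma>\<^sub>k\<close>, the error of the momentum estimator by \<open>1 - \<eta>\<^sub>k\<close>, and the value function
  decreases by the squared projected gradient up to these two errors. With the given exponents all
  coupling terms are of lower order, so a Lyapunov function with polynomial weights decreases from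
  some index on. Only large \<open>k\<close> matter for the rates, hence the arbitrary witness \<open>1\<close> for the threshold
  on \<open>\<beta>\<^sub>0 / \<sigma>\<^sub>0\<close>.
\<close>

section \<open>Gradients and projections\<close>

text \<open>The exponents balance as follows. With modulus k^(-t) and Lipschitz constant k^t, a
  plain gradient step contracts once \<beta>_k k^(2t) falls below k^(-t) up to constants, which
  happens for large k, and then by 1 - c k^(-5t-s). The saddle point moves by k^(2t) times the step
  in x. Splitting this motion off by Young's inequality costs the inverse contraction rate, and
  k^(5t+s) k^(4t) = k^(9t+s) is exactly the order 1 / \<alpha>_k of the quadratic term that the
  descent inequality offers. The two are thus of equal order, with constants that need not fit, and
  it is the weight k^(-2t) on the tracking error that opens a strict gap. The curvature of the value
  function, k^t k^(2t) = k^(3t), is harmless because \<alpha>_k k^(3t) tends to 0. Conditional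
  expectations enter only through orthogonality of the noise to square integrable vectors determined
  by the past, so every recursion is an inequality between real numbers.\<close>

lemma norm_fst_bound: "norm (fst p) \<le> norm p"
  by (metis norm_fst_le prod.collapse)

lemma norm_snd_bound: "norm (snd p) \<le> norm p"
  by (metis norm_snd_le prod.collapse)

lemma norm_le_fst_snd: "norm p \<le> norm (fst p) + norm (snd p)"
  using norm_Pair_le[of "fst p" "snd p"] by simp

text \<open>Riesz representation: the vector behind the functional \<open>f'\<close> is its adjoint
  applied to 1. This makes the choice in \<open>grad_within\<close> meaningful.\<close>

lemma grad_has_derivative:
  fixes f :: "'a::euclidean_space \<Rightarrow> real"
  assumes "f differentiable (at x)"
  shows "(f has_derivative (\<lambda>h. h \<bullet> grad f x)) (at x)"
proof -
  obtain f' where f': "(f has_derivative f') (at x)"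
    using assms by (auto simp: differentiable_def)
  have "f' = (\<lambda>h. h \<bullet> adjoint f' 1)"
    using adjoint_works[OF has_derivative_linear[OF f'], of _ 1] by auto
  with f' have "\<exists>v. (f has_derivative (\<lambda>h. h \<bullet> v)) (at x)"
    by metis
  then show ?thesis
    unfolding grad_within_def by (rule someI_ex)
qed

lemma grad_eqI:
  assumes "(f has_derivative (\<lambda>h. h \<bullet> v)) (at x)"
  shows "grad f x = v"
proof -
  have "(f has_derivative (\<lambda>h. h \<bullet> grad f x)) (at x)"
    unfolding grad_within_def by (rule someI) (use assms in simp)
  then have "(\<lambda>h. h \<bullet> grad f x) = (\<lambda>h. h \<bullet> v)"
    using assms by (rule has_derivative_unique)
  then have "(grad f x - v) \<bullet> (grad f x - v) = 0"
    by (metis inner_diff_right right_minus_eq)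
  then show ?thesis by simp
qed

text \<open>One-sided on purpose: x may lie on the boundary of S, where only the open segment
  towards x + d is available.\<close>

lemma has_derivative_slope_tendsto:
  fixes f :: "'a::real_normed_vector \<Rightarrow> real"
  assumes f: "(f has_derivative f') (at x within S)"
    and S: "\<And>s. 0 < s \<Longrightarrow> s < 1 \<Longrightarrow> x + s *\<^sub>R d \<in> S"
  shows "((\<lambda>s. (f (x + s *\<^sub>R d) - f x) / s) \<longlongrightarrow> f' d) (at_right 0)"
proof -
  have lin: "linear f'" using f by (rule has_derivative_linear)
  have g: "((\<lambda>s::real. x + s *\<^sub>R d) has_derivative (\<lambda>s. s *\<^sub>R d)) (at 0 within {0<..<1})"
    by (auto intro!: derivative_eq_intros)
  have "(f has_derivative f') (at (x + 0 *\<^sub>R d) within (\<lambda>s. x + s *\<^sub>R d) ` {0<..<1})"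
  proof (rule has_derivative_subset)
    show "(f has_derivative f') (at (x + 0 *\<^sub>R d) within S)" using f by simp
    show "(\<lambda>s. x + s *\<^sub>R d) ` {0<..<1} \<subseteq> S" using S by fastforce
  qed
  from diff_chain_within[OF g this]
  have "((\<lambda>s. f (x + s *\<^sub>R d)) has_derivative (\<lambda>s. s * f' d)) (at 0 within {0<..<1})"
    by (simp add: o_def linear_cmul[OF lin])
  then have "((\<lambda>s. f (x + s *\<^sub>R d)) has_field_derivative f' d) (at 0 within {0<..<1})"
    unfolding has_field_derivative_def by (rule has_derivative_eq_rhs) (simp add: fun_eq_iff)
  then have "((\<lambda>s. (f (x + s *\<^sub>R d) - f x) / s) \<longlongrightarrow> f' d) (at 0 within {0<..<1})"
    by (simp add: has_field_derivative_iff)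
  moreover have "at (0::real) within {0<..<1} = at_right 0"
    by (rule at_within_nhd[of _ "{-1<..<1}"]) auto
  ultimately show ?thesis by simp
qed

lemma has_derivative_quadratic_remainder:
  fixes f :: "'a::real_inner \<Rightarrow> real"
  assumes "\<And>y. y \<in> S \<Longrightarrow> \<bar>f y - f x - (y - x) \<bullet> v\<bar> \<le> C * (norm (y - x))\<^sup>2"
  shows "(f has_derivative (\<lambda>h. h \<bullet> v)) (at x within S)"
proof (rule has_derivativeI_sandwich[of 1 _ _ _ _ "\<lambda>y. C * norm (y - x)"])
  show "((\<lambda>y. C * norm (y - x)) \<longlongrightarrow> 0) (at x within S)"
    by (auto intro!: tendsto_eq_intros)
  show "norm (f y - f x - (y - x) \<bullet> v) / norm (y - x) \<le> C * norm (y - x)"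
    if "y \<in> S" "y \<noteq> x" for y
    using assms[OF that(1)] that(2) by (simp add: pos_divide_le_eq power2_eq_square mult_ac)
qed (auto intro: bounded_linear_inner_left)

section \<open>First-order conditions on convex sets\<close>

text \<open>By convexity every difference quotient along the segment is at most f y - f x, and so is
  the limit.\<close>

lemma convex_first_order:
  fixes f :: "'a::real_inner \<Rightarrow> real"
  assumes cvx: "convex_on S f" and S: "x \<in> S" "y \<in> S"
    and f: "(f has_derivative (\<lambda>h. h \<bullet> v)) (at x)"
  shows "f x + (y - x) \<bullet> v \<le> f y"
proof -
  have lim: "((\<lambda>s. (f (x + s *\<^sub>R (y - x)) - f x) / s) \<longlongrightarrow> (y - x) \<bullet> v) (at_right 0)"
    by (rule has_derivative_slope_tendsto[OF f]) auto
  have "eventually (\<lambda>s. (f (x + s *\<^sub>R (y - x)) - f x) / s \<le> f y - f x) (at_right 0)"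
    unfolding eventually_at_right_field
  proof (intro exI[of _ 1] conjI allI impI)
    fix s :: real assume s: "0 < s" "s < 1"
    have "f ((1 - s) *\<^sub>R x + s *\<^sub>R y) \<le> (1 - s) * f x + s * f y"
      using s S by (intro convex_onD[OF cvx]) auto
    also have "(1 - s) *\<^sub>R x + s *\<^sub>R y = x + s *\<^sub>R (y - x)"
      by (simp add: algebra_simps)
    finally show "(f (x + s *\<^sub>R (y - x)) - f x) / s \<le> f y - f x"
      using s by (simp add: field_simps)
  qed auto
  from tendsto_upperbound[OF lim this] show ?thesis by simp
qed

text \<open>Moving from x towards y stays in S, so the difference quotients are nonnegative.\<close>

lemma minimizer_first_order:
  fixes f :: "'a::real_inner \<Rightarrow> real"
  assumes S: "convex S" "x \<in> S" "y \<in> S"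
    and min: "\<And>z. z \<in> S \<Longrightarrow> f x \<le> f z"
    and f: "(f has_derivative (\<lambda>h. h \<bullet> v)) (at x)"
  shows "0 \<le> (y - x) \<bullet> v"
proof -
  have lim: "((\<lambda>s. (f (x + s *\<^sub>R (y - x)) - f x) / s) \<longlongrightarrow> (y - x) \<bullet> v) (at_right 0)"
    by (rule has_derivative_slope_tendsto[OF f]) auto
  have "eventually (\<lambda>s. 0 \<le> (f (x + s *\<^sub>R (y - x)) - f x) / s) (at_right 0)"
    unfolding eventually_at_right_field
  proof (intro exI[of _ 1] conjI allI impI)
    fix s :: real assume s: "0 < s" "s < 1"
    have "(1 - s) *\<^sub>R x + s *\<^sub>R y \<in> S"
      using s S by (intro convexD) auto
    also have "(1 - s) *\<^sub>R x + s *\<^sub>R y = x + s *\<^sub>R (y - x)"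
      by (simp add: algebra_simps)
    finally show "0 \<le> (f (x + s *\<^sub>R (y - x)) - f x) / s"
      using s min by simp
  qed auto
  from tendsto_lowerbound[OF lim this] show ?thesis by simp
qed

section \<open>Projections and the projected gradient mapping\<close>

text \<open>Expanding |a - z|^2 around p leaves an inner product with the right sign and a
  square.\<close>

lemma closest_point_eqI:
  fixes S :: "'a::euclidean_space set"
  assumes S: "convex S" "closed S" "p \<in> S"
    and vi: "\<And>z. z \<in> S \<Longrightarrow> (a - p) \<bullet> (z - p) \<le> 0"
  shows "closest_point S a = p"
proof (rule closest_point_unique[symmetric, OF S], rule ballI)
  fix z assume z: "z \<in> S"
  have "(norm (a - z))\<^sup>2 = (norm (a - p))\<^sup>2 - 2 * ((a - p) \<bullet> (z - p)) + (norm (z - p))\<^sup>2"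
    by (simp add: power2_norm_eq_inner inner_diff algebra_simps inner_commute)
  with vi[OF z] have "(norm (a - p))\<^sup>2 \<le> (norm (a - z))\<^sup>2" 
    by (smt (verit) zero_le_power2)
  then show "dist a p \<le> dist a z"
    unfolding dist_norm by (rule power2_le_imp_le) simp
qed

lemma closest_point_Times:
  fixes A :: "'a::euclidean_space set" and B :: "'b::euclidean_space set"
  assumes "convex A" "closed A" "A \<noteq> {}" "convex B" "closed B" "B \<noteq> {}"
  shows "closest_point (A \<times> B) (a, b) = (closest_point A a, closest_point B b)"
proof (rule closest_point_eqI)
  fix z assume "z \<in> A \<times> B"
  then have "(a - closest_point A a) \<bullet> (fst z - closest_point A a) \<le> 0"
    "(b - closest_point B b) \<bullet> (snd z - closest_point B b) \<le> 0"
    using assms by (auto intro: closest_point_dot)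
  then show "((a, b) - (closest_point A a, closest_point B b))
      \<bullet> (z - (closest_point A a, closest_point B b)) \<le> 0"
    by (cases z) simp
qed (use assms in \<open>auto simp: convex_Times closed_Times closest_point_in_set\<close>)

lemma closest_point_nonexpansive:
  fixes S :: "'a::euclidean_space set"
  assumes "convex S" "closed S" "S \<noteq> {}"
  shows "norm (closest_point S a - closest_point S b) \<le> norm (a - b)"
  using closest_point_lipschitz[OF assms, of a b] by (simp add: dist_norm)

text \<open>Both inner products are the limit of the same difference quotients along the segment
  from x to y.\<close>

lemma within_gradient_diff_orthogonal:
  fixes f :: "'a::real_inner \<Rightarrow> real"
  assumes "convex S" "x \<in> S" "y \<in> S"
    and "(f has_derivative (\<lambda>h. h \<bullet> v)) (at x within S)"
    and "(f has_derivative (\<lambda>h. h \<bullet> w)) (at x within S)"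
  shows "(y - x) \<bullet> v = (y - x) \<bullet> w"
proof -
  have mem: "x + s *\<^sub>R (y - x) \<in> S" if "0 < s" "s < 1" for s
  proof -
    have "(1 - s) *\<^sub>R x + s *\<^sub>R y \<in> S"
      using that assms by (intro convexD) auto
    then show ?thesis by (simp add: algebra_simps)
  qed
  show ?thesis
    using has_derivative_slope_tendsto[OF assms(4) mem] has_derivative_slope_tendsto[OF assms(5) mem]
    by (intro tendsto_unique[OF trivial_limit_at_right_real]) 
qed

text \<open>The projection is characterized by inequalities that test the gradient only against
  differences of points of S, and on those all admissible gradients agree.\<close>

lemma proj_grad_map_eq:
  fixes S :: "'a::euclidean_space set"
  assumes S: "convex S" "closed S" "x \<in> S"
    and f: "(f has_derivative (\<lambda>h. h \<bullet> v)) (at x within S)"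
  shows "proj_grad_map S a f x = (1 / a) *\<^sub>R (x - closest_point S (x - a *\<^sub>R v))"
proof -
  define g where "g = grad_within S f x"
  have g: "(f has_derivative (\<lambda>h. h \<bullet> g)) (at x within S)"
    unfolding g_def grad_within_def by (rule someI) (use f in simp)
  let ?p = "closest_point S (x - a *\<^sub>R v)"
  have p: "?p \<in> S" using S by (intro closest_point_in_set) auto
  have "closest_point S (x - a *\<^sub>R g) = ?p"
  proof (rule closest_point_eqI[OF S(1,2) p])
    fix z assume z: "z \<in> S"
    have "(x - a *\<^sub>R v - ?p) \<bullet> (z - ?p) \<le> 0"
      using S z by (intro closest_point_dot)
    moreover have "(z - ?p) \<bullet> v = (z - ?p) \<bullet> g"
      using within_gradient_diff_orthogonal[OF S(1,3) z f g]
        within_gradient_diff_orthogonal[OF S(1,3) p f g]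
      by (simp add: inner_diff_left)
    moreover have "(x - a *\<^sub>R g - ?p) \<bullet> (z - ?p)
        = (x - a *\<^sub>R v - ?p) \<bullet> (z - ?p) + a * ((z - ?p) \<bullet> v) - a * ((z - ?p) \<bullet> g)"
      by (simp add: algebra_simps inner_commute)
    ultimately show "(x - a *\<^sub>R g - ?p) \<bullet> (z - ?p) \<le> 0"
      by simp
  qed
  then show ?thesis by (simp add: proj_grad_map_def g_def)
qed

section \<open>Functions with Lipschitz partial gradients\<close>

text \<open>The working form of \<open>C1_lipschitz_grad\<close>: partial gradients replace the
  joint one, and distances are measured by the sum of the norms, which dominates the norm of the
  pair.\<close>

definition smooth_on ::
  "'a::euclidean_space set \<Rightarrow> 'b::euclidean_space set \<Rightarrow> real \<Rightarrow> ('a \<Rightarrow> 'b \<Rightarrow> real) \<Rightarrow> bool" where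
  "smooth_on X Y L h \<longleftrightarrow>
     (\<forall>x\<in>X. \<forall>y\<in>Y.
        ((\<lambda>x'. h x' y) has_derivative (\<lambda>v. v \<bullet> grad_x h x y)) (at x) \<and>
        ((\<lambda>y'. h x y') has_derivative (\<lambda>v. v \<bullet> grad_y h x y)) (at y) \<and>
        (\<forall>x'\<in>X. \<forall>y'\<in>Y.
           norm (grad_x h x y - grad_x h x' y') \<le> L * (norm (x - x') + norm (y - y')) \<and>
           norm (grad_y h x y - grad_y h x' y') \<le> L * (norm (x - x') + norm (y - y'))))"

lemma smooth_on_mono:
  assumes "smooth_on X Y L h" "L \<le> L'"
  shows "smooth_on X Y L' h"
proof -
  have "L * (norm (x - x') + norm (y - y')) \<le> L' * (norm (x - x') + norm (y - y'))"
    for x x' :: 'a and y y' :: 'b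
    using assms(2) by (intro mult_right_mono) auto
  with assms(1) show ?thesis
    unfolding smooth_on_def by (meson order_trans)
qed

lemma C1_lipschitz_grad_imp_smooth_on:
  fixes h :: "'a::euclidean_space \<Rightarrow> 'b::euclidean_space \<Rightarrow> real"
  assumes "C1_lipschitz_grad X Y h"
  obtains L where "smooth_on X Y L h"
proof -
  define g where "g = grad (\<lambda>(x, y). h x y)"
  obtain L where L: "L-lipschitz_on (X \<times> Y) g"
    using assms by (auto simp: C1_lipschitz_grad_def g_def)
  have d: "((\<lambda>(x, y). h x y) has_derivative (\<lambda>v. v \<bullet> g (x, y))) (at (x, y))"
    if "x \<in> X" "y \<in> Y" for x y
    unfolding g_def by (rule grad_has_derivative) (use assms that in \<open>auto simp: C1_lipschitz_grad_def\<close>)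
  have dx: "((\<lambda>x'. h x' y) has_derivative (\<lambda>v. v \<bullet> fst (g (x, y)))) (at x)"
    if "x \<in> X" "y \<in> Y" for x y
  proof -
    have "((\<lambda>x'. (x', y)) has_derivative (\<lambda>v. (v, 0))) (at x)"
      by (auto intro!: derivative_eq_intros)
    from has_derivative_compose[OF this d[OF that]] show ?thesis
      by (simp add: o_def inner_prod_def)
  qed
  have dy: "((\<lambda>y'. h x y') has_derivative (\<lambda>v. v \<bullet> snd (g (x, y)))) (at y)"
    if "x \<in> X" "y \<in> Y" for x y
  proof -
    have "((\<lambda>y'. (x, y')) has_derivative (\<lambda>v. (0, v))) (at y)"
      by (auto intro!: derivative_eq_intros)
    from has_derivative_compose[OF this d[OF that]] show ?thesis
      by (simp add: o_def inner_prod_def)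
  qed
  have gx: "grad_x h x y = fst (g (x, y))" and gy: "grad_y h x y = snd (g (x, y))"
    if "x \<in> X" "y \<in> Y" for x y
    unfolding grad_x_def grad_y_def using dx[OF that] dy[OF that] by (auto intro: grad_eqI)
  have lip: "norm (g (x, y) - g (x', y')) \<le> L * (norm (x - x') + norm (y - y'))"
    if "x \<in> X" "y \<in> Y" "x' \<in> X" "y' \<in> Y" for x y x' y'
  proof -
    have "norm (g (x, y) - g (x', y')) \<le> L * dist (x, y) (x', y')"
      using lipschitz_onD[OF L] that by (auto simp: dist_norm)
    also have "\<dots> \<le> L * (norm (x - x') + norm (y - y'))"
      using lipschitz_on_nonneg[OF L] norm_Pair_le[of "x - x'" "y - y'"]
      by (intro mult_left_mono) (auto simp: dist_norm)
    finally show ?thesis .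
  qed
  have "smooth_on X Y L h"
    unfolding smooth_on_def
  proof (intro ballI conjI)
    fix x y x' y' assume p: "x \<in> X" "y \<in> Y" "x' \<in> X" "y' \<in> Y"
    show "((\<lambda>x'. h x' y) has_derivative (\<lambda>v. v \<bullet> grad_x h x y)) (at x)"
      using dx[OF p(1,2)] by (simp add: gx[OF p(1,2)])
    show "((\<lambda>y'. h x y') has_derivative (\<lambda>v. v \<bullet> grad_y h x y)) (at y)"
      using dy[OF p(1,2)] by (simp add: gy[OF p(1,2)])
    show "norm (grad_x h x y - grad_x h x' y') \<le> L * (norm (x - x') + norm (y - y'))"
      using lip[OF p] norm_fst_bound[of "g (x, y) - g (x', y')"]
      unfolding gx[OF p(1,2)] gx[OF p(3,4)] fst_diff by simp
    show "norm (grad_y h x y - grad_y h x' y') \<le> L * (norm (x - x') + norm (y - y'))"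
      using lip[OF p] norm_snd_bound[of "g (x, y) - g (x', y')"]
      unfolding gy[OF p(1,2)] gy[OF p(3,4)] snd_diff by simp
  qed
  then show ?thesis by (rule that)
qed

text \<open>The mean value theorem on the segment, which gives the constant L where integration
  would give L / 2.\<close>

lemma smooth_on_remainder:
  assumes h: "smooth_on X Y L h" and X: "convex X" "x \<in> X" "x' \<in> X" and y: "y \<in> Y"
  shows "\<bar>h x' y - h x y - (x' - x) \<bullet> grad_x h x y\<bar> \<le> L * (norm (x' - x))\<^sup>2"
proof -
  let ?p = "\<lambda>s::real. x + s *\<^sub>R (x' - x)"
  have mem: "?p s \<in> X" if "s \<in> {0..1}" for s
  proof -
    have "(1 - s) *\<^sub>R x + s *\<^sub>R x' \<in> X"
      using that X by (intro convexD) auto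
    then show ?thesis by (simp add: algebra_simps)
  qed
  have "((\<lambda>s. h (?p s) y) has_derivative (\<lambda>v. (v *\<^sub>R (x' - x)) \<bullet> grad_x h (?p s) y)) (at s within {0..1})"
    if "s \<in> {0..1}" for s
  proof -
    have "((\<lambda>x'. h x' y) has_derivative (\<lambda>v. v \<bullet> grad_x h (?p s) y)) (at (?p s))"
      using h mem[OF that] y by (auto simp: smooth_on_def)
    then show ?thesis
      by (rule has_derivative_compose[rotated]) (auto intro!: derivative_eq_intros)
  qed
  from mvt_very_simple[OF zero_le_one, of "\<lambda>s. h (?p s) y", OF this]
  obtain s where s: "s \<in> {0..1}" and eq: "h x' y - h x y = (x' - x) \<bullet> grad_x h (?p s) y"
    by auto
  have L: "norm (grad_x h (?p s) y - grad_x h x y) \<le> L * norm (s *\<^sub>R (x' - x))"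
  proof -
    have "norm (grad_x h (?p s) y - grad_x h x y) \<le> L * (norm (?p s - x) + norm (y - y))"
      using h mem[OF s] X y unfolding smooth_on_def by blast
    then show ?thesis by simp
  qed
  \<comment> \<open>The sign of L is not given. If x and x' differ, the Lipschitz inequality between
    them forces 0 \<le> L.\<close>
  have L0: "L * norm (s *\<^sub>R (x' - x)) \<le> L * norm (x' - x)"
  proof (cases "x = x'")
    case False
    have "0 \<le> L * norm (x - x')"
    proof -
      have "norm (grad_x h x y - grad_x h x' y) \<le> L * (norm (x - x') + norm (y - y))"
        using h X y unfolding smooth_on_def by blast
      then show ?thesis
        using norm_ge_zero[of "grad_x h x y - grad_x h x' y"] by (simp del: norm_ge_zero)
    qed
    with False have "0 \<le> L" by (simp add: zero_le_mult_iff)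
    then show ?thesis using s by (intro mult_left_mono) (auto intro: mult_left_le_one_le)
  qed simp
  have "\<bar>h x' y - h x y - (x' - x) \<bullet> grad_x h x y\<bar> = \<bar>(x' - x) \<bullet> (grad_x h (?p s) y - grad_x h x y)\<bar>"
    by (simp add: eq inner_diff_right)
  also have "\<dots> \<le> norm (x' - x) * norm (grad_x h (?p s) y - grad_x h x y)"
    by (rule Cauchy_Schwarz_ineq2)
  also have "\<dots> \<le> norm (x' - x) * (L * norm (x' - x))"
    using L L0 by (intro mult_left_mono) auto
  finally show ?thesis by (simp add: power2_eq_square mult_ac)
qed

section \<open>The regularized saddle point problem\<close>

text \<open>
  \<open>saddle_op gF gf\<close> is the operator \<open>(- \<nabla>\<^sub>y \<psi>, \<nabla>\<^sub>z \<psi>)\<close> and \<open>upper_dir gF gf\<close> is \<open>\<nabla>\<^sub>x \<psi>\<close>, with the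
  partial gradients of \<open>F\<close> and \<open>f\<close> as parameters: both the mean and the sampled gradients are
  plugged in.
\<close>

definition saddle_op ::
  "('a \<Rightarrow> 'b \<Rightarrow> 'b::real_inner) \<Rightarrow> ('a \<Rightarrow> 'b \<Rightarrow> 'b) \<Rightarrow> real \<Rightarrow> real \<Rightarrow> real \<Rightarrow> 'a \<Rightarrow> 'b \<times> 'b \<Rightarrow> 'b \<times> 'b"
  where "saddle_op gF gf \<rho> \<sigma> \<delta> x u =
    (- gF x (fst u) + \<rho> *\<^sub>R gf x (fst u) + \<sigma> *\<^sub>R snd u + \<delta> *\<^sub>R fst u,
     \<rho> *\<^sub>R gf x (snd u) + \<sigma> *\<^sub>R snd u - \<sigma> *\<^sub>R fst u)"

definition upper_dir ::
  "('a \<Rightarrow> 'b \<Rightarrow> 'a::real_inner) \<Rightarrow> ('a \<Rightarrow> 'b \<Rightarrow> 'a) \<Rightarrow> real \<Rightarrow> 'a \<Rightarrow> 'b \<times> 'b \<Rightarrow> 'a"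
  where "upper_dir gF gf \<rho> x u = gF x (fst u) - \<rho> *\<^sub>R (gf x (fst u) - gf x (snd u))"

lemma psi_has_derivative_y:
  assumes "(F x has_derivative (\<lambda>h. h \<bullet> a)) (at y)" "(f x has_derivative (\<lambda>h. h \<bullet> b)) (at y)"
  shows "((\<lambda>y. psi F f \<rho> \<sigma> \<delta> x y z) has_derivative
    (\<lambda>h. h \<bullet> (a - \<rho> *\<^sub>R b - \<sigma> *\<^sub>R z - \<delta> *\<^sub>R y))) (at y)"
  unfolding psi_def power2_norm_eq_inner
  using assms by (auto intro!: derivative_eq_intros simp: algebra_simps inner_commute)

lemma psi_has_derivative_z:
  assumes "(f x has_derivative (\<lambda>h. h \<bullet> b)) (at z)"
  shows "((\<lambda>z. psi F f \<rho> \<sigma> \<delta> x y z) has_derivative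
    (\<lambda>h. h \<bullet> (\<rho> *\<^sub>R b + \<sigma> *\<^sub>R z - \<sigma> *\<^sub>R y))) (at z)"
  unfolding psi_def power2_norm_eq_inner
  using assms by (auto intro!: derivative_eq_intros simp: algebra_simps inner_commute)

lemma psi_has_derivative_x:
  assumes "((\<lambda>x. F x y) has_derivative (\<lambda>h. h \<bullet> a)) (at x)"
    "((\<lambda>x. f x y) has_derivative (\<lambda>h. h \<bullet> b)) (at x)"
    "((\<lambda>x. f x z) has_derivative (\<lambda>h. h \<bullet> c)) (at x)"
  shows "((\<lambda>x. psi F f \<rho> \<sigma> \<delta> x y z) has_derivative (\<lambda>h. h \<bullet> (a - \<rho> *\<^sub>R (b - c)))) (at x)"
  unfolding psi_def using assms by (auto intro!: derivative_eq_intros simp: algebra_simps)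

text \<open>A real supremum is meaningful only over a bounded set, hence \<open>bdd\<close>. Testing
  every supremum with \<open>fst u\<close> bounds the infimum from below, and z =
  \<open>snd u\<close> attains it.\<close>

lemma is_saddle_value:
  assumes Y: "Y \<noteq> {}" and u: "is_saddle Y (\<psi> x) u"
    and bdd: "\<And>z. z \<in> Y \<Longrightarrow> bdd_above ((\<lambda>y. \<psi> x y z) ` Y)"
  shows "min_max Y \<psi> x = \<psi> x (fst u) (snd u)"
proof -
  have uY: "fst u \<in> Y" "snd u \<in> Y"
    and y: "\<And>y. y \<in> Y \<Longrightarrow> \<psi> x y (snd u) \<le> \<psi> x (fst u) (snd u)"
    and z: "\<And>z. z \<in> Y \<Longrightarrow> \<psi> x (fst u) (snd u) \<le> \<psi> x (fst u) z"
    using u by (auto simp: is_saddle_def)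
  have lower: "\<psi> x (fst u) (snd u) \<le> (SUP y\<in>Y. \<psi> x y z)" if "z \<in> Y" for z
    by (rule order_trans[OF z[OF that] cSUP_upper[OF uY(1) bdd[OF that]]])
  have "(SUP y\<in>Y. \<psi> x y (snd u)) \<le> \<psi> x (fst u) (snd u)"
    using Y y by (intro cSUP_least)
  then have "min_max Y \<psi> x \<le> \<psi> x (fst u) (snd u)"
    unfolding min_max_def using lower uY(2)
    by (intro cINF_lower2[OF bdd_belowI2[of Y "\<psi> x (fst u) (snd u)"]]) auto
  moreover have "\<psi> x (fst u) (snd u) \<le> min_max Y \<psi> x"
    unfolding min_max_def using Y lower by (intro cINF_greatest)
  ultimately show ?thesis by simp
qed

section \<open>Strongly monotone variational inequalities\<close>

definition is_vi_sol :: "'a::real_inner set \<Rightarrow> ('a \<Rightarrow> 'a) \<Rightarrow> 'a \<Rightarrow> bool" where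
  "is_vi_sol S T u \<longleftrightarrow> u \<in> S \<and> (\<forall>v\<in>S. 0 \<le> T u \<bullet> (v - u))"

text \<open>Add the two inequalities, each tested with the solution of the other. With equal
  operators this is uniqueness; otherwise the shift of the solution is measured by the operator
  error at v alone.\<close>

lemma vi_sol_perturbation:
  assumes mono: "\<mu> * (norm (u - v))\<^sup>2 \<le> (T u - T v) \<bullet> (u - v)"
    and u: "is_vi_sol S T u" and v: "is_vi_sol S T' v"
  shows "\<mu> * norm (u - v) \<le> norm (T v - T' v)"
proof (cases "u = v")
  case False
  have "0 \<le> T u \<bullet> (v - u)" "0 \<le> T' v \<bullet> (u - v)"
    using u v by (auto simp: is_vi_sol_def)
  then have "(T u - T v) \<bullet> (u - v) \<le> (T' v - T v) \<bullet> (u - v)"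
    by (simp add: inner_diff_left inner_diff_right)
  also have "\<dots> \<le> norm (T' v - T v) * norm (u - v)"
    by (rule norm_cauchy_schwarz)
  finally have "(\<mu> * norm (u - v)) * norm (u - v) \<le> norm (T v - T' v) * norm (u - v)"
    using mono by (simp add: power2_eq_square norm_minus_commute)
  then show ?thesis using False by simp
qed simp

text \<open>In the expanded square the term \<beta>^2 L^2 uses up at most half of the gain 2 \<beta>
  \<mu>, by the bound on \<beta>.\<close>

lemma gradient_step_contraction:
  assumes mono: "\<mu> * (norm (u - v))\<^sup>2 \<le> (T u - T v) \<bullet> (u - v)"
    and lip: "norm (T u - T v) \<le> L * norm (u - v)"
    and \<beta>: "0 \<le> \<beta>" "\<beta> * L\<^sup>2 \<le> \<mu>"
  shows "(norm ((u - \<beta> *\<^sub>R T u) - (v - \<beta> *\<^sub>R T v)))\<^sup>2 \<le> (1 - \<beta> * \<mu>) * (norm (u - v))\<^sup>2"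
proof -
  have "(norm ((u - \<beta> *\<^sub>R T u) - (v - \<beta> *\<^sub>R T v)))\<^sup>2
      = (norm ((u - v) - \<beta> *\<^sub>R (T u - T v)))\<^sup>2"
    by (simp add: algebra_simps)
  also have "\<dots> = (norm (u - v))\<^sup>2 - 2 * \<beta> * ((T u - T v) \<bullet> (u - v)) + \<beta>\<^sup>2 * (norm (T u - T v))\<^sup>2"
    unfolding power2_norm_eq_inner
    by (simp only: inner_diff_left inner_diff_right inner_scaleR_left inner_scaleR_right)
       (simp add: algebra_simps power2_eq_square inner_commute)
  also have "\<dots> \<le> (norm (u - v))\<^sup>2 - 2 * \<beta> * (\<mu> * (norm (u - v))\<^sup>2) + \<beta> * (\<beta> * L\<^sup>2) * (norm (u - v))\<^sup>2"
  proof -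
    have "(norm (T u - T v))\<^sup>2 \<le> (L * norm (u - v))\<^sup>2"
      by (rule power_mono[OF lip]) simp
    then have "\<beta>\<^sup>2 * (norm (T u - T v))\<^sup>2 \<le> \<beta>\<^sup>2 * (L * norm (u - v))\<^sup>2"
      by (intro mult_left_mono) auto
    moreover have "2 * \<beta> * (\<mu> * (norm (u - v))\<^sup>2) \<le> 2 * \<beta> * ((T u - T v) \<bullet> (u - v))"
      using \<beta> mono by (intro mult_left_mono) auto
    ultimately show ?thesis by (simp add: power_mult_distrib power2_eq_square mult_ac)
  qed
  also have "\<dots> \<le> (norm (u - v))\<^sup>2 - 2 * \<beta> * (\<mu> * (norm (u - v))\<^sup>2) + \<beta> * \<mu> * (norm (u - v))\<^sup>2"
    using \<beta> by (intro add_left_mono mult_right_mono mult_left_mono) auto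
  finally show ?thesis by (simp add: algebra_simps)
qed

text \<open>The obtuse angle criterion for the projection at u is the variational inequality
  multiplied by \<beta>.\<close>

lemma vi_sol_iff_fixed_point:
  fixes S :: "'a::euclidean_space set"
  assumes S: "convex S" "closed S" "S \<noteq> {}" and \<beta>: "0 < \<beta>"
  shows "is_vi_sol S T u \<longleftrightarrow> closest_point S (u - \<beta> *\<^sub>R T u) = u"
proof
  assume u: "is_vi_sol S T u"
  show "closest_point S (u - \<beta> *\<^sub>R T u) = u"
    by (rule closest_point_eqI) (use u S \<beta> in \<open>auto simp: is_vi_sol_def\<close>)
next
  assume u: "closest_point S (u - \<beta> *\<^sub>R T u) = u"
  have "u \<in> S" using closest_point_in_set[OF S(2,3)] u by metis
  moreover have "0 \<le> T u \<bullet> (v - u)" if "v \<in> S" for v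
    using closest_point_dot[OF S(1,2) that, of "u - \<beta> *\<^sub>R T u"] \<beta> by (simp add: u zero_le_mult_iff)
  ultimately show "is_vi_sol S T u" by (simp add: is_vi_sol_def)
qed

lemma strongly_monotone_vi_sol_exists:
  fixes S :: "'a::euclidean_space set"
  assumes S: "convex S" "closed S" "S \<noteq> {}" and \<mu>: "0 < \<mu>"
    and mono: "\<And>u v. u \<in> S \<Longrightarrow> v \<in> S \<Longrightarrow> \<mu> * (norm (u - v))\<^sup>2 \<le> (T u - T v) \<bullet> (u - v)"
    and lip: "\<And>u v. u \<in> S \<Longrightarrow> v \<in> S \<Longrightarrow> norm (T u - T v) \<le> L * norm (u - v)"
  shows "\<exists>u. is_vi_sol S T u"
proof -
  \<comment> \<open>Taking at least 1 and at least \<mu> yields \<beta> * \<mu> \<le> 1, so the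
    contraction factor below is the square root of a nonnegative number.\<close>
  define L' where "L' = max 1 (max \<bar>L\<bar> \<mu>)"
  have L': "1 \<le> L'" "\<bar>L\<bar> \<le> L'" "\<mu> \<le> L'" by (auto simp: L'_def)
  define \<beta> where "\<beta> = \<mu> / L'\<^sup>2"
  have \<beta>: "0 < \<beta>" "\<beta> * L'\<^sup>2 \<le> \<mu>" using \<mu> L' by (auto simp: \<beta>_def)
  have "\<mu> * \<mu> \<le> L'\<^sup>2" using L' \<mu> by (auto simp: power2_eq_square intro: mult_mono)
  then have \<beta>\<mu>: "\<beta> * \<mu> \<le> 1" "0 < \<beta> * \<mu>" using L' \<mu> \<beta> by (auto simp: \<beta>_def field_simps)
  let ?f = "\<lambda>u. closest_point S (u - \<beta> *\<^sub>R T u)"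
  have "\<exists>!u\<in>S. ?f u = u"
  proof (rule Banach_fix)
    show "Topological_Spaces.complete S" using S by (simp add: complete_eq_closed)
    show "0 \<le> sqrt (1 - \<beta> * \<mu>)" "sqrt (1 - \<beta> * \<mu>) < 1" using \<beta>\<mu> by auto
    show "?f ` S \<subseteq> S" using S closest_point_in_set by auto
    fix u v assume uv: "u \<in> S" "v \<in> S"
    have "norm (T u - T v) \<le> L' * norm (u - v)"
      by (rule order_trans[OF lip[OF uv]]) (use L' in \<open>auto intro: mult_right_mono\<close>)
    with mono[OF uv] have *: "(norm ((u - \<beta> *\<^sub>R T u) - (v - \<beta> *\<^sub>R T v)))\<^sup>2
        \<le> (1 - \<beta> * \<mu>) * (norm (u - v))\<^sup>2"
      using \<beta> by (intro gradient_step_contraction[where L = L']) auto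
    have "norm (?f u - ?f v) \<le> norm ((u - \<beta> *\<^sub>R T u) - (v - \<beta> *\<^sub>R T v))"
      by (rule closest_point_nonexpansive[OF S])
    also have "\<dots> \<le> sqrt (1 - \<beta> * \<mu>) * norm (u - v)"
      using real_sqrt_le_mono[OF *] by (simp add: real_sqrt_mult)
    finally show "dist (?f u) (?f v) \<le> sqrt (1 - \<beta> * \<mu>) * dist u v"
      by (simp add: dist_norm)
  qed (use S in auto)
  then show ?thesis using vi_sol_iff_fixed_point[OF S \<beta>(1)] by blast
qed

section \<open>The saddle operator of the bilevel problem\<close>

text \<open>One L serves F and f, and \<open>1 \<le> L\<close> lets it also dominate the linear
  terms of the operator. \<open>sol_bounded\<close> is the local boundedness of lower-level
  solutions for the bounded set X itself.\<close>

locale bilevel =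
  fixes X :: "'a::euclidean_space set" and Y :: "'b::euclidean_space set"
    and F f :: "'a \<Rightarrow> 'b \<Rightarrow> real" and L :: real
  assumes X: "X \<noteq> {}" "compact X" "convex X"
    and Y: "Y \<noteq> {}" "closed Y" "convex Y"
    and L: "1 \<le> L" and F_smooth: "smooth_on X Y L F" and f_smooth: "smooth_on X Y L f"
    and F_concave: "x \<in> X \<Longrightarrow> concave_on Y (F x)"
    and f_convex: "x \<in> X \<Longrightarrow> convex_on Y (f x)"
    and F_coercive: "x \<in> X \<Longrightarrow> filterlim (F x) at_bot (inf at_infinity (principal Y))"
    and sol_bounded: "\<exists>Dy\<subseteq>Y. bounded Dy \<and> (\<forall>x\<in>X. lower_sol f Y x \<inter> Dy \<noteq> {})"
begin

lemma YY: "convex (Y \<times> Y)" "closed (Y \<times> Y)" "Y \<times> Y \<noteq> {}"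
  using Y by (auto simp: convex_Times closed_Times)

lemma deriv_F_y: "x \<in> X \<Longrightarrow> y \<in> Y \<Longrightarrow> (F x has_derivative (\<lambda>v. v \<bullet> grad_y F x y)) (at y)"
  and deriv_f_y: "x \<in> X \<Longrightarrow> y \<in> Y \<Longrightarrow> (f x has_derivative (\<lambda>v. v \<bullet> grad_y f x y)) (at y)"
  using F_smooth f_smooth by (auto simp: smooth_on_def)

lemma lip_F_x: "x \<in> X \<Longrightarrow> y \<in> Y \<Longrightarrow> x' \<in> X \<Longrightarrow> y' \<in> Y \<Longrightarrow>
    norm (grad_x F x y - grad_x F x' y') \<le> L * (norm (x - x') + norm (y - y'))"
  and lip_F_y: "x \<in> X \<Longrightarrow> y \<in> Y \<Longrightarrow> x' \<in> X \<Longrightarrow> y' \<in> Y \<Longrightarrow>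
    norm (grad_y F x y - grad_y F x' y') \<le> L * (norm (x - x') + norm (y - y'))"
  and lip_f_x: "x \<in> X \<Longrightarrow> y \<in> Y \<Longrightarrow> x' \<in> X \<Longrightarrow> y' \<in> Y \<Longrightarrow>
    norm (grad_x f x y - grad_x f x' y') \<le> L * (norm (x - x') + norm (y - y'))"
  and lip_f_y: "x \<in> X \<Longrightarrow> y \<in> Y \<Longrightarrow> x' \<in> X \<Longrightarrow> y' \<in> Y \<Longrightarrow>
    norm (grad_y f x y - grad_y f x' y') \<le> L * (norm (x - x') + norm (y - y'))"
  using F_smooth f_smooth by (auto simp: smooth_on_def)

abbreviation T where "T \<equiv> saddle_op (grad_y F) (grad_y f)"
abbreviation gx where "gx \<equiv> upper_dir (grad_x F) (grad_x f)"

lemma F_first_order: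
  assumes "x \<in> X" "y \<in> Y" "y' \<in> Y"
  shows "F x y' \<le> F x y + (y' - y) \<bullet> grad_y F x y"
proof -
  have "((\<lambda>y. - F x y) has_derivative (\<lambda>v. v \<bullet> (- grad_y F x y))) (at y)"
    using deriv_F_y[OF assms(1,2)] by (auto intro!: derivative_eq_intros)
  then have "- F x y + (y' - y) \<bullet> (- grad_y F x y) \<le> - F x y'"
    using F_concave[OF assms(1)] assms unfolding concave_on_def
    by (intro convex_first_order[where S = Y]) 
  then show ?thesis by simp
qed

lemma f_first_order:
  assumes "x \<in> X" "y \<in> Y" "y' \<in> Y"
  shows "f x y + (y' - y) \<bullet> grad_y f x y \<le> f x y'"
  using assms by (intro convex_first_order[OF f_convex _ _ deriv_f_y])

text \<open>-\<nabla>F and \<nabla>f are monotone in y by the first-order inequalities, the coupling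
  terms \<sigma> z and -\<sigma> y are skew and cancel, and the regularization contributes \<delta>
  in y and \<sigma> in z.\<close>

lemma saddle_op_strongly_monotone:
  assumes x: "x \<in> X" and uv: "u \<in> Y \<times> Y" "v \<in> Y \<times> Y" and \<rho>: "0 \<le> \<rho>"
  shows "min \<sigma> \<delta> * (norm (u - v))\<^sup>2 \<le> (T \<rho> \<sigma> \<delta> x u - T \<rho> \<sigma> \<delta> x v) \<bullet> (u - v)"
proof -
  obtain y z y' z' where u: "u = (y, z)" "v = (y', z')" by fastforce
  have Y: "y \<in> Y" "z \<in> Y" "y' \<in> Y" "z' \<in> Y" using uv u by auto
  have F: "(grad_y F x y - grad_y F x y') \<bullet> (y - y') \<le> 0"
    using F_first_order[OF x Y(1,3)] F_first_order[OF x Y(3,1)]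
    by (simp add: algebra_simps inner_commute)
  have f1: "0 \<le> (grad_y f x y - grad_y f x y') \<bullet> (y - y')"
    using f_first_order[OF x Y(1,3)] f_first_order[OF x Y(3,1)]
    by (simp add: algebra_simps inner_commute)
  have f2: "0 \<le> (grad_y f x z - grad_y f x z') \<bullet> (z - z')"
    using f_first_order[OF x Y(2,4)] f_first_order[OF x Y(4,2)]
    by (simp add: algebra_simps inner_commute)
  have "min \<sigma> \<delta> * (norm (u - v))\<^sup>2 = min \<sigma> \<delta> * (norm (y - y'))\<^sup>2 + min \<sigma> \<delta> * (norm (z - z'))\<^sup>2"
    by (simp add: u norm_Pair algebra_simps)
  also have "\<dots> \<le> \<delta> * (norm (y - y'))\<^sup>2 + \<sigma> * (norm (z - z'))\<^sup>2"
    by (intro add_mono mult_right_mono) auto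
  also have "\<dots> \<le> - ((grad_y F x y - grad_y F x y') \<bullet> (y - y')) + \<rho> * ((grad_y f x y - grad_y f x y') \<bullet> (y - y'))
     + \<rho> * ((grad_y f x z - grad_y f x z') \<bullet> (z - z')) + \<delta> * (norm (y - y'))\<^sup>2 + \<sigma> * (norm (z - z'))\<^sup>2"
    using F mult_nonneg_nonneg[OF \<rho> f1] mult_nonneg_nonneg[OF \<rho> f2] by linarith
  also have "\<dots> = (T \<rho> \<sigma> \<delta> x u - T \<rho> \<sigma> \<delta> x v) \<bullet> (u - v)"
    unfolding u saddle_op_def power2_norm_eq_inner by (simp add: algebra_simps inner_commute)
  finally show ?thesis .
qed

lemma saddle_op_lipschitz:
  assumes "x \<in> X" "x' \<in> X" and uv: "u \<in> Y \<times> Y" "v \<in> Y \<times> Y" and p: "0 \<le> \<rho>" "0 \<le> \<sigma>" "0 \<le> \<delta>"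
  shows "norm (T \<rho> \<sigma> \<delta> x u - T \<rho> \<sigma> \<delta> x' v) \<le> 3 * L * (1 + \<rho> + \<sigma> + \<delta>) * (norm (x - x') + norm (u - v))"
proof -
  obtain y z y' z' where u: "u = (y, z)" "v = (y', z')" by fastforce
  have Y: "y \<in> Y" "z \<in> Y" "y' \<in> Y" "z' \<in> Y" using uv u by auto
  define n where "n = norm (x - x') + norm (u - v)"
  have n: "norm (x - x') + norm (y - y') \<le> n" "norm (x - x') + norm (z - z') \<le> n"
    using norm_fst_bound[of "u - v"] norm_snd_bound[of "u - v"] by (auto simp: n_def u)
  have n0: "norm (y - y') \<le> n" "norm (z - z') \<le> n" "0 \<le> n"
    using n norm_ge_zero[of "x - x'"] norm_ge_zero[of "y - y'"]  by linarith+
  have L0: "0 \<le> L" using L by simp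
  have F: "norm (grad_y F x y - grad_y F x' y') \<le> L * n"
    and f1: "norm (grad_y f x y - grad_y f x' y') \<le> L * n"
    and f2: "norm (grad_y f x z - grad_y f x' z') \<le> L * n"
    using assms(1,2) Y n L0
    by (blast intro: order_trans[OF lip_F_y] order_trans[OF lip_f_y] mult_left_mono)+
  have n1: "norm (y - y') \<le> L * n" "norm (z - z') \<le> L * n"
    using n0 L mult_right_mono[OF L n0(3)] by auto
  have "norm (fst (T \<rho> \<sigma> \<delta> x u - T \<rho> \<sigma> \<delta> x' v)) = norm (- (grad_y F x y - grad_y F x' y') +
      (\<rho> *\<^sub>R (grad_y f x y - grad_y f x' y') + (\<sigma> *\<^sub>R (z - z') + \<delta> *\<^sub>R (y - y'))))"
    by (simp add: saddle_op_def u algebra_simps)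
  also have "\<dots> \<le> L * n + (\<rho> * (L * n) + (\<sigma> * (L * n) + \<delta> * (L * n)))"
    using F f1 n1 p by (intro norm_triangle_mono) (auto intro: mult_left_mono simp: norm_minus_commute)
  finally have A: "norm (fst (T \<rho> \<sigma> \<delta> x u - T \<rho> \<sigma> \<delta> x' v)) \<le> L * (1 + \<rho> + \<sigma> + \<delta>) * n"
    by (simp add: algebra_simps)
  have "norm (snd (T \<rho> \<sigma> \<delta> x u - T \<rho> \<sigma> \<delta> x' v)) = norm (
      \<rho> *\<^sub>R (grad_y f x z - grad_y f x' z') + (\<sigma> *\<^sub>R (z - z') + (- \<sigma>) *\<^sub>R (y - y')))"
    by (simp add: saddle_op_def u algebra_simps)
  also have "\<dots> \<le> \<rho> * (L * n) + (\<sigma> * (L * n) + \<sigma> * (L * n))"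
    using f2 n1 p by (intro norm_triangle_mono) (auto intro: mult_left_mono)
  also have "\<dots> \<le> 2 * (L * (1 + \<rho> + \<sigma> + \<delta>) * n)"
    using mult_nonneg_nonneg[OF L0 n0(3)] mult_nonneg_nonneg[OF p(1) mult_nonneg_nonneg[OF L0 n0(3)]]
      mult_nonneg_nonneg[OF p(3) mult_nonneg_nonneg[OF L0 n0(3)]]
    by (simp add: algebra_simps)
  finally show ?thesis
    using A norm_le_fst_snd[of "T \<rho> \<sigma> \<delta> x u - T \<rho> \<sigma> \<delta> x' v"]
    unfolding n_def by (simp add: algebra_simps)
qed

lemma upper_dir_lipschitz:
  assumes "x \<in> X" "x' \<in> X" and uv: "u \<in> Y \<times> Y" "v \<in> Y \<times> Y" and p: "0 \<le> \<rho>"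
  shows "norm (gx \<rho> x u - gx \<rho> x' v) \<le> 2 * L * (1 + \<rho>) * (norm (x - x') + norm (u - v))"
proof -
  obtain y z y' z' where u: "u = (y, z)" "v = (y', z')" by fastforce
  have Y: "y \<in> Y" "z \<in> Y" "y' \<in> Y" "z' \<in> Y" using uv u by auto
  define n where "n = norm (x - x') + norm (u - v)"
  have n: "norm (x - x') + norm (y - y') \<le> n" "norm (x - x') + norm (z - z') \<le> n" "0 \<le> n"
    using norm_fst_bound[of "u - v"] norm_snd_bound[of "u - v"] by (auto simp: n_def u)
  have L0: "0 \<le> L" using L by simp
  have F: "norm (grad_x F x y - grad_x F x' y') \<le> L * n"
    and f1: "norm (grad_x f x y - grad_x f x' y') \<le> L * n"
    and f2: "norm (grad_x f x z - grad_x f x' z') \<le> L * n"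
    using assms(1,2) Y n L0
    by (blast intro: order_trans[OF lip_F_x] order_trans[OF lip_f_x] mult_left_mono)+
  have "norm (gx \<rho> x u - gx \<rho> x' v) = norm ((grad_x F x y - grad_x F x' y') +
      ((- \<rho>) *\<^sub>R (grad_x f x y - grad_x f x' y') + \<rho> *\<^sub>R (grad_x f x z - grad_x f x' z')))"
    by (simp add: upper_dir_def u algebra_simps)
  also have "\<dots> \<le> L * n + (\<rho> * (L * n) + \<rho> * (L * n))"
    using F f1 f2 p by (intro norm_triangle_mono) (auto intro: mult_left_mono)
  also have "\<dots> \<le> 2 * L * (1 + \<rho>) * n"
    using mult_nonneg_nonneg[OF L0 n(3)] by (simp add: algebra_simps)
  finally show ?thesis unfolding n_def .
qed

text \<open>For fixed u the operator is affine in (\<rho>, \<sigma>, \<delta>), with the gradients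
  of f and the components of u as coefficients. This serves the drift of the parameters and, by
  comparison with zero parameters, the size of the operator itself.\<close>

lemma saddle_op_param:
  shows "norm (T \<rho>' \<sigma>' \<delta>' x u - T \<rho> \<sigma> \<delta> x u)
    \<le> (\<bar>\<rho>' - \<rho>\<bar> + \<bar>\<sigma>' - \<sigma>\<bar> + \<bar>\<delta>' - \<delta>\<bar>) *
       (norm (grad_y f x (fst u)) + norm (grad_y f x (snd u)) + 2 * norm (fst u) + 2 * norm (snd u))"
proof -
  obtain y z where u: "u = (y, z)" by fastforce
  let ?d = "\<bar>\<rho>' - \<rho>\<bar> + \<bar>\<sigma>' - \<sigma>\<bar> + \<bar>\<delta>' - \<delta>\<bar>"
  have "norm (fst (T \<rho>' \<sigma>' \<delta>' x u - T \<rho> \<sigma> \<delta> x u)) = norm (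
      (\<rho>' - \<rho>) *\<^sub>R grad_y f x y + ((\<sigma>' - \<sigma>) *\<^sub>R z + (\<delta>' - \<delta>) *\<^sub>R y))"
    by (simp add: saddle_op_def u algebra_simps)
  also have "\<dots> \<le> ?d * norm (grad_y f x y) + (?d * norm z + ?d * norm y)"
    by (intro norm_triangle_mono) (auto intro!: mult_right_mono)
  finally have A: "norm (fst (T \<rho>' \<sigma>' \<delta>' x u - T \<rho> \<sigma> \<delta> x u)) \<le> \<dots>" .
  have "norm (snd (T \<rho>' \<sigma>' \<delta>' x u - T \<rho> \<sigma> \<delta> x u)) = norm (
      (\<rho>' - \<rho>) *\<^sub>R grad_y f x z + ((\<sigma>' - \<sigma>) *\<^sub>R z + (\<sigma> - \<sigma>') *\<^sub>R y))"
    by (simp add: saddle_op_def u algebra_simps)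
  also have "\<dots> \<le> ?d * norm (grad_y f x z) + (?d * norm z + ?d * norm y)"
    by (intro norm_triangle_mono) (auto intro!: mult_right_mono)
  finally show ?thesis
    using A norm_le_fst_snd[of "T \<rho>' \<sigma>' \<delta>' x u - T \<rho> \<sigma> \<delta> x u"]
    unfolding u by (simp add: algebra_simps)
qed

subsection \<open>Saddle points\<close>

text \<open>\<psi> is concave in y and convex in z: the first-order bounds treat F and f, the
  quadratic terms expand exactly, and their remainders have the favourable sign.\<close>

lemma vi_sol_imp_saddle:
  assumes x: "x \<in> X" and p: "0 \<le> \<rho>" "0 \<le> \<sigma>" "0 \<le> \<delta>"
    and u: "is_vi_sol (Y \<times> Y) (T \<rho> \<sigma> \<delta> x) u"
  shows "is_saddle Y (psi F f \<rho> \<sigma> \<delta> x) u"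
proof -
  obtain y z where uyz: "u = (y, z)" by fastforce
  have Y: "y \<in> Y" "z \<in> Y" using u uyz by (auto simp: is_vi_sol_def)
  have vi: "0 \<le> T \<rho> \<sigma> \<delta> x u \<bullet> ((y', z') - u)" if "y' \<in> Y" "z' \<in> Y" for y' z'
    using u that by (auto simp: is_vi_sol_def)
  have "psi F f \<rho> \<sigma> \<delta> x y' z \<le> psi F f \<rho> \<sigma> \<delta> x y z" if y': "y' \<in> Y" for y'
  proof -
    have "0 \<le> (- grad_y F x y + \<rho> *\<^sub>R grad_y f x y + \<sigma> *\<^sub>R z + \<delta> *\<^sub>R y) \<bullet> (y' - y)"
      using vi[OF y' Y(2)] by (simp add: uyz saddle_op_def)
    moreover have "\<rho> * (f x y + (y' - y) \<bullet> grad_y f x y) \<le> \<rho> * f x y'"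
      using f_first_order[OF x Y(1) y'] p by (intro mult_left_mono)
    moreover have "\<delta> / 2 * (norm y')\<^sup>2 = \<delta> / 2 * (norm y)\<^sup>2 + \<delta> * (y \<bullet> (y' - y)) + \<delta> / 2 * (norm (y' - y))\<^sup>2"
      unfolding power2_norm_eq_inner by (simp add: algebra_simps inner_commute) 
    moreover have "0 \<le> \<delta> / 2 * (norm (y' - y))\<^sup>2" using p by simp
    ultimately show ?thesis
      using F_first_order[OF x Y(1) y'] by (simp add: psi_def algebra_simps inner_commute)
  qed
  moreover have "psi F f \<rho> \<sigma> \<delta> x y z \<le> psi F f \<rho> \<sigma> \<delta> x y z'" if z': "z' \<in> Y" for z'
  proof -
    have "0 \<le> (\<rho> *\<^sub>R grad_y f x z + \<sigma> *\<^sub>R z - \<sigma> *\<^sub>R y) \<bullet> (z' - z)"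
      using vi[OF Y(1) z'] by (simp add: uyz saddle_op_def)
    moreover have "\<rho> * (f x z + (z' - z) \<bullet> grad_y f x z) \<le> \<rho> * f x z'"
      using f_first_order[OF x Y(2) z'] p by (intro mult_left_mono)
    moreover have "\<sigma> / 2 * (norm z')\<^sup>2 = \<sigma> / 2 * (norm z)\<^sup>2 + \<sigma> * (z \<bullet> (z' - z)) + \<sigma> / 2 * (norm (z' - z))\<^sup>2"
      unfolding power2_norm_eq_inner by (simp add: algebra_simps inner_commute)
    moreover have "0 \<le> \<sigma> / 2 * (norm (z' - z))\<^sup>2" using p by simp
    ultimately show ?thesis
      by (simp add: psi_def algebra_simps inner_commute)
  qed
  ultimately show ?thesis using Y by (simp add: is_saddle_def uyz)
qed

text \<open>The optimality conditions of -\<psi> in y and of \<psi> in z are the two components of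
  the inequality and add up to it.\<close>

lemma saddle_imp_vi_sol:
  assumes x: "x \<in> X" and u: "is_saddle Y (psi F f \<rho> \<sigma> \<delta> x) u"
  shows "is_vi_sol (Y \<times> Y) (T \<rho> \<sigma> \<delta> x) u"
proof -
  obtain y z where uyz: "u = (y, z)" by fastforce
  have Yu: "y \<in> Y" "z \<in> Y" using u uyz by (auto simp: is_saddle_def)
  have "0 \<le> T \<rho> \<sigma> \<delta> x u \<bullet> (v - u)" if "v \<in> Y \<times> Y" for v
  proof -
    obtain y' z' where v: "v = (y', z')" by fastforce
    have Yv: "y' \<in> Y" "z' \<in> Y" using that v by auto
    have "((\<lambda>y. - psi F f \<rho> \<sigma> \<delta> x y z) has_derivative
        (\<lambda>h. h \<bullet> (- (grad_y F x y - \<rho> *\<^sub>R grad_y f x y - \<sigma> *\<^sub>R z - \<delta> *\<^sub>R y)))) (at y)"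
      using has_derivative_minus[OF psi_has_derivative_y[where z = z and F = F and f = f and x = x,
            OF deriv_F_y[OF x Yu(1)] deriv_f_y[OF x Yu(1)]]]
      by (simp only: inner_minus_right)
    from minimizer_first_order[OF Y(3) Yu(1) Yv(1) _ this]
    have "0 \<le> (y' - y) \<bullet> (- (grad_y F x y - \<rho> *\<^sub>R grad_y f x y - \<sigma> *\<^sub>R z - \<delta> *\<^sub>R y))"
      using u by (simp add: is_saddle_def uyz)
    moreover from minimizer_first_order[OF Y(3) Yu(2) Yv(2) _ psi_has_derivative_z[where F = F and \<rho> = \<rho>
          and \<sigma> = \<sigma> and \<delta> = \<delta> and y = y and f = f and x = x, OF deriv_f_y[OF x Yu(2)]]]
    have "0 \<le> (z' - z) \<bullet> (\<rho> *\<^sub>R grad_y f x z + \<sigma> *\<^sub>R z - \<sigma> *\<^sub>R y)"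
      using u by (simp add: is_saddle_def uyz)
    ultimately show ?thesis
      by (simp add: uyz v saddle_op_def algebra_simps inner_commute)
  qed
  then show ?thesis using Yu by (simp add: is_vi_sol_def uyz)
qed

abbreviation us where "us \<rho> \<sigma> \<delta> \<equiv> saddle Y (psi F f \<rho> \<sigma> \<delta>)"
abbreviation phi where "phi \<rho> \<sigma> \<delta> \<equiv> min_max Y (psi F f \<rho> \<sigma> \<delta>)"

text \<open>Justifies the definite description in \<open>saddle\<close>: existence by the fixed
  point argument, uniqueness by \<open>vi_sol_perturbation\<close> with both operators
  equal.\<close>

lemma saddle_vi_sol:
  assumes x: "x \<in> X" and p: "0 < \<rho>" "0 < \<sigma>" "0 < \<delta>"
  shows "is_vi_sol (Y \<times> Y) (T \<rho> \<sigma> \<delta> x) (us \<rho> \<sigma> \<delta> x)"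
proof -
  have mono: "min \<sigma> \<delta> * (norm (u - v))\<^sup>2 \<le> (T \<rho> \<sigma> \<delta> x u - T \<rho> \<sigma> \<delta> x v) \<bullet> (u - v)"
    if "u \<in> Y \<times> Y" "v \<in> Y \<times> Y" for u v
    using saddle_op_strongly_monotone[OF x that] p by simp
  have "norm (T \<rho> \<sigma> \<delta> x u - T \<rho> \<sigma> \<delta> x v) \<le> 3 * L * (1 + \<rho> + \<sigma> + \<delta>) * norm (u - v)"
    if "u \<in> Y \<times> Y" "v \<in> Y \<times> Y" for u v
    using saddle_op_lipschitz[OF x x that, of \<rho> \<sigma> \<delta>] p by simp
  moreover have "0 < min \<sigma> \<delta>" using p by simp
  ultimately obtain u where u: "is_vi_sol (Y \<times> Y) (T \<rho> \<sigma> \<delta> x) u"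
    using strongly_monotone_vi_sol_exists[OF YY _ mono] by metis
  have "us \<rho> \<sigma> \<delta> x = u"
    unfolding saddle_def
  proof (rule the_equality)
    show "is_saddle Y (psi F f \<rho> \<sigma> \<delta> x) u" using vi_sol_imp_saddle[OF x _ _ _ u] p by simp
    fix v assume "is_saddle Y (psi F f \<rho> \<sigma> \<delta> x) v"
    then have v: "is_vi_sol (Y \<times> Y) (T \<rho> \<sigma> \<delta> x) v" by (rule saddle_imp_vi_sol[OF x])
    have "min \<sigma> \<delta> * norm (v - u) \<le> norm (T \<rho> \<sigma> \<delta> x u - T \<rho> \<sigma> \<delta> x u)"
      using u v by (intro vi_sol_perturbation[OF mono v u]) (simp_all add: is_vi_sol_def)
    then show "v = u" using \<open>0 < min \<sigma> \<delta>\<close> by (auto simp add: mult_le_0_iff)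
  qed
  with u show ?thesis by simp
qed

lemma saddle_is_saddle:
  assumes "x \<in> X" "0 < \<rho>" "0 < \<sigma>" "0 < \<delta>"
  shows "is_saddle Y (psi F f \<rho> \<sigma> \<delta> x) (us \<rho> \<sigma> \<delta> x)"
  using vi_sol_imp_saddle saddle_vi_sol assms by simp

lemma saddle_in:
  assumes "x \<in> X" "0 < \<rho>" "0 < \<sigma>" "0 < \<delta>"
  shows "us \<rho> \<sigma> \<delta> x \<in> Y \<times> Y"
  using saddle_vi_sol[OF assms] by (simp add: is_vi_sol_def)

lemma saddle_perturbation:
  assumes x: "x \<in> X" "x' \<in> X" and p: "0 < \<rho>" "0 < \<sigma>" "0 < \<delta>" "0 < \<rho>'" "0 < \<sigma>'" "0 < \<delta>'"
  shows "min \<sigma> \<delta> * norm (us \<rho> \<sigma> \<delta> x - us \<rho>' \<sigma>' \<delta>' x')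
    \<le> norm (T \<rho> \<sigma> \<delta> x (us \<rho>' \<sigma>' \<delta>' x') - T \<rho>' \<sigma>' \<delta>' x' (us \<rho>' \<sigma>' \<delta>' x'))"
  using assms by (intro vi_sol_perturbation[OF saddle_op_strongly_monotone saddle_vi_sol saddle_vi_sol])
    (auto intro: saddle_in)

lemma saddle_lipschitz:
  assumes x: "x \<in> X" "x' \<in> X" and p: "0 < \<rho>" "0 < \<sigma>" "0 < \<delta>"
  shows "norm (us \<rho> \<sigma> \<delta> x - us \<rho> \<sigma> \<delta> x') \<le> 3 * L * (1 + \<rho> + \<sigma> + \<delta>) / min \<sigma> \<delta> * norm (x - x')"
proof -
  have "min \<sigma> \<delta> * norm (us \<rho> \<sigma> \<delta> x - us \<rho> \<sigma> \<delta> x') \<le> 3 * L * (1 + \<rho> + \<sigma> + \<delta>) * (norm (x - x') + norm (us \<rho> \<sigma> \<delta> x' - us \<rho> \<sigma> \<delta> x'))"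
    using assms by (intro order_trans[OF saddle_perturbation saddle_op_lipschitz] saddle_in) auto
  then show ?thesis using p by (simp add: pos_le_divide_eq mult.commute)
qed

text \<open>Supplies the boundedness in \<open>is_saddle_value\<close>: strong concavity bounds
  \<psi> by a linear function minus \<delta> / 2 times a square, whose maximum is |g|^2 / (2
  \<delta>).\<close>

lemma psi_bdd_above:
  assumes x: "x \<in> X" and z: "z \<in> Y" and p: "0 < \<rho>" "0 < \<sigma>" "0 < \<delta>"
  shows "bdd_above ((\<lambda>y. psi F f \<rho> \<sigma> \<delta> x y z) ` Y)"
proof -
  obtain y0 where y0: "y0 \<in> Y" using Y by auto
  define g where "g = grad_y F x y0 - \<rho> *\<^sub>R grad_y f x y0 - \<sigma> *\<^sub>R z - \<delta> *\<^sub>R y0"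
  have "psi F f \<rho> \<sigma> \<delta> x y z \<le> psi F f \<rho> \<sigma> \<delta> x y0 z + (norm g)\<^sup>2 / (2 * \<delta>)" if y: "y \<in> Y" for y
  proof -
    have "\<rho> * (f x y0 + (y - y0) \<bullet> grad_y f x y0) \<le> \<rho> * f x y"
      using f_first_order[OF x y0 y] p by (intro mult_left_mono) auto
    moreover have "\<delta> / 2 * (norm y)\<^sup>2 = \<delta> / 2 * (norm y0)\<^sup>2 + \<delta> * (y0 \<bullet> (y - y0)) + \<delta> / 2 * (norm (y - y0))\<^sup>2"
      unfolding power2_norm_eq_inner by (simp add: algebra_simps inner_commute)
    ultimately have "psi F f \<rho> \<sigma> \<delta> x y z \<le> psi F f \<rho> \<sigma> \<delta> x y0 z + (y - y0) \<bullet> g - \<delta> / 2 * (norm (y - y0))\<^sup>2"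
      using F_first_order[OF x y0 y] by (simp add: psi_def g_def algebra_simps inner_commute)
    moreover have "(y - y0) \<bullet> g - \<delta> / 2 * (norm (y - y0))\<^sup>2 \<le> (norm g)\<^sup>2 / (2 * \<delta>)"
    proof -
      have "(norm (g - \<delta> *\<^sub>R (y - y0)))\<^sup>2 = (norm g)\<^sup>2 - 2 * \<delta> * ((y - y0) \<bullet> g) + \<delta>\<^sup>2 * (norm (y - y0))\<^sup>2"
        unfolding power2_norm_eq_inner by (simp add: algebra_simps inner_commute power2_eq_square)
      then have "2 * \<delta> * ((y - y0) \<bullet> g) \<le> (norm g)\<^sup>2 + \<delta>\<^sup>2 * (norm (y - y0))\<^sup>2"
        using zero_le_power2[of "norm (g - \<delta> *\<^sub>R (y - y0))"] by linarith
      then show ?thesis using p by (simp add: field_simps power2_eq_square)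
    qed
    ultimately show ?thesis by simp
  qed
  then show ?thesis by (rule bdd_aboveI2)
qed

lemma phi_eq:
  assumes "x \<in> X" "0 < \<rho>" "0 < \<sigma>" "0 < \<delta>"
  shows "phi \<rho> \<sigma> \<delta> x = psi F f \<rho> \<sigma> \<delta> x (fst (us \<rho> \<sigma> \<delta> x)) (snd (us \<rho> \<sigma> \<delta> x))"
  using assms Y by (intro is_saddle_value saddle_is_saddle psi_bdd_above) auto

lemma phi_le:
  assumes x: "x \<in> X" and p: "0 < \<rho>" "0 < \<sigma>" "0 < \<delta>" and z: "z \<in> Y"
  shows "phi \<rho> \<sigma> \<delta> x \<le> psi F f \<rho> \<sigma> \<delta> x (fst (us \<rho> \<sigma> \<delta> x)) z"
  using saddle_is_saddle[OF x p] z by (auto simp: phi_eq[OF x p] is_saddle_def)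

lemma le_phi:
  assumes x: "x \<in> X" and p: "0 < \<rho>" "0 < \<sigma>" "0 < \<delta>" and y: "y \<in> Y"
  shows "psi F f \<rho> \<sigma> \<delta> x y (snd (us \<rho> \<sigma> \<delta> x)) \<le> phi \<rho> \<sigma> \<delta> x"
  using saddle_is_saddle[OF x p] y by (auto simp: phi_eq[OF x p] is_saddle_def)

end

text \<open>Symmetry, so that \<open>smooth_on_remainder\<close> also covers increments in the
  second argument.\<close>

lemma smooth_on_swap:
  assumes "smooth_on X Y L h"
  shows "smooth_on Y X L (\<lambda>y x. h x y)"
proof -
  have "grad_x (\<lambda>y x. h x y) = (\<lambda>y x. grad_y h x y)" "grad_y (\<lambda>y x. h x y) = (\<lambda>y x. grad_x h x y)"
    by (auto simp: grad_x_def grad_y_def fun_eq_iff)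
  then show ?thesis
    using assms by (auto simp: smooth_on_def add.commute)
qed

text \<open>Two expansions, from (x0, y0) to (x, y0) and on to (x, y). As Y may be unbounded, y is
  confined to a ball.\<close>

lemma smooth_on_bounded:
  assumes h: "smooth_on X Y L h" and X: "convex X" "bounded X" and Y: "convex Y" and L: "0 \<le> L"
  obtains C where "0 \<le> C" "\<And>x y. x \<in> X \<Longrightarrow> y \<in> Y \<Longrightarrow> norm y \<le> B \<Longrightarrow> \<bar>h x y\<bar> \<le> C"
    "\<And>x y. x \<in> X \<Longrightarrow> y \<in> Y \<Longrightarrow> norm y \<le> B \<Longrightarrow> norm (grad_x h x y) \<le> C"
    "\<And>x y. x \<in> X \<Longrightarrow> y \<in> Y \<Longrightarrow> norm y \<le> B \<Longrightarrow> norm (grad_y h x y) \<le> C"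
proof (cases "X \<noteq> {} \<and> Y \<noteq> {}")
  case True
  then obtain x0 y0 where 0: "x0 \<in> X" "y0 \<in> Y" by auto
  obtain A where A: "\<And>x. x \<in> X \<Longrightarrow> norm x \<le> A" using X by (auto simp: bounded_iff)
  define a where "a = \<bar>A\<bar> + norm x0"
  define b where "b = \<bar>B\<bar> + norm y0"
  have a: "norm (x - x0) \<le> a" if "x \<in> X" for x
    using A[OF that] norm_triangle_ineq4[of x x0] by (simp add: a_def)
  have b: "norm (y - y0) \<le> b" if "norm y \<le> B" for y
    using that norm_triangle_ineq4[of y y0] by (simp add: b_def)
  have ab: "0 \<le> a" "0 \<le> b" by (simp_all add: a_def b_def)
  define gx where "gx = norm (grad_x h x0 y0) + L * (a + b)"
  define gy where "gy = norm (grad_y h x0 y0) + L * (a + b)"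
  have grad: "norm (grad_x h x y) \<le> gx" "norm (grad_y h x y) \<le> gy"
    if xy: "x \<in> X" "y \<in> Y" "norm (y - y0) \<le> b" for x y
  proof -
    have "L * (norm (x - x0) + norm (y - y0)) \<le> L * (a + b)"
      using L a[OF xy(1)] xy(3) by (intro mult_left_mono add_mono)
    moreover have "norm (grad_x h x y - grad_x h x0 y0) \<le> L * (norm (x - x0) + norm (y - y0))"
      "norm (grad_y h x y - grad_y h x0 y0) \<le> L * (norm (x - x0) + norm (y - y0))"
      using h xy 0 by (auto simp: smooth_on_def)
    ultimately show "norm (grad_x h x y) \<le> gx" "norm (grad_y h x y) \<le> gy"
      using norm_triangle_sub[of "grad_x h x y" "grad_x h x0 y0"]
        norm_triangle_sub[of "grad_y h x y" "grad_y h x0 y0"]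
      by (auto simp: gx_def gy_def)
  qed
  define C where "C = \<bar>h x0 y0\<bar> + (a * gx + L * a\<^sup>2) + (b * gy + L * b\<^sup>2)"
  have g0: "0 \<le> gx" "0 \<le> gy" using L ab by (auto simp: gx_def gy_def)
  have val: "\<bar>h x y\<bar> \<le> C" if xy: "x \<in> X" "y \<in> Y" "norm y \<le> B" for x y
  proof -
    have "\<bar>h x y0 - h x0 y0 - (x - x0) \<bullet> grad_x h x0 y0\<bar> \<le> L * (norm (x - x0))\<^sup>2"
      using smooth_on_remainder[OF h X(1) 0(1) xy(1) 0(2)] .
    moreover have "L * (norm (x - x0))\<^sup>2 \<le> L * a\<^sup>2"
      using L a[OF xy(1)] by (intro mult_left_mono power_mono) auto
    moreover have "\<bar>(x - x0) \<bullet> grad_x h x0 y0\<bar> \<le> a * gx"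
      using a[OF xy(1)] grad(1)[OF 0] ab g0
      by (intro order_trans[OF Cauchy_Schwarz_ineq2] mult_mono) auto
    moreover have "\<bar>h x y - h x y0 - (y - y0) \<bullet> grad_y h x y0\<bar> \<le> L * (norm (y - y0))\<^sup>2"
      using smooth_on_remainder[OF smooth_on_swap[OF h] Y 0(2) xy(2,1)]
      by (simp add: grad_x_def grad_y_def)
    moreover have "L * (norm (y - y0))\<^sup>2 \<le> L * b\<^sup>2"
      using L b[OF xy(3)] by (intro mult_left_mono power_mono) auto
    moreover have "\<bar>(y - y0) \<bullet> grad_y h x y0\<bar> \<le> b * gy"
      using b[OF xy(3)] grad(2)[OF xy(1) 0(2)] ab g0
      by (intro order_trans[OF Cauchy_Schwarz_ineq2] mult_mono) auto
    ultimately show ?thesis unfolding C_def by linarith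
  qed
  have "0 \<le> C" using g0 ab L by (auto simp: C_def)
  show ?thesis
  proof (rule that[of "C + gx + gy"])
    show "0 \<le> C + gx + gy" using g0 \<open>0 \<le> C\<close> by simp
    fix x y assume xy: "x \<in> X" "y \<in> Y" "norm y \<le> B"
    show "\<bar>h x y\<bar> \<le> C + gx + gy" "norm (grad_x h x y) \<le> C + gx + gy" "norm (grad_y h x y) \<le> C + gx + gy"
      using val[OF xy] grad[OF xy(1,2) b[OF xy(3)]] g0 \<open>0 \<le> C\<close> by linarith+
  qed
next
  case False
  then show ?thesis by (intro that[of 0]) auto
qed

context bilevel
begin

subsection \<open>The value of the regularized problem\<close>

lemma psi_remainder:
  assumes x: "x \<in> X" "x' \<in> X" and y: "y \<in> Y" "z \<in> Y" and \<rho>: "0 \<le> \<rho>"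
  shows "\<bar>psi F f \<rho> \<sigma> \<delta> x' y z - psi F f \<rho> \<sigma> \<delta> x y z - (x' - x) \<bullet> gx \<rho> x (y, z)\<bar>
    \<le> L * (1 + 2 * \<rho>) * (norm (x' - x))\<^sup>2"
proof -
  let ?r = "\<lambda>h y. h x' y - h x y - (x' - x) \<bullet> grad_x h x y"
  let ?n = "L * (norm (x' - x))\<^sup>2"
  have "\<bar>?r F y\<bar> \<le> ?n" "\<bar>?r f y\<bar> \<le> ?n" "\<bar>?r f z\<bar> \<le> ?n"
    using X x y F_smooth f_smooth by (auto intro: smooth_on_remainder)
  moreover have "psi F f \<rho> \<sigma> \<delta> x' y z - psi F f \<rho> \<sigma> \<delta> x y z - (x' - x) \<bullet> gx \<rho> x (y, z)
      = ?r F y - \<rho> * ?r f y + \<rho> * ?r f z"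
    by (simp add: psi_def upper_dir_def algebra_simps)
  moreover have "\<bar>?r F y - \<rho> * ?r f y + \<rho> * ?r f z\<bar> \<le> \<bar>?r F y\<bar> + \<rho> * \<bar>?r f y\<bar> + \<rho> * \<bar>?r f z\<bar>"
    using abs_triangle_ineq[of "?r F y - \<rho> * ?r f y" "\<rho> * ?r f z"] 
      abs_triangle_ineq4[of "?r F y" "\<rho> * ?r f y"] \<rho>
    by (simp add: abs_mult)
  ultimately have "\<bar>psi F f \<rho> \<sigma> \<delta> x' y z - psi F f \<rho> \<sigma> \<delta> x y z - (x' - x) \<bullet> gx \<rho> x (y, z)\<bar>
    \<le> ?n + \<rho> * ?n + \<rho> * ?n"
    using \<rho> by (smt (verit) mult_left_mono)
  then show ?thesis by (simp add: algebra_simps)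
qed

text \<open>A sandwich in the manner of Danskin: the saddle property bounds the increment of the
  value above through the mixed pair (y', z) and below through (y, z'). Along a frozen pair only x
  moves, and replacing the pair by (y, z) costs the Lipschitz constant of the saddle point times |x'
  - x|, hence again a quadratic term.\<close>

lemma phi_remainder:
  assumes x: "x \<in> X" "x' \<in> X" and p: "0 < \<rho>" "0 < \<sigma>" "0 < \<delta>"
  shows "\<bar>phi \<rho> \<sigma> \<delta> x' - phi \<rho> \<sigma> \<delta> x - (x' - x) \<bullet> gx \<rho> x (us \<rho> \<sigma> \<delta> x)\<bar>
    \<le> (L * (1 + 2 * \<rho>) + 2 * L * (1 + \<rho>) * (3 * L * (1 + \<rho> + \<sigma> + \<delta>) / min \<sigma> \<delta>)) * (norm (x' - x))\<^sup>2"
proof -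
  obtain y z where u: "us \<rho> \<sigma> \<delta> x = (y, z)" by fastforce
  obtain y' z' where u': "us \<rho> \<sigma> \<delta> x' = (y', z')" by fastforce
  have Y: "y \<in> Y" "z \<in> Y" "y' \<in> Y" "z' \<in> Y"
    using saddle_in[OF x(1) p] saddle_in[OF x(2) p] u u' by auto
  let ?\<psi> = "psi F f \<rho> \<sigma> \<delta>" and ?\<phi> = "phi \<rho> \<sigma> \<delta>"
  define n where "n = norm (x' - x)"
  define Lu where "Lu = 3 * L * (1 + \<rho> + \<sigma> + \<delta>) / min \<sigma> \<delta>"
  have lip: "norm ((y', z') - (y, z)) \<le> Lu * n"
    using saddle_lipschitz[OF x(2,1) p] by (simp add: u u' Lu_def n_def)
  have L0: "0 \<le> 2 * L * (1 + \<rho>)" using L p by simp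
  have g: "\<bar>(x' - x) \<bullet> gx \<rho> x v - (x' - x) \<bullet> gx \<rho> x (y, z)\<bar> \<le> 2 * L * (1 + \<rho>) * Lu * n\<^sup>2"
    if v: "v \<in> Y \<times> Y" "norm (v - (y, z)) \<le> norm ((y', z') - (y, z))" for v
  proof -
    have "\<bar>(x' - x) \<bullet> gx \<rho> x v - (x' - x) \<bullet> gx \<rho> x (y, z)\<bar> \<le> n * norm (gx \<rho> x v - gx \<rho> x (y, z))"
      unfolding n_def inner_diff_right[symmetric] by (rule Cauchy_Schwarz_ineq2)
    also have "\<dots> \<le> n * (2 * L * (1 + \<rho>) * (norm (x - x) + norm (v - (y, z))))"
      using x v Y p by (intro mult_left_mono upper_dir_lipschitz) (auto simp: n_def)
    also have "\<dots> \<le> n * (2 * L * (1 + \<rho>) * (Lu * n))"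
      using v lip L0 by (intro mult_left_mono) (auto simp: n_def)
    finally show ?thesis by (simp add: power2_eq_square mult_ac)
  qed
  have "?\<phi> x' - ?\<phi> x \<le> ?\<psi> x' y' z - ?\<psi> x y' z"
    using phi_le[OF x(2) p Y(2)] le_phi[OF x(1) p Y(3)] by (simp add: u u')
  moreover have "?\<psi> x' y z' - ?\<psi> x y z' \<le> ?\<phi> x' - ?\<phi> x"
    using phi_le[OF x(1) p Y(4)] le_phi[OF x(2) p Y(1)] by (simp add: u u')
  moreover have "\<bar>?\<psi> x' y' z - ?\<psi> x y' z - (x' - x) \<bullet> gx \<rho> x (y', z)\<bar> \<le> L * (1 + 2 * \<rho>) * n\<^sup>2"
    "\<bar>?\<psi> x' y z' - ?\<psi> x y z' - (x' - x) \<bullet> gx \<rho> x (y, z')\<bar> \<le> L * (1 + 2 * \<rho>) * n\<^sup>2"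
    unfolding n_def using x Y p by (auto intro!: psi_remainder)
  moreover have "\<bar>(x' - x) \<bullet> gx \<rho> x (y', z) - (x' - x) \<bullet> gx \<rho> x (y, z)\<bar> \<le> 2 * L * (1 + \<rho>) * Lu * n\<^sup>2"
    "\<bar>(x' - x) \<bullet> gx \<rho> x (y, z') - (x' - x) \<bullet> gx \<rho> x (y, z)\<bar> \<le> 2 * L * (1 + \<rho>) * Lu * n\<^sup>2"
    using Y by (auto intro!: g simp: norm_Pair)
  ultimately have "\<bar>?\<phi> x' - ?\<phi> x - (x' - x) \<bullet> gx \<rho> x (y, z)\<bar> \<le> L * (1 + 2 * \<rho>) * n\<^sup>2 + 2 * L * (1 + \<rho>) * Lu * n\<^sup>2"
    by linarith
  then show ?thesis by (simp add: u n_def Lu_def algebra_simps)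
qed

lemma phi_has_derivative:
  assumes "x \<in> X" "0 < \<rho>" "0 < \<sigma>" "0 < \<delta>"
  shows "(phi \<rho> \<sigma> \<delta> has_derivative (\<lambda>h. h \<bullet> gx \<rho> x (us \<rho> \<sigma> \<delta> x))) (at x within X)"
  using assms by (intro has_derivative_quadratic_remainder[OF phi_remainder])

section \<open>Uniform bounds on saddle points and values\<close>

text \<open>Otherwise F stays above c along points y_n escaping to infinity while x_n tends to some
  x. Concavity keeps F(x_n, .) large where the segment from y0 to y_n crosses a fixed sphere, and
  there F(x_n, .) is close to F(x, .), against coercivity at the single point x.\<close>

lemma F_uniformly_coercive:
  "\<exists>R. \<forall>x\<in>X. \<forall>y\<in>Y. c \<le> F x y \<longrightarrow> norm y \<le> R"
proof (rule ccontr)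
  assume "\<not> ?thesis"
  then have "\<forall>n::nat. \<exists>x y. x \<in> X \<and> y \<in> Y \<and> c \<le> F x y \<and> real n < norm y"
    by (meson not_le)
  then obtain xs ys where xs: "\<And>n::nat. xs n \<in> X" and ys: "\<And>n. ys n \<in> Y"
    and F: "\<And>n. c \<le> F (xs n) (ys n)" and big: "\<And>n. real n < norm (ys n)"
    by metis
  obtain x r where x: "x \<in> X" and r: "strict_mono (r :: nat \<Rightarrow> nat)" and lim: "(xs \<circ> r) \<longlonglongrightarrow> x"
    using X(2)[unfolded compact_def, rule_format, of xs] xs by blast
  obtain y0 where y0: "y0 \<in> Y" using Y by auto
  \<comment> \<open>The margin 1 below F(x, y0) keeps F(x_n, y0) above \<open>c'\<close> once F(x_n,
    .) is within 1 of F(x, .), so both endpoints of the segment lie above \<open>c'\<close>.\<close>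
  define c' where "c' = min c (F x y0 - 1)"
  have "eventually (\<lambda>y. F x y \<le> c' - 2) (inf at_infinity (principal Y))"
    using F_coercive[OF x] by (auto simp: filterlim_at_bot)
  then obtain R where R: "\<And>y. y \<in> Y \<Longrightarrow> R \<le> norm y \<Longrightarrow> F x y \<le> c' - 2"
    unfolding eventually_inf_principal eventually_at_infinity by auto
  \<comment> \<open>Points of Y at distance \<open>R1\<close> from y0 have norm at least R, where
    F(x, .) is at most \<open>c' - 2\<close>; this gap of 2 exceeds the error 1.\<close>
  define R1 where "R1 = \<bar>R\<bar> + norm y0 + 1"
  define e where "e n = norm (xs (r n) - x) * (norm (grad_x F x y0) + L * R1)
      + L * (norm (xs (r n) - x))\<^sup>2" for n
  have close: "\<bar>F (xs (r n)) y - F x y\<bar> \<le> e n" if y: "y \<in> Y" "norm (y - y0) \<le> R1" for n y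
  proof -
    have "\<bar>F (xs (r n)) y - F x y - (xs (r n) - x) \<bullet> grad_x F x y\<bar> \<le> L * (norm (xs (r n) - x))\<^sup>2"
      using smooth_on_remainder[OF F_smooth X(3) x xs y(1)] .
    moreover have "norm (grad_x F x y) \<le> norm (grad_x F x y0) + L * R1"
    proof -
      have "norm (grad_x F x y - grad_x F x y0) \<le> L * (norm (x - x) + norm (y - y0))"
        by (rule lip_F_x) (use x y y0 in auto)
      also have "\<dots> \<le> L * R1" using L y by simp
      finally show ?thesis using norm_triangle_sub[of "grad_x F x y" "grad_x F x y0"] by simp
    qed
    then have "\<bar>(xs (r n) - x) \<bullet> grad_x F x y\<bar> \<le> norm (xs (r n) - x) * (norm (grad_x F x y0) + L * R1)"
      by (intro order_trans[OF Cauchy_Schwarz_ineq2] mult_left_mono) auto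
    ultimately show ?thesis unfolding e_def by linarith
  qed
  have "(\<lambda>n. norm (xs (r n) - x)) \<longlonglongrightarrow> 0"
    using lim by (simp add: o_def LIM_zero tendsto_norm_zero)
  then have "e \<longlonglongrightarrow> 0 * (norm (grad_x F x y0) + L * R1) + L * 0\<^sup>2"
    unfolding e_def by (intro tendsto_intros)
  then have "eventually (\<lambda>n. e n < 1) sequentially"
    by (auto dest!: order_tendstoD(2)[of e 0 sequentially 1])
  then obtain N where N: "\<And>n. N \<le> n \<Longrightarrow> e n < 1" by (auto simp: eventually_sequentially)
  define n where "n = max N (nat \<lceil>R1 + norm y0\<rceil>)"
  have Nn: "e n < 1" by (rule N) (simp add: n_def)
  define y where "y = ys (r n)"
  have "R1 + norm y0 \<le> real n" by (simp add: n_def le_max_iff_disj) linarith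
  also have "\<dots> \<le> real (r n)" using seq_suble[OF r, of n] by simp
  also have "\<dots> < norm y" using big by (simp add: y_def)
  finally have big': "R1 < norm (y - y0)" using norm_triangle_sub[of y y0] by simp
  have R1: "0 < R1" using norm_ge_zero[of y0] unfolding R1_def by linarith
  \<comment> \<open>Pulls y back along the segment to distance \<open>R1\<close> from y0.\<close>
  define \<theta> where "\<theta> = R1 / norm (y - y0)"
  have ny: "0 < norm (y - y0)" using big' R1 by linarith
  have "\<theta> \<le> 1" unfolding \<theta>_def
    by (rule divide_le_eq_1_pos[THEN iffD2, OF ny less_imp_le[OF big']])
  then have \<theta>: "0 \<le> \<theta>" "\<theta> \<le> 1" "\<theta> * norm (y - y0) = R1"
    using ny R1 by (auto simp: \<theta>_def)
  define v where "v = (1 - \<theta>) *\<^sub>R y0 + \<theta> *\<^sub>R y"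
  have yY: "y \<in> Y" using ys by (simp add: y_def)
  have vY: "v \<in> Y" using Y(3) y0 yY \<theta> unfolding v_def by (intro convexD) auto
  have vy0: "v - y0 = \<theta> *\<^sub>R (y - y0)" by (simp add: v_def algebra_simps)
  then have nv: "norm (v - y0) = R1" using \<theta> by simp
  then have "R \<le> norm v" using norm_triangle_ineq4[of v y0] by (simp add: R1_def)
  with R[OF vY] have "F x v \<le> c' - 2" .
  moreover have "c' \<le> F (xs (r n)) v"
  proof -
    have "(1 - \<theta>) * F (xs (r n)) y0 + \<theta> * F (xs (r n)) y \<le> F (xs (r n)) v"
      using convex_onD[OF F_concave[OF xs[of "r n"], unfolded concave_on_def] \<theta>(1,2) y0 yY] by (simp add: v_def)
    moreover have "c' \<le> F (xs (r n)) y" using F by (simp add: c'_def y_def min_le_iff_disj)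
    moreover have "c' \<le> F (xs (r n)) y0"
      using close[OF y0, of n] Nn R1 by (simp add: c'_def)
    ultimately have "(1 - \<theta>) * c' + \<theta> * c' \<le> F (xs (r n)) v"
      using \<theta> mult_left_mono[of c' "F (xs (r n)) y0" "1 - \<theta>"]
        mult_left_mono[of c' "F (xs (r n)) y" \<theta>] by linarith
    then show ?thesis by (simp add: algebra_simps)
  qed
  ultimately show False using close[OF vY eq_refl[OF nv], of n] Nn by linarith
qed

text \<open>All comparisons use a lower-level solution w from a bounded set: there the \<rho>-terms
  have a favourable sign and drop out, so the bounds are uniform in \<rho>. Testing y = w bounds the
  value below; testing z = w as well bounds F(x, y) below, hence y by coercivity; minimality in z
  then bounds z.\<close>

lemma saddle_uniformly_bounded:
  assumes "0 < \<sigma>m" "0 < \<delta>m"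
  obtains R where "0 \<le> R"
    "\<And>x \<rho> \<sigma> \<delta>. x \<in> X \<Longrightarrow> 0 < \<rho> \<Longrightarrow> 0 < \<sigma> \<Longrightarrow> \<sigma> \<le> \<sigma>m \<Longrightarrow> 0 < \<delta> \<Longrightarrow> \<delta> \<le> \<delta>m \<Longrightarrow> \<sigma> \<le> \<kappa> * \<delta> \<Longrightarrow>
      norm (us \<rho> \<sigma> \<delta> x) \<le> R \<and> - R \<le> phi \<rho> \<sigma> \<delta> x"
proof -
  obtain Dy where Dy: "Dy \<subseteq> Y" "bounded Dy" "\<forall>x\<in>X. lower_sol f Y x \<inter> Dy \<noteq> {}"
    using sol_bounded by auto
  obtain B where B: "0 < B" "\<And>y. y \<in> Dy \<Longrightarrow> norm y \<le> B" using Dy(2) by (auto simp: bounded_pos)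
  obtain C where C: "0 \<le> C" "\<And>x y. x \<in> X \<Longrightarrow> y \<in> Y \<Longrightarrow> norm y \<le> B \<Longrightarrow> \<bar>F x y\<bar> \<le> C"
    by (rule smooth_on_bounded[OF F_smooth X(3) compact_imp_bounded[OF X(2)] Y(3)
          order_trans[OF zero_le_one L], of B]) (rule that; blast)
  define c where "c = - (C + \<sigma>m * B\<^sup>2 + \<delta>m * B\<^sup>2 + \<sigma>m * \<kappa> * B\<^sup>2)"
  obtain R1 where R1: "\<And>x y. x \<in> X \<Longrightarrow> y \<in> Y \<Longrightarrow> c \<le> F x y \<Longrightarrow> norm y \<le> R1"
    using F_uniformly_coercive[of c] by blast
  define R2 where "R2 = C + \<sigma>m * B\<^sup>2 + \<delta>m * B\<^sup>2"
  have R2: "0 \<le> R2" using C assms by (simp add: R2_def)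
  have bd: "norm (us \<rho> \<sigma> \<delta> x) \<le> 3 * \<bar>R1\<bar> + B \<and> - R2 \<le> phi \<rho> \<sigma> \<delta> x"
    if x: "x \<in> X" and p: "0 < \<rho>" "0 < \<sigma>" "0 < \<delta>" and pm: "\<sigma> \<le> \<sigma>m" "\<delta> \<le> \<delta>m" "\<sigma> \<le> \<kappa> * \<delta>"
    for x \<rho> \<sigma> \<delta>
  proof -
    obtain y z where u: "us \<rho> \<sigma> \<delta> x = (y, z)" by fastforce
    have yz: "y \<in> Y" "z \<in> Y" using saddle_in[OF x p] u by auto
    obtain w where w: "w \<in> lower_sol f Y x" "w \<in> Dy" using Dy(3) x by blast
    then have wY: "w \<in> Y" and wB: "norm w \<le> B" and wmin: "\<And>y. y \<in> Y \<Longrightarrow> f x w \<le> f x y"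
      using Dy(1) B(2) by (auto simp: lower_sol_def is_arg_min_linorder)
    have FC: "- C \<le> F x w" using C(2)[OF x wY wB] by simp
    have fy: "\<rho> * f x w \<le> \<rho> * f x y" and fz: "\<rho> * f x w \<le> \<rho> * f x z"
      using wmin yz p by (auto intro: mult_left_mono)
    have w2: "(norm w)\<^sup>2 \<le> B\<^sup>2" using wB by (intro power_mono) auto
    have \<sigma>B: "\<sigma> * (norm w)\<^sup>2 \<le> \<sigma>m * B\<^sup>2" "\<delta> * (norm w)\<^sup>2 \<le> \<delta>m * B\<^sup>2"
      using w2 p pm by (auto intro!: mult_mono)
    have sq: "(norm (z - w))\<^sup>2 = (norm z)\<^sup>2 - 2 * (w \<bullet> z) + (norm w)\<^sup>2"
      unfolding power2_norm_eq_inner by (simp add: algebra_simps inner_commute)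
    have sq': "0 \<le> \<sigma> * (norm (z - w))\<^sup>2" using p by simp
    define m where "m = phi \<rho> \<sigma> \<delta> x"
    have low: "psi F f \<rho> \<sigma> \<delta> x w z \<le> m"
      using le_phi[OF x p wY] by (simp add: u m_def)
    have nn: "0 \<le> \<sigma> * (norm w)\<^sup>2" "0 \<le> \<delta> * (norm w)\<^sup>2" using p by auto
    then have "- R2 \<le> m"
      using low FC fz \<sigma>B sq' unfolding psi_def R2_def sq
      by (simp add: algebra_simps)
    then have "- R2 \<le> phi \<rho> \<sigma> \<delta> x" by (simp add: m_def)
    moreover have "norm (us \<rho> \<sigma> \<delta> x) \<le> 3 * \<bar>R1\<bar> + B"
    proof -
      have "psi F f \<rho> \<sigma> \<delta> x w z \<le> psi F f \<rho> \<sigma> \<delta> x y w"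
        using low phi_le[OF x p wY] by (simp add: u m_def)
      moreover have "- (\<sigma>m * \<kappa> * B\<^sup>2) \<le> \<sigma> * (y \<bullet> w) + \<delta> / 2 * (norm y)\<^sup>2"
      proof -
        \<comment> \<open>Completing the square: the cross term \<sigma> (y \<bullet> w) costs
          \<sigma>^2 |w|^2 / \<delta> up to a constant, which stays bounded because \<sigma> \<le>
          \<kappa> * \<delta>.\<close>
        have "0 \<le> (norm (\<delta> *\<^sub>R y + \<sigma> *\<^sub>R w))\<^sup>2" by simp
        also have "\<dots> = \<delta>\<^sup>2 * (norm y)\<^sup>2 + 2 * \<delta> * \<sigma> * (y \<bullet> w) + \<sigma>\<^sup>2 * (norm w)\<^sup>2"
          unfolding power2_norm_eq_inner by (simp add: algebra_simps inner_commute power2_eq_square)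
        also have "\<dots> \<le> \<delta>\<^sup>2 * (norm y)\<^sup>2 + 2 * \<delta> * \<sigma> * (y \<bullet> w) + \<delta> * \<kappa> * (\<sigma>m * B\<^sup>2)"
        proof -
          have "\<sigma>\<^sup>2 * (norm w)\<^sup>2 = \<sigma> * (\<sigma> * (norm w)\<^sup>2)" by (simp add: power2_eq_square)
          also have "\<dots> \<le> (\<kappa> * \<delta>) * (\<sigma>m * B\<^sup>2)" by (rule mult_mono) (use pm p \<sigma>B(1) in simp_all)
          finally show ?thesis by (simp add: mult_ac)
        qed
        also have "\<dots> = 2 * \<delta> * (\<sigma> * (y \<bullet> w) + \<delta> / 2 * (norm y)\<^sup>2 + \<kappa> * \<sigma>m * B\<^sup>2 / 2)"
          by (simp add: algebra_simps power2_eq_square)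
        finally have "0 \<le> \<sigma> * (y \<bullet> w) + \<delta> / 2 * (norm y)\<^sup>2 + \<kappa> * \<sigma>m * B\<^sup>2 / 2"
          using p by (simp add: zero_le_mult_iff)
        moreover have "0 < \<kappa>" using pm p by (metis less_le_trans zero_less_mult_pos2)
        then have "0 \<le> \<kappa> * \<sigma>m * B\<^sup>2" using assms by simp
        ultimately show ?thesis by (simp add: mult_ac)
      qed
      ultimately have "c \<le> F x y"
        using FC fy fz \<sigma>B sq' nn unfolding psi_def c_def sq by (simp add: algebra_simps)
      then have yR: "norm y \<le> R1" using R1 x yz by blast
      have "psi F f \<rho> \<sigma> \<delta> x y z \<le> psi F f \<rho> \<sigma> \<delta> x y w"
        using saddle_is_saddle[OF x p] wY by (simp add: u is_saddle_def)
      \<comment> \<open>Up to a term in y alone the regularization in z is \<sigma> |z - y|^2 / 2,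
        and w minimizes f, so z is no farther from y than w is.\<close>
      then have "\<sigma> * (norm (z - y))\<^sup>2 \<le> \<sigma> * (norm (w - y))\<^sup>2"
        using fz unfolding psi_def power2_norm_eq_inner by (simp add: algebra_simps inner_commute)
      then have "norm (z - y) \<le> norm (w - y)"
        using p by (simp add: power2_le_iff_abs_le)
      then have "norm z \<le> norm y + (norm w + norm y)"
        using norm_triangle_sub[of z y] norm_triangle_ineq4[of w y] by linarith
      then show ?thesis
        using yR wB norm_Pair_le[of y z] unfolding u by linarith
    qed
    ultimately show ?thesis by simp
  qed
  show ?thesis
  proof (rule that[of "3 * \<bar>R1\<bar> + B + R2"])
    show "0 \<le> 3 * \<bar>R1\<bar> + B + R2" using R2 B by simp
    fix x and \<rho> \<sigma> \<delta> :: real assume "x \<in> X" "0 < \<rho>" "0 < \<sigma>" "\<sigma> \<le> \<sigma>m" "0 < \<delta>" "\<delta> \<le> \<delta>m" "\<sigma> \<le> \<kappa> * \<delta>"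
    then show "norm (us \<rho> \<sigma> \<delta> x) \<le> 3 * \<bar>R1\<bar> + B + R2 \<and> - (3 * \<bar>R1\<bar> + B + R2) \<le> phi \<rho> \<sigma> \<delta> x"
      using bd[of x \<rho> \<sigma> \<delta>] R2 B by auto
  qed
qed

text \<open>Again a mixed pair is frozen, now with x fixed and the parameters changing; \<psi> is
  affine in them, so their increments factor out.\<close>

lemma phi_drift:
  assumes x: "x \<in> X" and p: "0 < \<rho>" "0 < \<sigma>" "0 < \<delta>" "0 < \<rho>'" "0 < \<sigma>'" "0 < \<delta>'"
    and R: "norm (us \<rho> \<sigma> \<delta> x) \<le> R" "norm (us \<rho>' \<sigma>' \<delta>' x) \<le> R"
    and C: "\<And>y. y \<in> Y \<Longrightarrow> norm y \<le> R \<Longrightarrow> \<bar>f x y\<bar> \<le> C"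
  shows "phi \<rho>' \<sigma>' \<delta>' x \<le> phi \<rho> \<sigma> \<delta> x + (\<bar>\<rho>' - \<rho>\<bar> + \<bar>\<sigma>' - \<sigma>\<bar> + \<bar>\<delta>' - \<delta>\<bar>) * (2 * C + 2 * R\<^sup>2)"
proof -
  define y where "y = fst (us \<rho>' \<sigma>' \<delta>' x)"
  define z where "z = snd (us \<rho> \<sigma> \<delta> x)"
  have Y: "y \<in> Y" "z \<in> Y" using saddle_in[OF x p(1-3)] saddle_in[OF x p(4-6)] by (auto simp: y_def z_def)
  have yz: "norm y \<le> R" "norm z \<le> R"
    using R norm_fst_bound[of "us \<rho>' \<sigma>' \<delta>' x"] norm_snd_bound[of "us \<rho> \<sigma> \<delta> x"] by (auto simp: y_def z_def)
  have R0: "0 \<le> R" using yz norm_ge_zero order_trans by blast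
  have f: "\<bar>f x z - f x y\<bar> \<le> 2 * C + 2 * R\<^sup>2"
    using C[OF Y(1) yz(1)] C[OF Y(2) yz(2)] by (smt (verit) zero_le_power2)
  have "\<bar>y \<bullet> z\<bar> \<le> R\<^sup>2"
    unfolding power2_eq_square using yz R0 by (intro order_trans[OF Cauchy_Schwarz_ineq2] mult_mono) auto
  moreover have "(norm y)\<^sup>2 \<le> R\<^sup>2" "(norm z)\<^sup>2 \<le> R\<^sup>2" using yz by (auto intro: power_mono)
  moreover have "0 \<le> (norm z)\<^sup>2" "0 \<le> (norm y)\<^sup>2" by auto
  ultimately have q: "\<bar>(norm z)\<^sup>2 / 2 - y \<bullet> z\<bar> \<le> 2 * C + 2 * R\<^sup>2" "\<bar>- ((norm y)\<^sup>2 / 2)\<bar> \<le> 2 * C + 2 * R\<^sup>2"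
    using C[OF Y(1) yz(1)] by linarith+
  have "phi \<rho>' \<sigma>' \<delta>' x - phi \<rho> \<sigma> \<delta> x \<le> psi F f \<rho>' \<sigma>' \<delta>' x y z - psi F f \<rho> \<sigma> \<delta> x y z"
    using phi_le[OF x p(4-6) Y(2)] le_phi[OF x p(1-3) Y(1)] by (simp add: y_def z_def)
  also have "\<dots> = (\<rho>' - \<rho>) * (f x z - f x y) + ((\<sigma>' - \<sigma>) * ((norm z)\<^sup>2 / 2 - y \<bullet> z) + (\<delta>' - \<delta>) * (- ((norm y)\<^sup>2 / 2)))"
    by (simp add: psi_def algebra_simps add_divide_distrib diff_divide_distrib)
  also have "\<dots> \<le> \<bar>\<rho>' - \<rho>\<bar> * \<bar>f x z - f x y\<bar> + (\<bar>\<sigma>' - \<sigma>\<bar> * \<bar>(norm z)\<^sup>2 / 2 - y \<bullet> z\<bar> + \<bar>\<delta>' - \<delta>\<bar> * \<bar>- ((norm y)\<^sup>2 / 2)\<bar>)"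
    unfolding abs_mult[symmetric] by (intro add_mono abs_ge_self)
  also have "\<dots> \<le> \<bar>\<rho>' - \<rho>\<bar> * (2 * C + 2 * R\<^sup>2) + (\<bar>\<sigma>' - \<sigma>\<bar> * (2 * C + 2 * R\<^sup>2) + \<bar>\<delta>' - \<delta>\<bar> * (2 * C + 2 * R\<^sup>2))"
    using f q by (intro add_mono mult_left_mono) auto
  finally show ?thesis by (simp add: algebra_simps)
qed

end

section \<open>Square integrable random vectors and oracle noise\<close>

definition sq_int :: "'o measure \<Rightarrow> ('o \<Rightarrow> 'a::euclidean_space) \<Rightarrow> bool" where
  "sq_int M v \<longleftrightarrow> v \<in> borel_measurable M \<and> integrable M (\<lambda>\<omega>. (norm (v \<omega>))\<^sup>2)"

lemma sq_intD:
  assumes "sq_int M v"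
  shows "v \<in> borel_measurable M" "integrable M (\<lambda>\<omega>. (norm (v \<omega>))\<^sup>2)"
  using assms by (auto simp: sq_int_def)

lemma norm_add_sq_le: "(norm (a + b))\<^sup>2 \<le> 2 * (norm a)\<^sup>2 + 2 * (norm (b::'a::real_normed_vector))\<^sup>2"
proof -
  have "(norm (a + b))\<^sup>2 \<le> (norm a + norm b)\<^sup>2"
    by (intro power_mono norm_triangle_ineq) simp
  also have "\<dots> \<le> 2 * (norm a)\<^sup>2 + 2 * (norm b)\<^sup>2"
    using sum_squares_bound[of "norm a" "norm b"] by (simp add: power2_sum)
  finally show ?thesis .
qed

lemma norm_diff_sq_le: "(norm (a - b))\<^sup>2 \<le> 2 * (norm a)\<^sup>2 + 2 * (norm (b::'a::real_normed_vector))\<^sup>2"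
  using norm_add_sq_le[of a "- b"] by simp

lemma sq_int_bound:
  assumes "v \<in> borel_measurable M" "integrable M g" "\<And>\<omega>. \<omega> \<in> space M \<Longrightarrow> (norm (v \<omega>))\<^sup>2 \<le> g \<omega>"
  shows "sq_int M v"
  unfolding sq_int_def
proof (intro conjI assms(1))
  have [measurable]: "v \<in> borel_measurable M" by fact
  show "integrable M (\<lambda>\<omega>. (norm (v \<omega>))\<^sup>2)"
    by (rule Bochner_Integration.integrable_bound[OF assms(2)])
       (use assms(3) in \<open>auto intro!: AE_I2 simp: abs_of_nonneg intro: order_trans[OF _ abs_ge_self]\<close>)
qed

lemma sq_int_add: "sq_int M v \<Longrightarrow> sq_int M w \<Longrightarrow> sq_int M (\<lambda>\<omega>. v \<omega> + w \<omega>)"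
  by (rule sq_int_bound[where g = "\<lambda>\<omega>. 2 * (norm (v \<omega>))\<^sup>2 + 2 * (norm (w \<omega>))\<^sup>2"])
     (auto simp: sq_int_def norm_add_sq_le)

lemma sq_int_diff: "sq_int M v \<Longrightarrow> sq_int M w \<Longrightarrow> sq_int M (\<lambda>\<omega>. v \<omega> - w \<omega>)"
  by (rule sq_int_bound[where g = "\<lambda>\<omega>. 2 * (norm (v \<omega>))\<^sup>2 + 2 * (norm (w \<omega>))\<^sup>2"])
     (auto simp: sq_int_def norm_diff_sq_le)

lemma sq_int_scaleR: "sq_int M v \<Longrightarrow> sq_int M (\<lambda>\<omega>. c *\<^sub>R v \<omega>)"
  by (auto simp: sq_int_def power_mult_distrib)

lemma sq_int_Pair: "sq_int M v \<Longrightarrow> sq_int M w \<Longrightarrow> sq_int M (\<lambda>\<omega>. (v \<omega>, w \<omega>))"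
  by (auto simp: sq_int_def norm_Pair)

lemma measurable_fst_snd:
  fixes w :: "'o \<Rightarrow> 'a::euclidean_space \<times> 'b::euclidean_space"
  assumes "w \<in> borel_measurable G"
  shows "(\<lambda>\<omega>. fst (w \<omega>)) \<in> borel_measurable G" "(\<lambda>\<omega>. snd (w \<omega>)) \<in> borel_measurable G"
proof -
  have "w \<in> measurable G (borel \<Otimes>\<^sub>M borel)" using assms by (simp add: borel_prod)
  then show "(\<lambda>\<omega>. fst (w \<omega>)) \<in> borel_measurable G" "(\<lambda>\<omega>. snd (w \<omega>)) \<in> borel_measurable G"
    by measurable
qed

lemma sq_int_fst: "sq_int M v \<Longrightarrow> sq_int M (\<lambda>\<omega>. fst (v \<omega>))"
  by (rule sq_int_bound[where g = "\<lambda>\<omega>. (norm (v \<omega>))\<^sup>2"])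
     (auto simp: sq_int_def intro!: power_mono norm_fst_bound measurable_fst_snd)

lemma sq_int_snd: "sq_int M v \<Longrightarrow> sq_int M (\<lambda>\<omega>. snd (v \<omega>))"
  by (rule sq_int_bound[where g = "\<lambda>\<omega>. (norm (v \<omega>))\<^sup>2"])
     (auto simp: sq_int_def intro!: power_mono norm_snd_bound measurable_fst_snd)

lemma sq_int_bounded:
  assumes "finite_measure M" "v \<in> borel_measurable M" "\<And>\<omega>. \<omega> \<in> space M \<Longrightarrow> norm (v \<omega>) \<le> B"
  shows "sq_int M v"
  by (rule sq_int_bound[where g = "\<lambda>\<omega>. B\<^sup>2"])
     (use assms in \<open>auto intro!: power_mono finite_measure.integrable_const\<close>)

lemma sq_int_mono:
  assumes "finite_measure M" "v \<in> borel_measurable M" "sq_int M w"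
    "\<And>\<omega>. \<omega> \<in> space M \<Longrightarrow> norm (v \<omega>) \<le> B + C * norm (w \<omega>)"
  shows "sq_int M v"
proof (rule sq_int_bound[where g = "\<lambda>\<omega>. 2 * B\<^sup>2 + 2 * (C\<^sup>2 * (norm (w \<omega>))\<^sup>2)"])
  show "integrable M (\<lambda>\<omega>. 2 * B\<^sup>2 + 2 * (C\<^sup>2 * (norm (w \<omega>))\<^sup>2))"
    using assms(3) by (auto simp: sq_int_def intro!: finite_measure.integrable_const[OF assms(1)])
  fix \<omega> assume "\<omega> \<in> space M"
  then have "(norm (v \<omega>))\<^sup>2 \<le> (B + C * norm (w \<omega>))\<^sup>2"
    using assms(4) by (intro power_mono) auto
  also have "\<dots> \<le> 2 * B\<^sup>2 + 2 * (C * norm (w \<omega>))\<^sup>2"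
    using sum_squares_bound[of B "C * norm (w \<omega>)"] by (simp add: power2_sum)
  finally show "(norm (v \<omega>))\<^sup>2 \<le> 2 * B\<^sup>2 + 2 * (C\<^sup>2 * (norm (w \<omega>))\<^sup>2)"
    by (simp add: power_mult_distrib)
qed fact

lemma sq_int_inner:
  assumes "sq_int M v" "sq_int M w"
  shows "integrable M (\<lambda>\<omega>. v \<omega> \<bullet> w \<omega>)"
proof (rule Bochner_Integration.integrable_bound[where f = "\<lambda>\<omega>. (norm (v \<omega>))\<^sup>2 + (norm (w \<omega>))\<^sup>2"])
  have [measurable]: "v \<in> borel_measurable M" "w \<in> borel_measurable M"
    using assms by (auto simp: sq_int_def)
  show "(\<lambda>\<omega>. v \<omega> \<bullet> w \<omega>) \<in> borel_measurable M" by simp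
  have "norm (v \<omega> \<bullet> w \<omega>) \<le> norm ((norm (v \<omega>))\<^sup>2 + (norm (w \<omega>))\<^sup>2)" for \<omega>
  proof -
    have "\<bar>v \<omega> \<bullet> w \<omega>\<bar> \<le> norm (v \<omega>) * norm (w \<omega>)" by (rule Cauchy_Schwarz_ineq2)
    also have "\<dots> \<le> (norm (v \<omega>))\<^sup>2 + (norm (w \<omega>))\<^sup>2"
      using sum_squares_bound[of "norm (v \<omega>)" "norm (w \<omega>)"]
        mult_nonneg_nonneg[OF norm_ge_zero[of "v \<omega>"] norm_ge_zero[of "w \<omega>"]] by linarith
    finally show ?thesis by simp
  qed
  then show "AE \<omega> in M. norm (v \<omega> \<bullet> w \<omega>) \<le> norm ((norm (v \<omega>))\<^sup>2 + (norm (w \<omega>))\<^sup>2)" by simp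
qed (use assms in \<open>auto simp: sq_int_def\<close>)

text \<open>Centered given \<open>G\<close>, in the weak form of orthogonality to all \<open>G\<close>-measurable vectors.\<close>

definition noise :: "'o measure \<Rightarrow> 'o measure \<Rightarrow> real \<Rightarrow> ('o \<Rightarrow> 'a::euclidean_space) \<Rightarrow> bool" where
  "noise M G V N \<longleftrightarrow> sq_int M N \<and> (\<integral>\<omega>. (norm (N \<omega>))\<^sup>2 \<partial>M) \<le> V \<and>
     (\<forall>w. w \<in> borel_measurable G \<and> sq_int M w \<longrightarrow> (\<integral>\<omega>. N \<omega> \<bullet> w \<omega> \<partial>M) = 0)"

lemma noise_scaleR:
  assumes "noise M G V N"
  shows "noise M G (c\<^sup>2 * V) (\<lambda>\<omega>. c *\<^sub>R N \<omega>)"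
  using assms by (auto simp: noise_def power_mult_distrib sq_int_scaleR intro: mult_left_mono)

text \<open>The two vectors may share a sample and need not be orthogonal to each other, hence the
  factor 2.\<close>

lemma noise_add:
  assumes N: "noise M G V N" and N': "noise M G V' N'"
  shows "noise M G (2 * V + 2 * V') (\<lambda>\<omega>. N \<omega> + N' \<omega>)"
proof -
  have s: "sq_int M N" "sq_int M N'" using assms by (auto simp: noise_def)
  note [simp] = sq_intD[OF s(1)] sq_intD[OF s(2)] 
  have "(\<integral>\<omega>. (norm (N \<omega> + N' \<omega>))\<^sup>2 \<partial>M) \<le> (\<integral>\<omega>. 2 * (norm (N \<omega>))\<^sup>2 + 2 * (norm (N' \<omega>))\<^sup>2 \<partial>M)"
    using sq_intD[OF sq_int_add[OF s]] by (intro integral_mono) (auto simp: norm_add_sq_le)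
  also have "\<dots> \<le> 2 * V + 2 * V'" using assms by (auto simp: noise_def)
  finally have "(\<integral>\<omega>. (norm (N \<omega> + N' \<omega>))\<^sup>2 \<partial>M) \<le> 2 * V + 2 * V'" .
  then show ?thesis
    using assms sq_int_add[OF s] by (auto simp: noise_def inner_add_left sq_int_inner)
qed

lemma noise_mono: "noise M G V N \<Longrightarrow> V \<le> V' \<Longrightarrow> noise M G V' N"
  by (auto simp: noise_def)

lemma noise_diff:
  assumes "noise M G V N" "noise M G V' N'"
  shows "noise M G (2 * V + 2 * V') (\<lambda>\<omega>. N \<omega> - N' \<omega>)"
  using noise_add[OF assms(1) noise_scaleR[OF assms(2), of "- 1"]] by simp

lemma noise_Pair:
  assumes N: "noise M G V N" and N': "noise M G V' N'"
  shows "noise M G (V + V') (\<lambda>\<omega>. (N \<omega>, N' \<omega>))"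
proof -
  have s: "sq_int M N" "sq_int M N'" using assms by (auto simp: noise_def)
  have "(\<integral>\<omega>. (norm (N \<omega>, N' \<omega>))\<^sup>2 \<partial>M) = (\<integral>\<omega>. (norm (N \<omega>))\<^sup>2 \<partial>M) + (\<integral>\<omega>. (norm (N' \<omega>))\<^sup>2 \<partial>M)"
    using sq_intD(2)[OF s(1)] sq_intD(2)[OF s(2)] by (simp add: norm_Pair)
  moreover have "(\<integral>\<omega>. (N \<omega>, N' \<omega>) \<bullet> w \<omega> \<partial>M) = 0"
    if w: "w \<in> borel_measurable G" "sq_int M w" for w
  proof -
    have "(\<integral>\<omega>. (N \<omega>, N' \<omega>) \<bullet> w \<omega> \<partial>M) = (\<integral>\<omega>. N \<omega> \<bullet> fst (w \<omega>) + N' \<omega> \<bullet> snd (w \<omega>) \<partial>M)"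
      by (simp add: inner_prod_def)
    also have "\<dots> = (\<integral>\<omega>. N \<omega> \<bullet> fst (w \<omega>) \<partial>M) + (\<integral>\<omega>. N' \<omega> \<bullet> snd (w \<omega>) \<partial>M)"
      using s w by (intro Bochner_Integration.integral_add sq_int_inner sq_int_fst sq_int_snd)
    also have "\<dots> = 0"
      using assms w measurable_fst_snd[OF w(1)] sq_int_fst[OF w(2)] sq_int_snd[OF w(2)]
      by (auto simp: noise_def)
    finally show ?thesis .
  qed
  ultimately show ?thesis
    using assms sq_int_Pair[OF s] by (auto simp: noise_def)
qed

lemma noise_orthogonal:
  assumes N: "noise M G V N" and w: "w \<in> borel_measurable G" "sq_int M w"
  shows "(\<integral>\<omega>. (norm (w \<omega> + N \<omega>))\<^sup>2 \<partial>M) = (\<integral>\<omega>. (norm (w \<omega>))\<^sup>2 \<partial>M) + (\<integral>\<omega>. (norm (N \<omega>))\<^sup>2 \<partial>M)"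
proof -
  have s: "sq_int M N" and o: "(\<integral>\<omega>. N \<omega> \<bullet> w \<omega> \<partial>M) = 0" using assms by (auto simp: noise_def)
  have "(norm (w \<omega> + N \<omega>))\<^sup>2 = (norm (w \<omega>))\<^sup>2 + 2 * (N \<omega> \<bullet> w \<omega>) + (norm (N \<omega>))\<^sup>2" for \<omega>
    unfolding power2_norm_eq_inner by (simp add: algebra_simps inner_commute)
  then show ?thesis
    using o sq_intD(2)[OF s] sq_intD(2)[OF w(2)] sq_int_inner[OF s w(2)] by simp
qed

text \<open>Since the conditional variance is taken in \<open>ennreal\<close>, square integrability
  of the error can be derived from it. Only then may a \<open>G\<close>-measurable w be pulled into
  the conditional expectations, one coordinate at a time.\<close>

lemma unbiased_oracle_noise:
  fixes M :: "'c measure"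
    and gS :: "real^'n \<Rightarrow> real^'m \<Rightarrow> 'w \<Rightarrow> real^'l"
  assumes M: "prob_space M" and G: "subalgebra M G"
    and unb_oracle: "unbiased_oracle M G \<xi> X Y \<Delta> gS g"
    and x: "x \<in> borel_measurable G" "sq_int M x" "\<And>\<omega>. \<omega> \<in> space M \<Longrightarrow> x \<omega> \<in> X"
    and v: "v \<in> borel_measurable G" "sq_int M v" "\<And>\<omega>. \<omega> \<in> space M \<Longrightarrow> v \<omega> \<in> Y"
    and gS: "(\<lambda>\<omega>. gS (x \<omega>) (v \<omega>) (\<xi> \<omega>)) \<in> borel_measurable M"
    and g: "(\<lambda>\<omega>. g (x \<omega>) (v \<omega>)) \<in> borel_measurable G" "sq_int M (\<lambda>\<omega>. g (x \<omega>) (v \<omega>))"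
  shows "noise M G (\<Delta>\<^sup>2) (\<lambda>\<omega>. gS (x \<omega>) (v \<omega>) (\<xi> \<omega>) - g (x \<omega>) (v \<omega>))"
proof -
  interpret prob_space M by fact
  interpret finite_measure_subalgebra M G by unfold_locales (rule G)
  define a where "a \<omega> = gS (x \<omega>) (v \<omega>) (\<xi> \<omega>)" for \<omega>
  define b where "b \<omega> = g (x \<omega>) (v \<omega>)" for \<omega>
  have [measurable]: "a \<in> borel_measurable M" "b \<in> borel_measurable M"
    using gS g by (auto simp: a_def[abs_def] b_def[abs_def] sq_int_def)
  have unb: "AE \<omega> in M. real_cond_exp M G (\<lambda>\<omega>. a \<omega> $ i) \<omega> = b \<omega> $ i" for i
    using unb_oracle x v unfolding unbiased_oracle_def a_def b_def sq_int_def by auto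
  have var: "AE \<omega> in M. nn_cond_exp M G (\<lambda>\<omega>. ennreal ((norm (a \<omega> - b \<omega>))\<^sup>2)) \<omega> \<le> ennreal (\<Delta>\<^sup>2)"
    using unb_oracle x v unfolding unbiased_oracle_def a_def b_def sq_int_def by auto
  have "(\<integral>\<^sup>+\<omega>. ennreal ((norm (a \<omega> - b \<omega>))\<^sup>2) \<partial>M)
      = (\<integral>\<^sup>+\<omega>. nn_cond_exp M G (\<lambda>\<omega>. ennreal ((norm (a \<omega> - b \<omega>))\<^sup>2)) \<omega> \<partial>M)"
    using nn_cond_exp_intg[of "\<lambda>_. 1" "\<lambda>\<omega>. ennreal ((norm (a \<omega> - b \<omega>))\<^sup>2)"] by simp
  also have "\<dots> \<le> (\<integral>\<^sup>+\<omega>. ennreal (\<Delta>\<^sup>2) \<partial>M)"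
    by (rule nn_integral_mono_AE[OF var])
  also have "\<dots> = ennreal (\<Delta>\<^sup>2)" by (simp add: emeasure_space_1)
  finally have le: "(\<integral>\<^sup>+\<omega>. ennreal ((norm (a \<omega> - b \<omega>))\<^sup>2) \<partial>M) \<le> ennreal (\<Delta>\<^sup>2)" .
  have int: "integrable M (\<lambda>\<omega>. (norm (a \<omega> - b \<omega>))\<^sup>2)"
    by (rule integrableI_bounded) (use le in \<open>auto intro: le_less_trans\<close>)
  have sab: "sq_int M (\<lambda>\<omega>. a \<omega> - b \<omega>)" using int by (simp add: sq_int_def)
  have sb: "sq_int M b" using g by (simp add: b_def[abs_def])
  have sa: "sq_int M a" using sq_int_add[OF sab sb] by simp
  have "(\<integral>\<omega>. (norm (a \<omega> - b \<omega>))\<^sup>2 \<partial>M) \<le> \<Delta>\<^sup>2"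
    using le unfolding nn_integral_eq_integral[OF int AE_I2[OF zero_le_power2]]
    by (simp add: ennreal_le_iff)
  moreover have "(\<integral>\<omega>. (a \<omega> - b \<omega>) \<bullet> w \<omega> \<partial>M) = 0"
    if w: "w \<in> borel_measurable G" "sq_int M w" for w
  proof -
    have nth: "(\<lambda>x::real^'l. x $ i) \<in> borel_measurable borel" for i
      by (intro borel_measurable_continuous_onI continuous_intros)
    have comp: "sq_int M (\<lambda>\<omega>. h \<omega> $ i)" if "sq_int M h" for h :: "'c \<Rightarrow> real^'l" and i
    proof (rule sq_int_bound[where g = "\<lambda>\<omega>. (norm (h \<omega>))\<^sup>2"])
      show "(norm (h \<omega> $ i))\<^sup>2 \<le> (norm (h \<omega>))\<^sup>2" for \<omega>
        by (intro power_mono) (auto simp: component_le_norm_cart)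
    qed (use that in \<open>auto simp: sq_int_def intro: measurable_compose[OF _ nth]\<close>)
    have wi: "(\<lambda>\<omega>. w \<omega> $ i) \<in> borel_measurable G" for i
      using w(1) by (rule measurable_compose[OF _ nth])
    have ai: "(\<lambda>\<omega>. a \<omega> $ i) \<in> borel_measurable M" and bi: "(\<lambda>\<omega>. b \<omega> $ i) \<in> borel_measurable M"
      and wi': "(\<lambda>\<omega>. w \<omega> $ i) \<in> borel_measurable M" for i
      using sq_intD(1)[OF w(2)] by (auto intro: measurable_compose[OF _ nth])
    have int_a: "integrable M (\<lambda>\<omega>. w \<omega> $ i * a \<omega> $ i)" and int_b: "integrable M (\<lambda>\<omega>. w \<omega> $ i * b \<omega> $ i)" for i
      using sq_int_inner[OF comp[OF w(2)] comp[OF sa]] sq_int_inner[OF comp[OF w(2)] comp[OF sb]] by auto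
    have "(\<integral>\<omega>. w \<omega> $ i * a \<omega> $ i \<partial>M) = (\<integral>\<omega>. w \<omega> $ i * b \<omega> $ i \<partial>M)" for i
    proof -
      have "(\<integral>\<omega>. w \<omega> $ i * a \<omega> $ i \<partial>M) = (\<integral>\<omega>. w \<omega> $ i * real_cond_exp M G (\<lambda>\<omega>. a \<omega> $ i) \<omega> \<partial>M)"
        by (rule real_cond_exp_intg(2)[symmetric]) (use int_a wi ai in auto)
      also have "\<dots> = (\<integral>\<omega>. w \<omega> $ i * b \<omega> $ i \<partial>M)"
        using unb[of i] wi'[of i] bi[of i] by (intro integral_cong_AE) auto
      finally show ?thesis .
    qed
    moreover have "(\<integral>\<omega>. (a \<omega> - b \<omega>) \<bullet> w \<omega> \<partial>M)
        = (\<integral>\<omega>. (\<Sum>i\<in>UNIV. w \<omega> $ i * a \<omega> $ i - w \<omega> $ i * b \<omega> $ i) \<partial>M)"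
      by (simp add: inner_vec_def algebra_simps)
    ultimately show ?thesis
      using int_a int_b by simp
  qed
  ultimately show ?thesis
    using sab unfolding noise_def a_def b_def by simp
qed

section \<open>Independence and generated sigma-algebras\<close>

text \<open>Independence makes the joint law of U and \<xi> the product of their laws; the rest is
  Tonelli. This lifts the mean square Lipschitz bound from fixed points to random points determined
  by the past.\<close>

lemma indep_nn_integral_iterated:
  assumes M: "prob_space M" and G: "subalgebra M G"
    and \<xi>: "\<xi> \<in> measurable M D" "distr M D \<xi> = D"
    and indep: "prob_space.indep_set M (sets (vimage_algebra (space M) \<xi> D)) (sets G)"
    and U: "U \<in> measurable G N"
    and h[measurable]: "h \<in> borel_measurable (N \<Otimes>\<^sub>M D)"
  shows "(\<integral>\<^sup>+\<omega>. h (U \<omega>, \<xi> \<omega>) \<partial>M) = (\<integral>\<^sup>+\<omega>. (\<integral>\<^sup>+w. h (U \<omega>, w) \<partial>D) \<partial>M)"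
proof -
  interpret prob_space M by fact
  have UM[measurable]: "U \<in> measurable M N" using measurable_from_subalg[OF G U] .
  note [measurable] = \<xi>(1)
  interpret dU: prob_space "distr M N U" by (rule prob_space_distr) fact
  interpret D: prob_space D using prob_space_distr[OF \<xi>(1)] \<xi>(2) by simp
  have "distr M N U \<Otimes>\<^sub>M D = distr M (N \<Otimes>\<^sub>M D) (\<lambda>\<omega>. (U \<omega>, \<xi> \<omega>))"
  proof (rule pair_measure_eqI)
    fix A B assume [measurable]: "A \<in> sets (distr M N U)" "B \<in> sets D"
    have A[measurable]: "A \<in> sets N" using \<open>A \<in> sets (distr M N U)\<close> by simp
    have a: "\<xi> -` B \<inter> space M \<in> sets (vimage_algebra (space M) \<xi> D)"
      by (rule in_vimage_algebra) fact
    have b: "U -` A \<inter> space M \<in> sets G"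
      using measurable_sets[OF U A] G by (simp add: subalgebra_def)
    have "emeasure (distr M N U) A * emeasure D B
        = emeasure M (U -` A \<inter> space M) * emeasure M (\<xi> -` B \<inter> space M)"
    proof -
      have "emeasure D B = emeasure (distr M D \<xi>) B" by (simp add: \<xi>(2))
      then show ?thesis by (simp add: emeasure_distr)
    qed
    also have "\<dots> = emeasure M ((U -` A \<inter> space M) \<inter> (\<xi> -` B \<inter> space M))"
      using indep_setD[OF indep a b] by (simp add: emeasure_eq_measure ennreal_mult Int_commute mult.commute)
    also have "\<dots> = emeasure (distr M (N \<Otimes>\<^sub>M D) (\<lambda>\<omega>. (U \<omega>, \<xi> \<omega>))) (A \<times> B)"
      by (subst emeasure_distr) (auto intro!: arg_cong[where f = "emeasure M"])
    finally show "emeasure (distr M N U) A * emeasure D B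
        = emeasure (distr M (N \<Otimes>\<^sub>M D) (\<lambda>\<omega>. (U \<omega>, \<xi> \<omega>))) (A \<times> B)" .
  qed (auto intro: dU.sigma_finite_measure D.sigma_finite_measure sets_pair_measure_cong
        simp: dU.sigma_finite_measure_axioms D.sigma_finite_measure_axioms)
  then have "(\<integral>\<^sup>+\<omega>. h (U \<omega>, \<xi> \<omega>) \<partial>M) = (\<integral>\<^sup>+p. h p \<partial>(distr M N U \<Otimes>\<^sub>M D))"
    by (simp add: nn_integral_distr)
  also have "\<dots> = (\<integral>\<^sup>+u. (\<integral>\<^sup>+w. h (u, w) \<partial>D) \<partial>distr M N U)"
  proof (rule D.nn_integral_fst[symmetric])
    have "sets (distr M N U \<Otimes>\<^sub>M D) = sets (N \<Otimes>\<^sub>M D)" by (intro sets_pair_measure_cong) auto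
    then show "h \<in> borel_measurable (distr M N U \<Otimes>\<^sub>M D)" using h by (simp cong: measurable_cong_sets)
  qed
  also have "\<dots> = (\<integral>\<^sup>+\<omega>. (\<integral>\<^sup>+w. h (U \<omega>, w) \<partial>D) \<partial>M)"
    by (subst nn_integral_distr) (auto intro!: D.borel_measurable_nn_integral)
  finally show ?thesis .
qed

lemma gen_alg_subalgebra:
  assumes "\<And>\<xi>. \<xi> \<in> V \<Longrightarrow> \<xi> \<in> measurable M D"
  shows "subalgebra M (gen_alg M D V)"
proof -
  have "sets (vimage_algebra (space M) \<xi> D) \<subseteq> sets M" if "\<xi> \<in> V" for \<xi>
  proof -
    have "\<xi> \<in> space M \<rightarrow> space D" using assms[OF that] by (auto simp: measurable_space)
    then show ?thesis
      using assms[OF that] by (auto simp: sets_vimage_algebra2 intro: measurable_sets)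
  qed
  then have "(\<Union>\<xi>\<in>V. sets (vimage_algebra (space M) \<xi> D)) \<subseteq> sets M" by blast
  then show ?thesis
    unfolding subalgebra_def gen_alg_def
    using sets.space_closed by (auto intro!: sets.sigma_sets_subset simp: space_measure_of_conv sets_measure_of_conv)
qed

lemma gen_alg_subset:
  assumes "V \<subseteq> W"
  shows "subalgebra (gen_alg M D W) (gen_alg M D V)"
proof -
  have "(\<Union>\<xi>\<in>W. sets (vimage_algebra (space M) \<xi> D)) \<subseteq> Pow (space M)"
    using sets.space_closed[of "vimage_algebra (space M) _ D"] by auto
  moreover have "(\<Union>\<xi>\<in>V. sets (vimage_algebra (space M) \<xi> D)) \<subseteq> (\<Union>\<xi>\<in>W. sets (vimage_algebra (space M) \<xi> D))"
    using assms by auto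
  ultimately show ?thesis
    unfolding subalgebra_def gen_alg_def
    by (auto simp: space_measure_of_conv sets_measure_of sigma_sets_mono' intro: sigma_sets_mono')
qed

lemma gen_alg_measurable:
  assumes "\<xi> \<in> V" "\<xi> \<in> measurable M D"
  shows "\<xi> \<in> measurable (gen_alg M D V) D"
proof (rule measurableI)
  have sub: "(\<Union>\<xi>\<in>V. sets (vimage_algebra (space M) \<xi> D)) \<subseteq> Pow (space M)"
    using sets.space_closed[of "vimage_algebra (space M) _ D"] by auto
  have sp: "space (gen_alg M D V) = space M" by (simp add: gen_alg_def space_measure_of[OF sub])
  show "\<xi> x \<in> space D" if "x \<in> space (gen_alg M D V)" for x
    using that assms(2) by (auto simp: sp measurable_space)
  fix A assume "A \<in> sets D"
  then have "\<xi> -` A \<inter> space M \<in> (\<Union>\<xi>\<in>V. sets (vimage_algebra (space M) \<xi> D))"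
    using assms(1) by (auto intro: in_vimage_algebra)
  then show "\<xi> -` A \<inter> space (gen_alg M D V) \<in> sets (gen_alg M D V)"
    unfolding sp unfolding gen_alg_def sets_measure_of[OF sub] by (rule sigma_sets.Basic)
qed

section \<open>Rates\<close>

text \<open>The shift keeps the base at least 1, which makes \<open>pw\<close> monotone in the
  exponent at every index, including k = 0.\<close>

definition pw :: "real \<Rightarrow> nat \<Rightarrow> real" where
  "pw e k = real (k + 1) powr e"

lemma pow_seq_eq: "pow_seq c e k = c * pw e k"
  by (simp add: pow_seq_def pw_def)

lemma pw_pos [simp]: "0 < pw e k"
  by (simp add: pw_def)

lemma pw_nonneg [simp]: "0 \<le> pw e k"
  by (simp add: pw_def)

lemma pw_mult: "pw a k * pw b k = pw (a + b) k"
  by (simp add: pw_def powr_add)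

lemma pw_zero [simp]: "pw 0 k = 1"
  by (simp add: pw_def)

lemma pw_mono: "a \<le> b \<Longrightarrow> pw a k \<le> pw b k"
  by (simp add: pw_def powr_mono)

lemma pw_ge_1: "0 \<le> a \<Longrightarrow> 1 \<le> pw a k"
  using pw_mono[of 0 a] by simp

lemma pw_le_1: "a \<le> 0 \<Longrightarrow> pw a k \<le> 1"
  using pw_mono[of a 0] by simp

lemma pw_minus: "pw (- a) k = 1 / pw a k"
  by (simp add: pw_def powr_minus_divide)

lemma pw_Suc_le: "a \<le> 0 \<Longrightarrow> pw a (Suc k) \<le> pw a k"
  unfolding pw_def by (rule powr_mono2') auto

text \<open>As k + 2 \<le> 2 (k + 1), an index shift costs only a constant factor.\<close>

lemma pw_Suc_ge:
  assumes "a \<le> 0"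
  shows "2 powr a * pw a k \<le> pw a (Suc k)"
proof -
  have "2 powr a * pw a k = (2 * real (k + 1)) powr a"
    unfolding pw_def by (rule powr_mult[symmetric])
  also have "\<dots> \<le> pw a (Suc k)"
    unfolding pw_def using assms by (intro powr_mono2') auto
  finally show ?thesis .
qed

lemma pw_Suc_le':
  assumes "0 \<le> a"
  shows "pw a (Suc k) \<le> 2 powr a * pw a k"
proof -
  have "pw a (Suc k) \<le> (2 * real (k + 1)) powr a"
    unfolding pw_def using assms by (intro powr_mono2) auto
  also have "\<dots> = 2 powr a * pw a k"
    unfolding pw_def by (rule powr_mult)
  finally show ?thesis .
qed

lemma powr_MVT:
  fixes x a :: real
  assumes "0 < x"
  obtains z where "x < z" "z < x + 1" "(x + 1) powr a - x powr a = a * z powr (a - 1)"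
proof -
  have "\<exists>z. x < z \<and> z < x + 1 \<and> (x + 1) powr a - x powr a = (x + 1 - x) * (a * z powr (a - 1))"
    by (rule MVT2[where f = "\<lambda>x. x powr a" and f' = "\<lambda>z. a * z powr (a - 1)"])
       (use assms in \<open>auto intro!: has_real_derivative_powr\<close>)
  then show ?thesis using that by auto
qed

text \<open>Mean value theorem; for a \<le> 1 the power z^(a-1) is largest at the left end of the
  interval.\<close>

lemma pw_increment:
  assumes "a \<le> 1"
  shows "\<bar>pw a (Suc k) - pw a k\<bar> \<le> \<bar>a\<bar> * pw (a - 1) k"
proof -
  obtain z where z: "real (k + 1) < z" and eq: "(real (k + 1) + 1) powr a - real (k + 1) powr a = a * z powr (a - 1)"
    using powr_MVT[of "real (k + 1)" a] by auto
  have "pw a (Suc k) - pw a k = a * z powr (a - 1)"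
    using eq by (simp add: pw_def add_ac)
  moreover have "z powr (a - 1) \<le> pw (a - 1) k"
    unfolding pw_def using z assms by (intro powr_mono2') auto
  ultimately show ?thesis by (simp add: abs_mult mult_left_mono)
qed

text \<open>This is how constants are absorbed: a strictly smaller exponent beats every factor C
  from some index on.\<close>

lemma pw_eventually_le:
  assumes "a < b" "0 < \<epsilon>"
  shows "\<forall>\<^sub>F k in sequentially. C * pw a k \<le> \<epsilon> * pw b k"
proof -
  have "(\<lambda>k. real (k + 1) powr (a - b)) \<longlonglongrightarrow> 0"
    using assms by (intro tendsto_neg_powr filterlim_compose[OF filterlim_real_sequentially]
        filterlim_add_const_nat_at_top) auto
  then have "(\<lambda>k. C * pw (a - b) k) \<longlonglongrightarrow> C * 0"
    unfolding pw_def by (intro tendsto_intros)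
  then have "\<forall>\<^sub>F k in sequentially. C * pw (a - b) k < \<epsilon>"
    using assms by (auto dest!: order_tendstoD(2)[of _ _ _ \<epsilon>])
  then show ?thesis
  proof eventually_elim
    case (elim k)
    then have "C * pw (a - b) k * pw b k \<le> \<epsilon> * pw b k"
      by (intro mult_right_mono) auto
    then show ?case by (simp add: mult.assoc pw_mult)
  qed
qed

text \<open>For q \<le> 1 each term is at most an increment of N^q / q, by the mean value theorem,
  and these telescope. For q > 1 every term is at most N^(q-1).\<close>

lemma pw_sum_le:
  assumes q: "0 < q" and e: "e \<le> q - 1"
  shows "(\<Sum>k<N. pw e k) \<le> max 1 (1 / q) * real N powr q"
proof (cases "q \<le> 1")
  case True
  have "(\<Sum>k<N. pw e k) \<le> (1 / q) * real N powr q"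
  proof (induction N)
    case (Suc N)
    have "pw e N \<le> (1 / q) * (real (Suc N) powr q - real N powr q)"
    \<comment> \<open>The mean value theorem needs a positive base; for N = 0 the claim reads 1
      \<le> 1 / q.\<close>
    proof (cases "N = 0")
      case True
      then show ?thesis using q \<open>q \<le> 1\<close> by (simp add: pw_def)
    next
      case False
      then obtain z where z: "real N < z" "z < real N + 1"
        and eq: "(real N + 1) powr q - real N powr q = q * z powr (q - 1)"
        using powr_MVT[of "real N" q] by auto
      have "pw e N \<le> pw (q - 1) N" using e by (rule pw_mono)
      also have "\<dots> \<le> z powr (q - 1)"
        unfolding pw_def using z False \<open>q \<le> 1\<close> by (intro powr_mono2') auto
      also have "\<dots> = (1 / q) * (real (Suc N) powr q - real N powr q)"
        using eq q by (simp add: add.commute)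
      finally show ?thesis .
    qed
    with Suc show ?case by (simp add: right_diff_distrib)
  qed simp
  also have "\<dots> \<le> max 1 (1 / q) * real N powr q"
    by (intro mult_right_mono) auto
  finally show ?thesis .
next
  case False
  have "(\<Sum>k<N. pw e k) \<le> (\<Sum>k<N. real N powr (q - 1))"
  proof (rule sum_mono)
    fix k assume k: "k \<in> {..<N}"
    have "pw e k \<le> pw (q - 1) k" using e by (rule pw_mono)
    also have "\<dots> \<le> real N powr (q - 1)"
      unfolding pw_def using k False by (intro powr_mono2) auto
    finally show "pw e k \<le> real N powr (q - 1)" .
  qed
  also have "\<dots> = real N powr q"
    by (cases "N = 0") (auto simp: powr_diff)
  also have "\<dots> \<le> max 1 (1 / q) * real N powr q"
    using mult_right_mono[of 1 "max 1 (1 / q)" "real N powr q"] by simp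
  finally show ?thesis .
qed

text \<open>Because p is positive, so is max p q, whatever the sign of q. Hence no logarithm
  appears, not even for e = -1.\<close>

lemma pw_sum_le2:
  assumes p: "0 < p" and e: "e \<le> p - 1 \<or> e \<le> q - 1"
  shows "\<exists>C\<ge>0. \<forall>K\<ge>1. (\<Sum>k<Suc K. pw e k) \<le> C * (real K powr p + real K powr q)"
proof -
  define r where "r = max p q"
  have r: "0 < r" "e \<le> r - 1" using assms by (auto simp: r_def)
  have "(\<Sum>k<Suc K. pw e k) \<le> (max 1 (1 / r) * 2 powr r) * (real K powr p + real K powr q)" if "1 \<le> K" for K
  proof -
    have "(\<Sum>k<Suc K. pw e k) \<le> max 1 (1 / r) * real (Suc K) powr r"
      by (rule pw_sum_le[OF r])
    also have "\<dots> \<le> max 1 (1 / r) * (2 * real K) powr r"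
      using r that by (intro mult_left_mono powr_mono2) auto
    also have "\<dots> = max 1 (1 / r) * 2 powr r * real K powr r"
      by (simp add: powr_mult)
    also have "real K powr r \<le> real K powr p + real K powr q"
      by (auto simp: r_def max_def)
    finally show ?thesis by (simp add: mult_left_mono)
  qed
  then show ?thesis by (intro exI[of _ "max 1 (1 / r) * 2 powr r"]) auto
qed

text \<open>The minimum lies below every term, the window from k1 to K has at least K / 2 indices,
  and every weight in it is at least (2 K)^e.\<close>

lemma min_rate:
  assumes e: "e \<le> 0" and C: "0 \<le> C" and g: "\<And>k. 0 \<le> g k"
    and sum: "\<And>K. k1 \<le> K \<Longrightarrow> 1 \<le> K \<Longrightarrow>
      (\<Sum>k = k1..<Suc K. pw e k * g k) \<le> C * (real K powr p + real K powr q)"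
  shows "(\<lambda>K. MIN k\<in>{0..K}. g k) \<in> O(\<lambda>K. 1 / real K powr (1 + e - p) + 1 / real K powr (1 + e - q))"
proof (rule bigoI)
  show "\<forall>\<^sub>F K in sequentially. norm (MIN k\<in>{0..K}. g k)
      \<le> (2 * 2 powr (- e) * C) * norm (1 / real K powr (1 + e - p) + 1 / real K powr (1 + e - q))"
    \<comment> \<open>From this index on K + 1 - k1 is at least K / 2.\<close>
    using eventually_ge_at_top[of "2 * k1 + 1"]
  proof eventually_elim
    case (elim K)
    define m where "m = (MIN k\<in>{0..K}. g k)"
    have m: "m \<le> g k" if "k \<le> K" for k
      unfolding m_def using that by (intro Min_le) auto
    have m0: "0 \<le> m" unfolding m_def using g by (subst Min_ge_iff) auto
    have K: "0 < real K" "1 \<le> K" "k1 \<le> K" using elim by auto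
    have pK: "2 powr e * real K powr e \<le> pw e k" if "k < Suc K" for k
    proof -
      have "2 powr e * real K powr e = (2 * real K) powr e" by (simp add: powr_mult)
      also have "\<dots> \<le> pw e k"
        unfolding pw_def using that e K by (intro powr_mono2') auto
      finally show ?thesis .
    qed
    have "real K / 2 * (2 powr e * real K powr e * m) \<le> real (Suc K - k1) * (2 powr e * real K powr e * m)"
      using elim m0 by (intro mult_right_mono) (auto simp: of_nat_diff)
    also have "\<dots> = (\<Sum>k = k1..<Suc K. 2 powr e * real K powr e * m)"
      by simp
    also have "\<dots> \<le> (\<Sum>k = k1..<Suc K. pw e k * g k)"
      using m m0 pK by (intro sum_mono mult_mono) auto
    also have "\<dots> \<le> C * (real K powr p + real K powr q)"
      using sum K by blast
    finally have le: "real K / 2 * (2 powr e * real K powr e * m) \<le> C * (real K powr p + real K powr q)" .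
    have "m = (2 * 2 powr (- e) * real K powr (- 1 - e)) * (real K / 2 * (2 powr e * real K powr e * m))"
    proof -
      have "real K powr (- 1 - e) * real K * real K powr e = real K powr (- 1 - e) * real K powr 1 * real K powr e"
        using K by simp
      also have "\<dots> = 1" using K by (simp only: powr_add[symmetric]) simp
      finally have A: "real K powr (- 1 - e) * real K * real K powr e = 1" .
      have B: "2 powr (- e) * 2 powr e = (1::real)" by (simp add: powr_add[symmetric])
      have "(2 * 2 powr (- e) * real K powr (- 1 - e)) * (real K / 2 * (2 powr e * real K powr e * m))
          = (2 powr (- e) * 2 powr e) * (real K powr (- 1 - e) * real K * real K powr e) * m"
        by simp
      then show ?thesis using A B by simp
    qed
    also have "\<dots> \<le> (2 * 2 powr (- e) * real K powr (- 1 - e)) * (C * (real K powr p + real K powr q))"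
      using le by (intro mult_left_mono) auto
    also have "\<dots> = (2 * 2 powr (- e) * C) * (real K powr (- 1 - e) * real K powr p + real K powr (- 1 - e) * real K powr q)"
      by (simp add: algebra_simps)
    also have "real K powr (- 1 - e) * real K powr p = 1 / real K powr (1 + e - p)"
      by (simp add: powr_add[symmetric] powr_minus_divide[symmetric] algebra_simps)
    also have "real K powr (- 1 - e) * real K powr q = 1 / real K powr (1 + e - q)"
      by (simp add: powr_add[symmetric] powr_minus_divide[symmetric] algebra_simps)
    finally show ?case using m0 by (simp add: m_def)
  qed
qed

lemma telescoping_sum_le:
  fixes V :: "nat \<Rightarrow> real"
  assumes "\<And>k. k1 \<le> k \<Longrightarrow> V (Suc k) + A k \<le> V k + B k" and "k1 \<le> N"
  shows "V N + (\<Sum>k = k1..<N. A k) \<le> V k1 + (\<Sum>k = k1..<N. B k)"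
  using \<open>k1 \<le> N\<close>
proof (induction N rule: dec_induct)
  case (step N)
  then show ?case using assms(1)[of N] by simp
qed simp

text \<open>
  \<open>\<Phi>\<close> is the mean value function along the iterates, \<open>a\<close> the mean square distance to the saddle
  point, \<open>b\<close> the mean square error of the search direction, \<open>S\<close> the mean square step and \<open>G\<close> the
  mean square of the projected gradient mapping. The weights in the Lyapunov function
  \<open>\<Phi> + A k\<^sup>-\<^sup>2\<^sup>t a + B k\<^sup>-\<^sup>4\<^sup>t b\<close> are dictated by \<open>\<alpha>\<^sub>k \<rho>\<^sub>k\<^sup>2 / (\<beta>\<^sub>k \<sigma>\<^sub>k)\<close> and \<open>\<alpha>\<^sub>k / \<eta>\<^sub>k\<close>.
\<close>

locale rate_recursion =
  fixes s t c C :: real and \<Phi> a b S G :: "nat \<Rightarrow> real" and k0 :: nat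
  assumes exps: "0 < t" "0 < s" "11 * t + s < 1"
    and const: "0 < c" "0 < C"
    and nonneg: "\<And>k. 0 \<le> a k" "\<And>k. 0 \<le> b k" "\<And>k. 0 \<le> S k" "\<And>k. 0 \<le> G k"
    and bdd_below: "\<And>k. - C \<le> \<Phi> k"
    and descent: "\<And>k. k0 \<le> k \<Longrightarrow>
      \<Phi> (Suc k) + c * pw (9 * t + s) k * S k + c * pw (- 9 * t - s) k * G k
      \<le> \<Phi> k + C * pw (- 9 * t - s) k * b k + C * pw (- 7 * t - s) k * a k
         + C * (pw (- 8 * t - 2 * s) k + pw (t - 1) k)"
    and tracking: "\<And>k. k0 \<le> k \<Longrightarrow>
      a (Suc k) \<le> (1 - c * pw (- 5 * t - s) k) * a k
        + C * (pw (- 6 * t - 2 * s) k + pw (9 * t + s) k * S k + pw (9 * t + s - 2) k)"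
    and momentum: "\<And>k. k0 \<le> k \<Longrightarrow>
      b (Suc k) \<le> (1 - c * pw (- 5 * t - s) k) * b k
        + C * (pw (- 4 * t - 2 * s) k * (1 + a (Suc k)) + pw (2 * t) k * S k)"
begin

text \<open>B is chosen so that the momentum contraction cancels the b-term of the descent, and A so
  that the tracking contraction cancels the a-terms of the descent and of the momentum recursion.
  The squared steps that remain carry weights up to k^(7t+s), a factor k^(-2t) below what the
  descent provides.\<close>

lemma lyapunov_decrease:
  "\<exists>V k1 C'. k0 \<le> k1 \<and> 0 \<le> C' \<and> (\<forall>k. - C \<le> V k) \<and> (\<forall>k\<ge>k1.
     V (Suc k) + c / 2 * (pw (9 * t + s) k * S k + pw (- 9 * t - s) k * G k)
     \<le> V k + C' * (pw (- 8 * t - 2 * s) k + pw (t - 1) k + pw (7 * t + s - 2) k))"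
proof -
  define B where "B = C / c"
  define A where "A = (C + B * C) / c"
  have AB: "0 < B" "0 < A" "B * c = C" "A * c = C + B * C"
    using const by (auto simp: A_def B_def add_pos_pos)
  define D where "D = A + B * C"
  have D: "0 < D" using AB const by (simp add: D_def add_pos_pos)
  define V where "V k = \<Phi> k + A * pw (- 2 * t) k * a k + B * pw (- 4 * t) k * b k" for k
  define C' where "C' = C + B * C + D * C"
  have C': "0 \<le> C'" "C + B * C + D * C \<le> C'" "C \<le> C'" "D * C \<le> C'"
    using AB const D by (auto simp: C'_def)
  obtain k2 where k2: "\<And>k. k2 \<le> k \<Longrightarrow> (B * C + D * C) * pw (7 * t + s) k \<le> c / 2 * pw (9 * t + s) k"
    using pw_eventually_le[of "7 * t + s" "9 * t + s" "c / 2" "B * C + D * C"] exps const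
    by (auto simp: eventually_sequentially)
  define k1 where "k1 = max k0 k2"
  have "V (Suc k) + c / 2 * (pw (9 * t + s) k * S k + pw (- 9 * t - s) k * G k)
     \<le> V k + C' * (pw (- 8 * t - 2 * s) k + pw (t - 1) k + pw (7 * t + s - 2) k)" if k: "k1 \<le> k" for k
  proof -
    have k0: "k0 \<le> k" and k2': "k2 \<le> k" using k by (auto simp: k1_def)
    define p2 where "p2 = pw (- 2 * t) k"
    define p4 where "p4 = pw (- 4 * t) k"
    define p5 where "p5 = pw (- 5 * t - s) k"
    define p7 where "p7 = pw (- 7 * t - s) k"
    define p8 where "p8 = pw (- 8 * t - 2 * s) k"
    define p9 where "p9 = pw (- 9 * t - s) k"
    define m where "m = pw (- 6 * t - 2 * s) k + pw (9 * t + s) k * S k + pw (9 * t + s - 2) k"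
    have pos: "0 < p2" "0 < p4" "0 < p5" "0 < p7" "0 < p8" "0 < p9" 
      by (auto simp: p2_def p4_def p5_def p7_def p8_def p9_def)
    have m0: "0 \<le> m" using nonneg by (simp add: m_def)
    have eqs: "p2 * p5 = p7" "p4 * p5 = p9" "p4 * pw (- 4 * t - 2 * s) k = p8" "p4 * pw (2 * t) k = p2"
      "p2 * pw (- 6 * t - 2 * s) k = p8" "p2 * pw (9 * t + s) k = pw (7 * t + s) k"
      "p2 * pw (9 * t + s - 2) k = pw (7 * t + s - 2) k"
      unfolding p2_def p4_def p5_def p7_def p8_def p9_def pw_mult
      by (rule arg_cong[where f = "\<lambda>e. pw e k"], simp)+
    have p87: "p8 \<le> p7" "p8 \<le> p2" "p2 \<le> pw (7 * t + s) k"
      unfolding p8_def p7_def p2_def using exps by (auto intro!: pw_mono)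
    have "V (Suc k) \<le> \<Phi> (Suc k) + A * p2 * a (Suc k) + B * p4 * b (Suc k)"
      unfolding V_def p2_def p4_def using exps AB nonneg
      by (intro add_mono mult_right_mono mult_left_mono pw_Suc_le order_refl) auto
    also have "B * p4 * b (Suc k) \<le> B * p4 * ((1 - c * p5) * b k
        + C * (pw (- 4 * t - 2 * s) k * (1 + a (Suc k)) + pw (2 * t) k * S k))"
      using momentum[OF k0] AB pos by (intro mult_left_mono) (auto simp: p5_def)
    also have "\<dots> = B * p4 * b k - (B * c) * (p4 * p5) * b k + B * C * (p4 * pw (- 4 * t - 2 * s) k) * (1 + a (Suc k))
        + B * C * (p4 * pw (2 * t) k) * S k"
      by (simp add: algebra_simps)
    finally have 1: "V (Suc k) \<le> \<Phi> (Suc k) + B * p4 * b k - C * p9 * b k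
        + (A * p2 + B * C * p8) * a (Suc k) + B * C * p8 + B * C * p2 * S k"
      unfolding eqs AB by (simp add: algebra_simps)
    \<comment> \<open>The momentum bound contains a (Suc k), so tracking is applied to the Lyapunov
      weight and this contribution together.\<close>
    have "(A * p2 + B * C * p8) * a (Suc k) \<le> (A * p2 + B * C * p8) * ((1 - c * p5) * a k + C * m)"
      using tracking[OF k0] AB pos const by (intro mult_left_mono) (auto simp: p5_def m_def)
    also have "\<dots> = (A * p2 * a k - (A * c) * (p2 * p5) * a k) + B * C * p8 * a k - (B * C * p8 * c * p5) * a k
        + (A * p2 + B * C * p8) * (C * m)"
      by (simp add: algebra_simps)
    also have "\<dots> \<le> (A * p2 * a k - (A * c) * (p2 * p5) * a k) + B * C * p7 * a k - 0
        + (A * p2 + B * C * p2) * (C * m)"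
      using AB pos const p87 nonneg m0
      by (intro add_mono diff_mono mult_right_mono mult_left_mono order_refl) auto
    also have "\<dots> = A * p2 * a k - C * p7 * a k + D * C * (p2 * m)"
      unfolding eqs AB by (simp add: algebra_simps D_def)
    also have "p2 * m = p8 + pw (7 * t + s) k * S k + pw (7 * t + s - 2) k"
      by (simp only: m_def distrib_left mult.assoc[symmetric] eqs)
    finally have 2: "(A * p2 + B * C * p8) * a (Suc k) \<le> A * p2 * a k - C * p7 * a k
        + D * C * (p8 + pw (7 * t + s) k * S k + pw (7 * t + s - 2) k)" .
    have 3: "B * C * p2 * S k + D * C * (pw (7 * t + s) k * S k) \<le> c / 2 * pw (9 * t + s) k * S k"
    proof -
      have "B * C * p2 * S k + D * C * (pw (7 * t + s) k * S k) \<le> ((B * C + D * C) * pw (7 * t + s) k) * S k"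
        using mult_right_mono[OF mult_left_mono[OF p87(3), of "B * C"], of "S k"] AB const nonneg
        by (simp add: algebra_simps)
      also have "\<dots> \<le> c / 2 * pw (9 * t + s) k * S k"
        using k2[OF k2'] nonneg by (intro mult_right_mono)
      finally show ?thesis .
    qed
    have 4: "\<Phi> (Suc k) + c * pw (9 * t + s) k * S k + c * p9 * G k
      \<le> \<Phi> k + C * p9 * b k + C * p7 * a k + C * (p8 + pw (t - 1) k)"
      using descent[OF k0] by (simp add: p9_def p7_def p8_def)
    have 5: "c / 2 * (pw (9 * t + s) k * S k + p9 * G k) \<le> c * pw (9 * t + s) k * S k + c * p9 * G k - c / 2 * pw (9 * t + s) k * S k"
      using mult_nonneg_nonneg[OF mult_nonneg_nonneg, of c p9 "G k"] const nonneg pos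
      by (simp add: algebra_simps)
    have 6: "C * (p8 + pw (t - 1) k) + B * C * p8 + D * C * (p8 + pw (7 * t + s - 2) k)
       \<le> C' * (p8 + pw (t - 1) k + pw (7 * t + s - 2) k)"
    proof -
      have "C * pw (t - 1) k \<le> C' * pw (t - 1) k" "D * C * pw (7 * t + s - 2) k \<le> C' * pw (7 * t + s - 2) k"
        using C' by (intro mult_right_mono; simp)+
      then show ?thesis by (simp add: C'_def algebra_simps)
    qed
    have Vk: "V k = \<Phi> k + A * p2 * a k + B * p4 * b k" by (simp add: V_def p2_def p4_def)
    have d: "D * C * (p8 + pw (7 * t + s) k * S k + pw (7 * t + s - 2) k)
      = D * C * (p8 + pw (7 * t + s - 2) k) + D * C * (pw (7 * t + s) k * S k)"
      by (simp add: algebra_simps)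
    show ?thesis
      using 1 2[unfolded d] 3 4 5 6 unfolding Vk p9_def[symmetric] p8_def[symmetric] by linarith
  qed
  moreover have "- C \<le> V k" for k
    using bdd_below[of k] nonneg AB by (auto simp: V_def intro!: add_increasing2)
  ultimately show ?thesis
    using C' by (intro exI[of _ V] exI[of _ k1] exI[of _ C']) (auto simp: k1_def)
qed

text \<open>The Lyapunov inequality is telescoped. As p > 0, the right-hand side is at least 1 up to
  the constant, which absorbs the initial value. The two rates need different p and q, so both are
  left free.\<close>

lemma weighted_sums:
  assumes p: "0 < p" "t \<le> p" "7 * t + s - 1 \<le> p" "1 - 8 * t - 2 * s \<le> q"
  shows "\<exists>k1 C''. k0 \<le> k1 \<and> 0 \<le> C'' \<and> (\<forall>K. k1 \<le> K \<longrightarrow> 1 \<le> K \<longrightarrow>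
    (\<Sum>k = k1..<Suc K. pw (9 * t + s) k * S k + pw (- 9 * t - s) k * G k)
      \<le> C'' * (real K powr p + real K powr q))"
proof -
  obtain V k1 C' where V: "k0 \<le> k1" "0 \<le> C'" "\<And>k. - C \<le> V k" and dec: "\<And>k. k1 \<le> k \<Longrightarrow>
     V (Suc k) + c / 2 * (pw (9 * t + s) k * S k + pw (- 9 * t - s) k * G k)
     \<le> V k + C' * (pw (- 8 * t - 2 * s) k + pw (t - 1) k + pw (7 * t + s - 2) k)"
    using lyapunov_decrease by blast
  obtain C1 C2 C3 where C1: "C1 \<ge> 0" "\<And>K. K\<ge>1 \<Longrightarrow> (\<Sum>k<Suc K. pw (- 8 * t - 2 * s) k) \<le> C1 * (real K powr p + real K powr q)"
    and C2: "C2 \<ge> 0" "\<And>K. K\<ge>1 \<Longrightarrow> (\<Sum>k<Suc K. pw (t - 1) k) \<le> C2 * (real K powr p + real K powr q)"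
    and C3: "C3 \<ge> 0" "\<And>K. K\<ge>1 \<Longrightarrow> (\<Sum>k<Suc K. pw (7 * t + s - 2) k) \<le> C3 * (real K powr p + real K powr q)"
    using pw_sum_le2[of p "- 8 * t - 2 * s" q] pw_sum_le2[of p "t - 1" q] pw_sum_le2[of p "7 * t + s - 2" q] p
    by (auto simp: algebra_simps)
  define C'' where "C'' = 2 / c * (\<bar>V k1\<bar> + C + C' * (C1 + C2 + C3))"
  have C'': "0 \<le> C''" using const V C1 C2 C3 by (simp add: C''_def)
  have "(\<Sum>k = k1..<Suc K. pw (9 * t + s) k * S k + pw (- 9 * t - s) k * G k)
      \<le> C'' * (real K powr p + real K powr q)" if K: "k1 \<le> K" "1 \<le> K" for K
  proof -
    define r where "r = real K powr p + real K powr q"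
    have "1 \<le> real K powr p" using p K by (intro ge_one_powr_ge_zero) auto
    then have r: "1 \<le> r" by (simp add: r_def add_increasing2)
    have le: "(\<Sum>k = k1..<Suc K. pw e k) \<le> (\<Sum>k<Suc K. pw e k)" for e
      by (rule sum_mono2) auto
    define Z where "Z = (\<Sum>k = k1..<Suc K. pw (9 * t + s) k * S k + pw (- 9 * t - s) k * G k)"
    have "V (Suc K) + (\<Sum>k = k1..<Suc K. c / 2 * (pw (9 * t + s) k * S k + pw (- 9 * t - s) k * G k))
      \<le> V k1 + (\<Sum>k = k1..<Suc K. C' * (pw (- 8 * t - 2 * s) k + pw (t - 1) k + pw (7 * t + s - 2) k))"
      using dec K by (intro telescoping_sum_le) auto
    then have "V (Suc K) + c / 2 * Z \<le> V k1 + C' * ((\<Sum>k = k1..<Suc K. pw (- 8 * t - 2 * s) k)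
        + (\<Sum>k = k1..<Suc K. pw (t - 1) k) + (\<Sum>k = k1..<Suc K. pw (7 * t + s - 2) k))"
      by (simp only: sum_distrib_left[symmetric] sum.distrib Z_def)
    also have "\<dots> \<le> V k1 + C' * (C1 * r + C2 * r + C3 * r)"
      unfolding r_def
      by (intro add_left_mono mult_left_mono add_mono V(2) order_trans[OF le C1(2)[OF K(2)]]
          order_trans[OF le C2(2)[OF K(2)]] order_trans[OF le C3(2)[OF K(2)]])
    finally have "c / 2 * Z \<le> (\<bar>V k1\<bar> + C) + C' * (C1 + C2 + C3) * r"
      using V(3)[of "Suc K"] by (simp add: algebra_simps)
    also have "\<dots> \<le> (\<bar>V k1\<bar> + C) * r + C' * (C1 + C2 + C3) * r"
      using r const mult_left_mono[OF r, of "\<bar>V k1\<bar> + C"] by simp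
    finally have "c / 2 * Z \<le> (\<bar>V k1\<bar> + C) * r + C' * (C1 + C2 + C3) * r" .
    then have "Z \<le> C'' * r"
      using const by (simp add: C''_def field_simps)
    then show ?thesis by (simp only: r_def Z_def)
  qed
  with V C'' show ?thesis by blast
qed

text \<open>For the weight exponent -9t - s, \<open>min_rate\<close> turns p = 2t and q = 1 - 7t -
  2s into 1 - 11t - s and s - 2t.\<close>

lemma gradient_rate:
  "(\<lambda>K. MIN k\<in>{0..K}. G k) \<in> O(\<lambda>K. 1 / real K powr (1 - 11 * t - s) + 1 / real K powr (s - 2 * t))"
proof -
  obtain k1 C'' where C'': "0 \<le> C''" "\<And>K. k1 \<le> K \<Longrightarrow> 1 \<le> K \<Longrightarrow>
    (\<Sum>k = k1..<Suc K. pw (9 * t + s) k * S k + pw (- 9 * t - s) k * G k)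
      \<le> C'' * (real K powr (2 * t) + real K powr (1 - 7 * t - 2 * s))"
    using weighted_sums[of "2 * t" "1 - 7 * t - 2 * s"] exps by auto
  have "(\<Sum>k = k1..<Suc K. pw (- 9 * t - s) k * G k)
      \<le> C'' * (real K powr (2 * t) + real K powr (1 - 7 * t - 2 * s))" if "k1 \<le> K" "1 \<le> K" for K
    using nonneg by (intro order_trans[OF sum_mono C''(2)[OF that]]) simp
  from min_rate[OF _ C''(1) nonneg(4) this]
  show ?thesis using exps by (simp add: algebra_simps)
qed

text \<open>The tracking recursion is summed once more: its contraction leaves the weighted sum of
  a, and \<open>weighted_sums\<close> controls the steps. For the weight exponent -5t - s, the
  choice p = 3t and q = 1 - 6t - 2s gives 1 - 8t - s and s + t.\<close>

lemma tracking_rate: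
  "(\<lambda>K. MIN k\<in>{0..K}. a k) \<in> O(\<lambda>K. 1 / real K powr (1 - 8 * t - s) + 1 / real K powr (s + t))"
proof -
  let ?r = "\<lambda>K. real K powr (3 * t) + real K powr (1 - 6 * t - 2 * s)"
  obtain k1 C'' where C'': "k0 \<le> k1" "0 \<le> C''" "\<And>K. k1 \<le> K \<Longrightarrow> 1 \<le> K \<Longrightarrow>
    (\<Sum>k = k1..<Suc K. pw (9 * t + s) k * S k + pw (- 9 * t - s) k * G k) \<le> C'' * ?r K"
    using weighted_sums[of "3 * t" "1 - 6 * t - 2 * s"] exps by auto
  obtain C1 C2 where C1: "C1 \<ge> 0" "\<And>K. K\<ge>1 \<Longrightarrow> (\<Sum>k<Suc K. pw (- 6 * t - 2 * s) k) \<le> C1 * ?r K"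
    and C2: "C2 \<ge> 0" "\<And>K. K\<ge>1 \<Longrightarrow> (\<Sum>k<Suc K. pw (9 * t + s - 2) k) \<le> C2 * ?r K"
    using pw_sum_le2[of "3 * t" "- 6 * t - 2 * s" "1 - 6 * t - 2 * s"]
      pw_sum_le2[of "3 * t" "9 * t + s - 2" "1 - 6 * t - 2 * s"] exps
    by (auto simp: algebra_simps)
  have sum: "(\<Sum>k = k1..<Suc K. pw (- 5 * t - s) k * a k) \<le> ((a k1 + C * (C1 + C'' + C2)) / c) * ?r K"
    if K: "k1 \<le> K" "1 \<le> K" for K
  proof -
    have "1 \<le> real K powr (3 * t)" using exps K by (intro ge_one_powr_ge_zero) auto
    then have r: "1 \<le> ?r K" by (simp add: add_increasing2)
    have le: "(\<Sum>k = k1..<Suc K. pw e k) \<le> (\<Sum>k<Suc K. pw e k)" for e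
      by (rule sum_mono2) auto
    have S: "(\<Sum>k = k1..<Suc K. pw (9 * t + s) k * S k) \<le> C'' * ?r K"
      using nonneg by (intro order_trans[OF sum_mono C''(3)[OF K]]) simp
    define Z where "Z = (\<Sum>k = k1..<Suc K. pw (- 5 * t - s) k * a k)"
    have "a (Suc K) + (\<Sum>k = k1..<Suc K. c * (pw (- 5 * t - s) k * a k))
      \<le> a k1 + (\<Sum>k = k1..<Suc K. C * (pw (- 6 * t - 2 * s) k + pw (9 * t + s) k * S k + pw (9 * t + s - 2) k))"
    proof (rule telescoping_sum_le)
      fix k assume "k1 \<le> k"
      then have "k0 \<le> k" using C''(1) by simp
      from tracking[OF this]
      show "a (Suc k) + c * (pw (- 5 * t - s) k * a k)
        \<le> a k + C * (pw (- 6 * t - 2 * s) k + pw (9 * t + s) k * S k + pw (9 * t + s - 2) k)"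
        by (simp add: algebra_simps)
    qed (use K in simp)
    then have "a (Suc K) + c * Z \<le> a k1 + C * ((\<Sum>k = k1..<Suc K. pw (- 6 * t - 2 * s) k)
        + (\<Sum>k = k1..<Suc K. pw (9 * t + s) k * S k) + (\<Sum>k = k1..<Suc K. pw (9 * t + s - 2) k))"
      by (simp only: sum_distrib_left[symmetric] sum.distrib Z_def)
    also have "\<dots> \<le> a k1 + C * (C1 * ?r K + C'' * ?r K + C2 * ?r K)"
      by (intro add_left_mono mult_left_mono add_mono S less_imp_le[OF const(2)]
          order_trans[OF le C1(2)[OF K(2)]] order_trans[OF le C2(2)[OF K(2)]])
    finally have "c * Z \<le> a k1 + C * (C1 + C'' + C2) * ?r K"
      using nonneg(1)[of "Suc K"] by (simp add: algebra_simps)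
    also have "\<dots> \<le> a k1 * ?r K + C * (C1 + C'' + C2) * ?r K"
      using mult_left_mono[OF r, of "a k1"] nonneg by simp
    finally have "c * Z \<le> a k1 * ?r K + C * (C1 + C'' + C2) * ?r K" .
    then have "Z \<le> ((a k1 + C * (C1 + C'' + C2)) / c) * ?r K"
      using const by (simp add: field_simps)
    then show ?thesis by (simp only: Z_def)
  qed
  have "0 \<le> (a k1 + C * (C1 + C'' + C2)) / c"
    using nonneg const C'' C1 C2 by simp
  from min_rate[OF _ this nonneg(1) sum]
  show ?thesis using exps by (simp add: algebra_simps)
qed

end

section \<open>Bounds along the parameter sequences\<close>

locale bilevel_path = bilevel X Y F f L
  for X :: "'a::euclidean_space set" and Y :: "'b::euclidean_space set"
    and F f :: "'a \<Rightarrow> 'b \<Rightarrow> real" and L :: real +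
  fixes \<sigma>0 \<delta>0 \<rho>0 t :: real
  assumes path_params: "0 < \<sigma>0" "0 < \<delta>0" "0 < \<rho>0" and t_bounds: "0 < t" "t \<le> 1"
begin

definition rh where "rh = pow_seq \<rho>0 t"
definition sg where "sg = pow_seq \<sigma>0 (- t)"
definition de where "de = pow_seq \<delta>0 (- t)"
definition Tk where "Tk k = T (rh k) (sg k) (de k)"
definition gk where "gk k = gx (rh k)"
definition usk where "usk k = us (rh k) (sg k) (de k)"
definition phik where "phik k = phi (rh k) (sg k) (de k)"

abbreviation (input) \<open>m0 \<equiv> min \<sigma>0 \<delta>0\<close>
abbreviation (input) \<open>K0 \<equiv> 1 + \<rho>0 + \<sigma>0 + \<delta>0\<close>

lemma par_pos: "0 < rh k" "0 < sg k" "0 < de k"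
  using path_params by (auto simp: rh_def sg_def de_def pow_seq_eq)

lemma par_eq: "rh k = \<rho>0 * pw t k" "sg k = \<sigma>0 * pw (- t) k" "de k = \<delta>0 * pw (- t) k"
  by (auto simp: rh_def sg_def de_def pow_seq_eq)

lemma m0_pos: "0 < m0" and K0_ge: "1 \<le> K0"
  using path_params by auto

lemma min_par: "min (sg k) (de k) = m0 * pw (- t) k"
  unfolding par_eq by (simp add: min_mult_distrib_right order.strict_implies_not_eq)

lemma sum_par: "1 + rh k + sg k + de k \<le> K0 * pw t k"
proof -
  have "1 \<le> pw t k" "pw (- t) k \<le> pw t k" using t_bounds by (auto intro: pw_ge_1 pw_mono)
  then have "\<sigma>0 * pw (- t) k \<le> \<sigma>0 * pw t k" "\<delta>0 * pw (- t) k \<le> \<delta>0 * pw t k"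
    using path_params by (auto intro: mult_left_mono)
  with \<open>1 \<le> pw t k\<close> show ?thesis
    unfolding par_eq by (simp add: algebra_simps)
qed

lemma one_rh: "1 + rh k \<le> K0 * pw t k"
  using sum_par[of k] par_pos[of k] by linarith

lemma par_drift: "\<bar>rh (Suc k) - rh k\<bar> + \<bar>sg (Suc k) - sg k\<bar> + \<bar>de (Suc k) - de k\<bar> \<le> K0 * pw (t - 1) k"
proof -
  have "\<bar>pw t (Suc k) - pw t k\<bar> \<le> t * pw (t - 1) k"
    using pw_increment[of t k] t_bounds by simp
  also have "\<dots> \<le> 1 * pw (t - 1) k" using t_bounds by (intro mult_right_mono) auto
  finally have up: "\<bar>pw t (Suc k) - pw t k\<bar> \<le> pw (t - 1) k" by simp
  have "\<bar>pw (- t) (Suc k) - pw (- t) k\<bar> \<le> t * pw (- t - 1) k"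
    using pw_increment[of "- t" k] t_bounds by simp
  also have "\<dots> \<le> 1 * pw (t - 1) k" using t_bounds by (intro mult_mono pw_mono) auto
  finally have down: "\<bar>pw (- t) (Suc k) - pw (- t) k\<bar> \<le> pw (t - 1) k" by simp
  have "\<bar>rh (Suc k) - rh k\<bar> \<le> \<rho>0 * pw (t - 1) k"
    "\<bar>sg (Suc k) - sg k\<bar> \<le> \<sigma>0 * pw (t - 1) k" "\<bar>de (Suc k) - de k\<bar> \<le> \<delta>0 * pw (t - 1) k"
    unfolding par_eq right_diff_distrib[symmetric] abs_mult
    using path_params up down by (auto intro!: mult_left_mono)
  then show ?thesis
    using pw_nonneg[of "t - 1" k] unfolding distrib_right mult_1 by linarith
qed

lemma usk_in: "x \<in> X \<Longrightarrow> usk k x \<in> Y \<times> Y"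
  unfolding usk_def using par_pos by (intro saddle_in)

lemma Tk_strongly_monotone:
  assumes "x \<in> X" "u \<in> Y \<times> Y" "v \<in> Y \<times> Y"
  shows "m0 * pw (- t) k * (norm (u - v))\<^sup>2 \<le> (Tk k x u - Tk k x v) \<bullet> (u - v)"
  using saddle_op_strongly_monotone[OF assms, of "rh k" "sg k" "de k"] par_pos[of k]
  by (simp add: Tk_def min_par)

lemma Tk_lipschitz:
  assumes "x \<in> X" "x' \<in> X" "u \<in> Y \<times> Y" "v \<in> Y \<times> Y"
  shows "norm (Tk k x u - Tk k x' v) \<le> 3 * L * K0 * pw t k * (norm (x - x') + norm (u - v))"
proof -
  have "norm (Tk k x u - Tk k x' v) \<le> 3 * L * (1 + rh k + sg k + de k) * (norm (x - x') + norm (u - v))"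
    unfolding Tk_def using par_pos[of k] by (intro saddle_op_lipschitz assms) auto
  also have "\<dots> \<le> 3 * L * (K0 * pw t k) * (norm (x - x') + norm (u - v))"
    using L sum_par by (intro mult_right_mono mult_left_mono) auto
  finally show ?thesis by (simp add: mult.assoc)
qed

lemma gk_lipschitz:
  assumes "x \<in> X" "x' \<in> X" "u \<in> Y \<times> Y" "v \<in> Y \<times> Y"
  shows "norm (gk k x u - gk k x' v) \<le> 2 * L * K0 * pw t k * (norm (x - x') + norm (u - v))"
proof -
  have "norm (gk k x u - gk k x' v) \<le> 2 * L * (1 + rh k) * (norm (x - x') + norm (u - v))"
    unfolding gk_def using par_pos[of k] by (intro upper_dir_lipschitz assms) auto
  also have "\<dots> \<le> 2 * L * (K0 * pw t k) * (norm (x - x') + norm (u - v))"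
    using L one_rh by (intro mult_right_mono mult_left_mono) auto
  finally show ?thesis by (simp add: mult.assoc)
qed

lemma lip_ratio: "3 * L * (1 + rh k + sg k + de k) / min (sg k) (de k) \<le> 3 * L * K0 / m0 * pw (2 * t) k"
proof -
  have "3 * L * (1 + rh k + sg k + de k) / min (sg k) (de k) \<le> 3 * L * (K0 * pw t k) / (m0 * pw (- t) k)"
    unfolding min_par using L sum_par m0_pos by (intro divide_right_mono mult_left_mono) auto
  also have "\<dots> = 3 * L * K0 / m0 * (pw t k * pw t k)"
    by (simp add: pw_minus)
  also have "pw t k * pw t k = pw (2 * t) k" by (simp add: pw_mult)
  finally show ?thesis .
qed

lemma usk_lipschitz:
  assumes "x \<in> X" "x' \<in> X"
  shows "norm (usk k x - usk k x') \<le> 3 * L * K0 / m0 * pw (2 * t) k * norm (x - x')"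
  unfolding usk_def
  by (rule order_trans[OF saddle_lipschitz[OF assms par_pos] mult_right_mono[OF lip_ratio]]) simp

text \<open>The direction \<open>gk\<close> is Lipschitz with constant of order k^t and the saddle
  point with k^(2t); the product is k^(3t).\<close>

lemma phik_remainder:
  assumes "x \<in> X" "x' \<in> X"
  shows "\<bar>phik k x' - phik k x - (x' - x) \<bullet> gk k x (usk k x)\<bar>
    \<le> (2 * L * K0 + 2 * L * K0 * (3 * L * K0 / m0)) * pw (3 * t) k * (norm (x' - x))\<^sup>2"
proof -
  let ?r = "3 * L * (1 + rh k + sg k + de k) / min (sg k) (de k)"
  have "L * (1 + 2 * rh k) \<le> 2 * L * K0 * pw (3 * t) k"
  proof -
    have "1 + 2 * rh k \<le> 2 * (K0 * pw t k)" using one_rh[of k] by linarith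
    also have "\<dots> \<le> 2 * (K0 * pw (3 * t) k)"
      using path_params t_bounds by (intro mult_left_mono pw_mono) auto
    finally show ?thesis using L by (simp add: mult.assoc mult_left_mono)
  qed
  moreover have "2 * L * (1 + rh k) * ?r \<le> 2 * L * (K0 * pw t k) * (3 * L * K0 / m0 * pw (2 * t) k)"
    using L one_rh lip_ratio par_pos[of k] K0_ge 
    by (intro mult_mono mult_left_mono) auto
  moreover have "2 * L * (K0 * pw t k) * (3 * L * K0 / m0 * pw (2 * t) k)
      = 2 * L * K0 * (3 * L * K0 / m0) * (pw t k * pw (2 * t) k)"
    by (simp only: mult_ac)
  then have "2 * L * (K0 * pw t k) * (3 * L * K0 / m0 * pw (2 * t) k) = 2 * L * K0 * (3 * L * K0 / m0) * pw (3 * t) k"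
    by (simp only: pw_mult) simp
  ultimately have "L * (1 + 2 * rh k) + 2 * L * (1 + rh k) * ?r
      \<le> (2 * L * K0 + 2 * L * K0 * (3 * L * K0 / m0)) * pw (3 * t) k"
    unfolding distrib_right by linarith
  then show ?thesis
    unfolding phik_def gk_def usk_def
    by (rule order_trans[OF phi_remainder[OF assms par_pos] mult_right_mono]) simp
qed

lemma proj_grad_map_phik:
  assumes "x \<in> X"
  shows "proj_grad_map X a (phik k) x = (1 / a) *\<^sub>R (x - closest_point X (x - a *\<^sub>R gk k x (usk k x)))"
  unfolding phik_def gk_def usk_def
  using X assms par_pos by (intro proj_grad_map_eq phi_has_derivative) (auto intro: compact_imp_closed)

lemma usk_step: 
  assumes "x \<in> X" "0 < \<beta>"
  shows "closest_point (Y \<times> Y) (usk k x - \<beta> *\<^sub>R Tk k x (usk k x)) = usk k x"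
  using saddle_vi_sol[OF assms(1) par_pos] vi_sol_iff_fixed_point[OF YY assms(2)]
  by (auto simp: usk_def Tk_def)

text \<open>Gathers all estimates under one constant, leaving only the powers of k + 1 visible. The
  ratio \<kappa> is \<sigma>0 / \<delta>0, since both regularization parameters decay with the same
  exponent.\<close>

lemma uniform_bounds:
  obtains C where "1 \<le> C"
    "\<And>k x. x \<in> X \<Longrightarrow> norm (usk k x) \<le> C"
    "\<And>k x. x \<in> X \<Longrightarrow> - C \<le> phik k x"
    "\<And>k x. x \<in> X \<Longrightarrow> norm (Tk k x (usk k x)) \<le> C * pw t k"
    "\<And>k x. x \<in> X \<Longrightarrow> norm (usk (Suc k) x - usk k x) \<le> C * pw (2 * t - 1) k"
    "\<And>k x. x \<in> X \<Longrightarrow> phik (Suc k) x \<le> phik k x + C * pw (t - 1) k"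
    "\<And>k x x' u v. x \<in> X \<Longrightarrow> x' \<in> X \<Longrightarrow> u \<in> Y \<times> Y \<Longrightarrow> v \<in> Y \<times> Y \<Longrightarrow>
      norm (Tk k x u - Tk k x' v) \<le> C * pw t k * (norm (x - x') + norm (u - v))"
    "\<And>k x x' u v. x \<in> X \<Longrightarrow> x' \<in> X \<Longrightarrow> u \<in> Y \<times> Y \<Longrightarrow> v \<in> Y \<times> Y \<Longrightarrow>
      norm (gk k x u - gk k x' v) \<le> C * pw t k * (norm (x - x') + norm (u - v))"
    "\<And>k x x'. x \<in> X \<Longrightarrow> x' \<in> X \<Longrightarrow> norm (usk k x - usk k x') \<le> C * pw (2 * t) k * norm (x - x')"
    "\<And>k x x'. x \<in> X \<Longrightarrow> x' \<in> X \<Longrightarrow>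
      \<bar>phik k x' - phik k x - (x' - x) \<bullet> gk k x (usk k x)\<bar> \<le> C * pw (3 * t) k * (norm (x' - x))\<^sup>2"
proof -
  obtain R where R: "0 \<le> R" and R_bd: "\<And>x \<rho> \<sigma> \<delta>. x \<in> X \<Longrightarrow> 0 < \<rho> \<Longrightarrow> 0 < \<sigma> \<Longrightarrow> \<sigma> \<le> \<sigma>0 \<Longrightarrow> 0 < \<delta> \<Longrightarrow> \<delta> \<le> \<delta>0 \<Longrightarrow>
      \<sigma> \<le> (\<sigma>0 / \<delta>0) * \<delta> \<Longrightarrow> norm (us \<rho> \<sigma> \<delta> x) \<le> R \<and> - R \<le> phi \<rho> \<sigma> \<delta> x"
    using saddle_uniformly_bounded[OF path_params(1,2), of "\<sigma>0 / \<delta>0"] by metis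
  have le0: "sg k \<le> \<sigma>0" "de k \<le> \<delta>0" "sg k \<le> (\<sigma>0 / \<delta>0) * de k" for k
    unfolding par_eq using path_params t_bounds pw_le_1[of "- t" k] by (auto intro: mult_left_le)
  have uR: "norm (usk k x) \<le> R" and pR: "- R \<le> phik k x" if "x \<in> X" for k x
    using R_bd[OF that par_pos(1,2) le0(1) par_pos(3) le0(2,3)] by (auto simp: usk_def phik_def)
  obtain A where A: "0 \<le> A" "\<And>x y. x \<in> X \<Longrightarrow> y \<in> Y \<Longrightarrow> norm y \<le> R \<Longrightarrow> norm (grad_y F x y) \<le> A"
    by (rule smooth_on_bounded[OF F_smooth X(3) compact_imp_bounded[OF X(2)] Y(3)
          order_trans[OF zero_le_one L], of R]) (rule that; blast)
  obtain B where B: "0 \<le> B" "\<And>x y. x \<in> X \<Longrightarrow> y \<in> Y \<Longrightarrow> norm y \<le> R \<Longrightarrow> \<bar>f x y\<bar> \<le> B"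
      "\<And>x y. x \<in> X \<Longrightarrow> y \<in> Y \<Longrightarrow> norm y \<le> R \<Longrightarrow> norm (grad_y f x y) \<le> B"
    by (rule smooth_on_bounded[OF f_smooth X(3) compact_imp_bounded[OF X(2)] Y(3)
          order_trans[OF zero_le_one L], of R]) (rule that; blast)
  have comp: "fst (usk k x) \<in> Y" "snd (usk k x) \<in> Y" "norm (fst (usk k x)) \<le> R" "norm (snd (usk k x)) \<le> R"
    if "x \<in> X" for k x
    using usk_in[OF that, of k] uR[OF that, of k] norm_fst_bound[of "usk k x"] norm_snd_bound[of "usk k x"] by auto
  define E where "E = 2 * B + 4 * R"
  have E0: "0 \<le> E" using B R by (simp add: E_def)
  have E: "norm (grad_y f x (fst (usk k x))) + norm (grad_y f x (snd (usk k x)))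
      + 2 * norm (fst (usk k x)) + 2 * norm (snd (usk k x)) \<le> E" if "x \<in> X" for k x
    using comp[OF that, of k] B(3)[OF that, of "fst (usk k x)"] B(3)[OF that, of "snd (usk k x)"]
    unfolding E_def by linarith
  define C1 where "C1 = (A + E) * K0"
  have C1: "norm (Tk k x (usk k x)) \<le> C1 * pw t k" if x: "x \<in> X" for k x
  proof -
    \<comment> \<open>With zero parameters only -\<nabla>F is left in the operator.\<close>
    have "norm (T 0 0 0 x (usk k x)) \<le> A"
      using A(2)[OF x comp(1,3)[OF x]] by (simp add: saddle_op_def norm_Pair)
    moreover have "norm (Tk k x (usk k x) - T 0 0 0 x (usk k x)) \<le> (rh k + sg k + de k) * E"
      unfolding Tk_def using par_pos[of k] E[OF x, of k]
      by (intro order_trans[OF saddle_op_param] mult_mono) auto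
    ultimately have "norm (Tk k x (usk k x)) \<le> A + (rh k + sg k + de k) * E"
      using norm_triangle_sub[of "Tk k x (usk k x)" "T 0 0 0 x (usk k x)"] by linarith
    also have "\<dots> \<le> (A + E) * (1 + rh k + sg k + de k)"
      using A(1) E0 par_pos[of k] by (simp add: algebra_simps)
    also have "\<dots> \<le> (A + E) * (K0 * pw t k)"
      using A(1) E0 sum_par by (intro mult_left_mono) auto
    finally show ?thesis by (simp add: C1_def mult.assoc)
  qed
  \<comment> \<open>Strong monotonicity is used at index k + 1; the factor 2 powr (- t) brings its
    modulus back to index k.\<close>
  define C2 where "C2 = K0 * E / (m0 * 2 powr (- t))"
  have C2: "norm (usk (Suc k) x - usk k x) \<le> C2 * pw (2 * t - 1) k" if x: "x \<in> X" for k x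
  proof -
    have "m0 * (2 powr (- t) * pw (- t) k) \<le> min (sg (Suc k)) (de (Suc k))"
      unfolding min_par using m0_pos t_bounds by (intro mult_left_mono pw_Suc_ge) auto
    then have "m0 * (2 powr (- t) * pw (- t) k) * norm (usk (Suc k) x - usk k x)
       \<le> min (sg (Suc k)) (de (Suc k)) * norm (usk (Suc k) x - usk k x)"
      by (rule mult_right_mono) simp
    also have "\<dots> \<le> norm (Tk (Suc k) x (usk k x) - Tk k x (usk k x))"
      unfolding usk_def Tk_def by (intro saddle_perturbation x par_pos)
    also have "\<dots> \<le> (K0 * pw (t - 1) k) * E"
      unfolding Tk_def using par_drift E[OF x, of k] K0_ge
      by (intro order_trans[OF saddle_op_param] mult_mono) auto
    finally have "norm (usk (Suc k) x - usk k x) \<le> (K0 * pw (t - 1) k) * E / (m0 * (2 powr (- t) * pw (- t) k))"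
      using m0_pos by (simp add: pos_le_divide_eq mult.commute)
    also have "\<dots> = C2 * (pw (t - 1) k * pw t k)"
      unfolding C2_def pw_minus by simp
    also have "pw (t - 1) k * pw t k = pw (2 * t - 1) k" by (simp add: pw_mult)
    finally show ?thesis .
  qed
  define C3 where "C3 = K0 * (2 * B + 2 * R\<^sup>2)"
  have C3: "phik (Suc k) x \<le> phik k x + C3 * pw (t - 1) k" if x: "x \<in> X" for k x
  proof -
    have "phik (Suc k) x \<le> phik k x + (\<bar>rh (Suc k) - rh k\<bar> + \<bar>sg (Suc k) - sg k\<bar> + \<bar>de (Suc k) - de k\<bar>) * (2 * B + 2 * R\<^sup>2)"
      unfolding phik_def using uR[OF x] B(2)[OF x]
      by (intro phi_drift x par_pos) (auto simp: usk_def)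
    also have "\<dots> \<le> phik k x + (K0 * pw (t - 1) k) * (2 * B + 2 * R\<^sup>2)"
      using B(1) par_drift by (intro add_left_mono mult_right_mono) auto
    finally show ?thesis by (simp add: C3_def mult_ac)
  qed
  define C4 where "C4 = 2 * L * K0 + 2 * L * K0 * (3 * L * K0 / m0)"
  define C5 where "C5 = 3 * L * K0"
  define C6 where "C6 = 2 * L * K0"
  define C7 where "C7 = 3 * L * K0 / m0"
  define C where "C = Max {1, R, C1, C2, C3, C4, C5, C6, C7}"
  have C: "1 \<le> C" "R \<le> C" "C1 \<le> C" "C2 \<le> C" "C3 \<le> C" "C5 \<le> C" "C6 \<le> C" "C7 \<le> C" "C4 \<le> C"
    unfolding C_def by (rule Max_ge; simp)+
  have up: "D * z \<le> C * z" if "D \<le> C" "0 \<le> z" for D z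
    using that by (rule mult_right_mono)
  show ?thesis
  proof (rule that[OF C(1)])
    fix k x assume x: "x \<in> X"
    show "norm (usk k x) \<le> C" "- C \<le> phik k x" using uR[OF x, of k] pR[OF x, of k] C by linarith+
    show "norm (Tk k x (usk k x)) \<le> C * pw t k" by (rule order_trans[OF C1[OF x] up[OF C(3)]]) simp
    show "norm (usk (Suc k) x - usk k x) \<le> C * pw (2 * t - 1) k" by (rule order_trans[OF C2[OF x] up[OF C(4)]]) simp
    show "phik (Suc k) x \<le> phik k x + C * pw (t - 1) k"
      by (rule order_trans[OF C3[OF x] add_left_mono[OF up[OF C(5)]]]) simp
  next
    fix k x x' and u v :: "'b \<times> 'b" assume xu: "x \<in> X" "x' \<in> X" "u \<in> Y \<times> Y" "v \<in> Y \<times> Y"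
    show "norm (Tk k x u - Tk k x' v) \<le> C * pw t k * (norm (x - x') + norm (u - v))"
      by (rule order_trans[OF Tk_lipschitz[OF xu, folded C5_def] mult_right_mono[OF up[OF C(6)]]]) auto
    show "norm (gk k x u - gk k x' v) \<le> C * pw t k * (norm (x - x') + norm (u - v))"
      by (rule order_trans[OF gk_lipschitz[OF xu, folded C6_def] mult_right_mono[OF up[OF C(7)]]]) auto
  next
    fix k x x' assume xu: "x \<in> X" "x' \<in> X"
    show "norm (usk k x - usk k x') \<le> C * pw (2 * t) k * norm (x - x')"
      by (rule order_trans[OF usk_lipschitz[OF xu, folded C7_def] mult_right_mono[OF up[OF C(8)]]]) auto
    show "\<bar>phik k x' - phik k x - (x' - x) \<bullet> gk k x (usk k x)\<bar> \<le> C * pw (3 * t) k * (norm (x' - x))\<^sup>2"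
      by (rule order_trans[OF phik_remainder[OF xu, folded C4_def] mult_right_mono[OF up[OF C(9)]]]) auto
  qed
qed

end

text \<open>Turns the constant obtained in \<open>uniform_bounds\<close> into a parameter, so that
  all later estimates share it.\<close>

locale bounded_path = bilevel_path X Y F f L \<sigma>0 \<delta>0 \<rho>0 t
  for X :: "'a::euclidean_space set" and Y :: "'b::euclidean_space set"
    and F f :: "'a \<Rightarrow> 'b \<Rightarrow> real" and L \<sigma>0 \<delta>0 \<rho>0 t :: real +
  fixes C :: real
  assumes C_ge: "1 \<le> C"
    and usk_bounded: "x \<in> X \<Longrightarrow> norm (usk k x) \<le> C"
    and phik_lower: "x \<in> X \<Longrightarrow> - C \<le> phik k x"
    and Tk_usk_le: "x \<in> X \<Longrightarrow> norm (Tk k x (usk k x)) \<le> C * pw t k"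
    and usk_drift: "x \<in> X \<Longrightarrow> norm (usk (Suc k) x - usk k x) \<le> C * pw (2 * t - 1) k"
    and phik_drift: "x \<in> X \<Longrightarrow> phik (Suc k) x \<le> phik k x + C * pw (t - 1) k"
    and Tk_lip: "x \<in> X \<Longrightarrow> x' \<in> X \<Longrightarrow> u \<in> Y \<times> Y \<Longrightarrow> v \<in> Y \<times> Y \<Longrightarrow>
      norm (Tk k x u - Tk k x' v) \<le> C * pw t k * (norm (x - x') + norm (u - v))"
    and gk_lip: "x \<in> X \<Longrightarrow> x' \<in> X \<Longrightarrow> u \<in> Y \<times> Y \<Longrightarrow> v \<in> Y \<times> Y \<Longrightarrow>
      norm (gk k x u - gk k x' v) \<le> C * pw t k * (norm (x - x') + norm (u - v))"
    and usk_lip: "x \<in> X \<Longrightarrow> x' \<in> X \<Longrightarrow> norm (usk k x - usk k x') \<le> C * pw (2 * t) k * norm (x - x')"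
    and phik_quad: "x \<in> X \<Longrightarrow> x' \<in> X \<Longrightarrow>
      \<bar>phik k x' - phik k x - (x' - x) \<bullet> gk k x (usk k x)\<bar> \<le> C * pw (3 * t) k * (norm (x' - x))\<^sup>2"

section \<open>Measurability and growth of the gradients\<close>

lemma smooth_on_continuous:
  assumes h: "smooth_on X Y L h" and L: "0 \<le> L"
  shows "continuous_on (X \<times> Y) (\<lambda>p. grad_x h (fst p) (snd p))"
    "continuous_on (X \<times> Y) (\<lambda>p. grad_y h (fst p) (snd p))"
proof -
  have le: "L * (norm (fst p - fst q) + norm (snd p - snd q)) \<le> 2 * L * norm (p - q)" for p q :: "'a \<times> 'b"
    using mult_left_mono[OF add_mono[OF norm_fst_bound[of "p - q"] norm_snd_bound[of "p - q"]] L] by simp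
  have "norm (grad_x h (fst p) (snd p) - grad_x h (fst q) (snd q)) \<le> 2 * L * norm (p - q) \<and>
      norm (grad_y h (fst p) (snd p) - grad_y h (fst q) (snd q)) \<le> 2 * L * norm (p - q)"
    if "p \<in> X \<times> Y" "q \<in> X \<times> Y" for p q
  proof -
    have "fst p \<in> X" "snd p \<in> Y" "fst q \<in> X" "snd q \<in> Y" using that by auto
    with h have "norm (grad_x h (fst p) (snd p) - grad_x h (fst q) (snd q)) \<le> L * (norm (fst p - fst q) + norm (snd p - snd q))"
      "norm (grad_y h (fst p) (snd p) - grad_y h (fst q) (snd q)) \<le> L * (norm (fst p - fst q) + norm (snd p - snd q))"
      unfolding smooth_on_def by blast+
    then show ?thesis using le[of p q] by linarith
  qed
  then have "(2 * L)-lipschitz_on (X \<times> Y) (\<lambda>p. grad_x h (fst p) (snd p))"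
    "(2 * L)-lipschitz_on (X \<times> Y) (\<lambda>p. grad_y h (fst p) (snd p))"
    using L by (intro lipschitz_onI; simp only: dist_norm; simp)+
  then show "continuous_on (X \<times> Y) (\<lambda>p. grad_x h (fst p) (snd p))"
    "continuous_on (X \<times> Y) (\<lambda>p. grad_y h (fst p) (snd p))"
    by (auto intro: lipschitz_on_continuous_on)
qed

text \<open>Y may be unbounded; linear growth carries square integrability from a random point to
  the gradients there.\<close>

lemma smooth_on_growth:
  assumes h: "smooth_on X Y L h" and L: "0 \<le> L" and X: "bounded X" "X \<noteq> {}" and Y: "Y \<noteq> {}"
  obtains B where "\<And>x y. x \<in> X \<Longrightarrow> y \<in> Y \<Longrightarrow> norm (grad_x h x y) \<le> B + L * norm y"
    "\<And>x y. x \<in> X \<Longrightarrow> y \<in> Y \<Longrightarrow> norm (grad_y h x y) \<le> B + L * norm y"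
proof -
  obtain x0 y0 where 0: "x0 \<in> X" "y0 \<in> Y" using X Y by auto
  obtain A where A: "\<And>x. x \<in> X \<Longrightarrow> norm x \<le> A" using X by (auto simp: bounded_iff)
  define B0 where "B0 = L * (A + norm x0 + norm y0)"
  have bd: "L * (norm (x - x0) + norm (y - y0)) \<le> B0 + L * norm y" if "x \<in> X" for x and y :: 'b
  proof -
    have "norm (x - x0) + norm (y - y0) \<le> (A + norm x0 + norm y0) + norm y"
      using A[OF that] norm_triangle_ineq4[of x x0] norm_triangle_ineq4[of y y0] by linarith
    from mult_left_mono[OF this L] show ?thesis by (simp add: B0_def distrib_left)
  qed
  show ?thesis
  proof (rule that[of "norm (grad_x h x0 y0) + norm (grad_y h x0 y0) + B0"])
    fix x y assume xy: "x \<in> X" "y \<in> Y"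
    have "norm (grad_x h x y - grad_x h x0 y0) \<le> L * (norm (x - x0) + norm (y - y0))"
      "norm (grad_y h x y - grad_y h x0 y0) \<le> L * (norm (x - x0) + norm (y - y0))"
      using h xy 0 by (auto simp: smooth_on_def)
    then show "norm (grad_x h x y) \<le> norm (grad_x h x0 y0) + norm (grad_y h x0 y0) + B0 + L * norm y"
      "norm (grad_y h x y) \<le> norm (grad_x h x0 y0) + norm (grad_y h x0 y0) + B0 + L * norm y"
      using bd[OF xy(1), of y] norm_triangle_sub[of "grad_x h x y" "grad_x h x0 y0"]
        norm_triangle_sub[of "grad_y h x y" "grad_y h x0 y0"]
        norm_ge_zero[of "grad_x h x0 y0"] norm_ge_zero[of "grad_y h x0 y0"] by linarith+
  qed
qed

text \<open>Sampled gradients are measurable on X x Y only, hence the restricted target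
  space.\<close>

lemma measurable_pair_restrict:
  fixes xx :: "'o \<Rightarrow> 'a::euclidean_space" and v :: "'o \<Rightarrow> 'b::euclidean_space"
  assumes "xx \<in> borel_measurable G" "v \<in> borel_measurable G"
    "\<And>\<omega>. \<omega> \<in> space G \<Longrightarrow> xx \<omega> \<in> X" "\<And>\<omega>. \<omega> \<in> space G \<Longrightarrow> v \<omega> \<in> Y"
  shows "(\<lambda>\<omega>. (xx \<omega>, v \<omega>)) \<in> measurable G (restrict_space borel (X \<times> Y))"
  using assms by (intro measurable_restrict_space2 borel_measurable_Pair) auto

lemma measurable_comp_continuous_on:
  fixes xx :: "'o \<Rightarrow> 'a::euclidean_space" and v :: "'o \<Rightarrow> 'b::euclidean_space"
    and h :: "'a \<Rightarrow> 'b \<Rightarrow> 'c::euclidean_space"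
  assumes "continuous_on (X \<times> Y) (\<lambda>p. h (fst p) (snd p))"
    "xx \<in> borel_measurable G" "v \<in> borel_measurable G"
    "\<And>\<omega>. \<omega> \<in> space G \<Longrightarrow> xx \<omega> \<in> X" "\<And>\<omega>. \<omega> \<in> space G \<Longrightarrow> v \<omega> \<in> Y"
  shows "(\<lambda>\<omega>. h (xx \<omega>) (v \<omega>)) \<in> borel_measurable G"
proof -
  have "(\<lambda>p. h (fst p) (snd p)) \<in> borel_measurable (restrict_space borel (X \<times> Y))"
    by (rule borel_measurable_continuous_on_restrict) fact
  from measurable_compose[OF measurable_pair_restrict[OF assms(2-5)] this]
  show ?thesis by simp
qed

section \<open>The stochastic iteration\<close>

locale sipba_run =
  bounded_path X Y "mean_fun D FS" "mean_fun D fS" L \<sigma>0 \<delta>0 \<rho>0 t C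
  for X :: "(real^'n) set" and Y :: "(real^'m) set" and D :: "'w measure"
    and FS fS :: "real^'n \<Rightarrow> real^'m \<Rightarrow> 'w \<Rightarrow> real" and L \<sigma>0 \<delta>0 \<rho>0 t C :: real +
  fixes M :: "'o measure" and \<xi>u \<xi>x :: "nat \<Rightarrow> 'o \<Rightarrow> 'w"
    and \<Delta> LF Lf \<alpha>0 \<beta>0 \<eta>0 s :: real and x0 :: "real^'n" and y0 z0 :: "real^'m"
    and x d :: "nat \<Rightarrow> 'o \<Rightarrow> real^'n" and y z :: "nat \<Rightarrow> 'o \<Rightarrow> real^'m"
  assumes prob_M: "prob_space M"
    and sample_funs: "sample_fun D X Y FS" "sample_fun D X Y fS"
    and samples: "samples M D \<xi>u \<xi>x"
    and oracles: "gradient_oracle M D \<xi>u \<xi>x X Y \<Delta> FS" "gradient_oracle M D \<xi>u \<xi>x X Y \<Delta> fS"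
    and mean_square: "mean_square_lipschitz D X Y LF FS" "mean_square_lipschitz D X Y Lf fS"
    and step_params: "0 < \<alpha>0" "0 < \<beta>0" "0 < \<eta>0" "\<eta>0 \<le> 1"
    and exps: "2 * t < s" "s < 1" "11 * t + s < 1"
    and start: "x0 \<in> X" "y0 \<in> Y" "z0 \<in> Y"
    and run: "sto_sipba M X Y
      (\<lambda>k w. psi (\<lambda>x y. FS x y w) (\<lambda>x y. fS x y w) (pow_seq \<rho>0 t k) (pow_seq \<sigma>0 (- t) k) (pow_seq \<delta>0 (- t) k))
      \<xi>u \<xi>x (pow_seq \<alpha>0 (- 9 * t - s)) (pow_seq \<beta>0 (- 4 * t - s)) (pow_seq \<eta>0 (- 5 * t - s)) x0 y0 z0 x y z d"
begin

definition al where "al = pow_seq \<alpha>0 (- 9 * t - s)"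
definition be where "be = pow_seq \<beta>0 (- 4 * t - s)"
definition et where "et = pow_seq \<eta>0 (- 5 * t - s)"

abbreviation Sx where "Sx h w \<equiv> grad_x (\<lambda>x y. h x y w)"
abbreviation Sy where "Sy h w \<equiv> grad_y (\<lambda>x y. h x y w)"

definition TS where "TS k w = saddle_op (Sy FS w) (Sy fS w) (rh k) (sg k) (de k)"
definition gS where "gS k w = upper_dir (Sx FS w) (Sx fS w) (rh k)"
definition u where "u k \<omega> = (y k \<omega>, z k \<omega>)"

abbreviation Fk where "Fk \<equiv> filt M D \<xi>u \<xi>x"
abbreviation Fh where "Fh \<equiv> filt_half M D \<xi>u \<xi>x"

sublocale M: prob_space M by (rule prob_M)

lemma closed_X: "closed X" using X by (simp add: compact_imp_closed)
lemma L_nonneg: "0 \<le> L" using L by simp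
lemma step_pos: "0 < al k" "0 < be k" "0 < et k"
  using step_params by (auto simp: al_def be_def et_def pow_seq_eq)

text \<open>Collects what is known of a single function, so that each estimate is proved once and
  used for both F and f.\<close>

definition oracle_fun :: "real \<Rightarrow> (real^'n \<Rightarrow> real^'m \<Rightarrow> 'w \<Rightarrow> real) \<Rightarrow> bool" where
  "oracle_fun Lh h \<longleftrightarrow> sample_fun D X Y h \<and> gradient_oracle M D \<xi>u \<xi>x X Y \<Delta> h \<and>
     mean_square_lipschitz D X Y Lh h \<and> smooth_on X Y L (mean_fun D h)"

lemma oracle_funs: "oracle_fun LF FS" "oracle_fun Lf fS"
  using sample_funs oracles mean_square F_smooth f_smooth by (auto simp: oracle_fun_def)

lemma \<xi>_measurable: "\<xi>u k \<in> measurable M D" "\<xi>x k \<in> measurable M D"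
  using samples by (auto simp: samples_def)

lemma \<xi>_space: "\<omega> \<in> space M \<Longrightarrow> \<xi>u k \<omega> \<in> space D" "\<omega> \<in> space M \<Longrightarrow> \<xi>x k \<omega> \<in> space D"
  using \<xi>_measurable by (auto intro: measurable_space)

lemma filt_subalgebra: "subalgebra M (Fk k)" "subalgebra M (Fh k)"
    "subalgebra (Fh k) (Fk k)" "subalgebra (Fk (Suc k)) (Fh k)"
  unfolding filt_def filt_half_def
  by (auto intro!: gen_alg_subalgebra gen_alg_subset \<xi>_measurable)

lemma filt_measurable: "\<xi>u k \<in> measurable (Fh k) D" "\<xi>x k \<in> measurable (Fk (Suc k)) D"
  unfolding filt_def filt_half_def
  by (auto intro!: gen_alg_measurable \<xi>_measurable)

lemma filt_space: "space (Fk k) = space M" "space (Fh k) = space M"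
  using filt_subalgebra by (auto simp: subalgebra_def)

lemma sample_deriv:
  assumes "oracle_fun Lh h" "p \<in> X" "q \<in> Y" "w \<in> space D"
  shows "((\<lambda>p. h p q w) has_derivative (\<lambda>v. v \<bullet> Sx h w p q)) (at p)"
    "((\<lambda>q. h p q w) has_derivative (\<lambda>v. v \<bullet> Sy h w p q)) (at q)"
  unfolding grad_x_def grad_y_def
  using assms by (auto intro!: grad_has_derivative simp: oracle_fun_def sample_fun_def)

lemma grad_psi_sample:
  assumes w: "w \<in> space D" and xyz: "p \<in> X" "q \<in> Y" "r \<in> Y"
  shows "grad (\<lambda>v. psi (\<lambda>x y. FS x y w) (\<lambda>x y. fS x y w) \<rho> \<sigma> \<delta> p v r) q
      = - fst (saddle_op (Sy FS w) (Sy fS w) \<rho> \<sigma> \<delta> p (q, r))"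
    "grad (\<lambda>v. psi (\<lambda>x y. FS x y w) (\<lambda>x y. fS x y w) \<rho> \<sigma> \<delta> p q v) r
      = snd (saddle_op (Sy FS w) (Sy fS w) \<rho> \<sigma> \<delta> p (q, r))"
    "grad (\<lambda>v. psi (\<lambda>x y. FS x y w) (\<lambda>x y. fS x y w) \<rho> \<sigma> \<delta> v q r) p
      = upper_dir (Sx FS w) (Sx fS w) \<rho> p (q, r)"
proof -
  note F = sample_deriv[OF oracle_funs(1) xyz(1) _ w] and f = sample_deriv[OF oracle_funs(2) xyz(1) _ w]
  have "grad (\<lambda>v. psi (\<lambda>x y. FS x y w) (\<lambda>x y. fS x y w) \<rho> \<sigma> \<delta> p v r) q
      = Sy FS w p q - \<rho> *\<^sub>R Sy fS w p q - \<sigma> *\<^sub>R r - \<delta> *\<^sub>R q"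
    by (intro grad_eqI psi_has_derivative_y F(2) f(2) xyz)
  then show "grad (\<lambda>v. psi (\<lambda>x y. FS x y w) (\<lambda>x y. fS x y w) \<rho> \<sigma> \<delta> p v r) q
      = - fst (saddle_op (Sy FS w) (Sy fS w) \<rho> \<sigma> \<delta> p (q, r))"
    by (simp add: saddle_op_def)
  have "grad (\<lambda>v. psi (\<lambda>x y. FS x y w) (\<lambda>x y. fS x y w) \<rho> \<sigma> \<delta> p q v) r
      = \<rho> *\<^sub>R Sy fS w p r + \<sigma> *\<^sub>R r - \<sigma> *\<^sub>R q"
    by (intro grad_eqI psi_has_derivative_z f(2) xyz)
  then show "grad (\<lambda>v. psi (\<lambda>x y. FS x y w) (\<lambda>x y. fS x y w) \<rho> \<sigma> \<delta> p q v) r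
      = snd (saddle_op (Sy FS w) (Sy fS w) \<rho> \<sigma> \<delta> p (q, r))"
    by (simp add: saddle_op_def)
  have "grad (\<lambda>v. psi (\<lambda>x y. FS x y w) (\<lambda>x y. fS x y w) \<rho> \<sigma> \<delta> v q r) p
      = Sx FS w p q - \<rho> *\<^sub>R (Sx fS w p q - Sx fS w p r)"
    by (intro grad_eqI psi_has_derivative_x F(1) f(1) xyz)
  then show "grad (\<lambda>v. psi (\<lambda>x y. FS x y w) (\<lambda>x y. fS x y w) \<rho> \<sigma> \<delta> v q r) p
      = upper_dir (Sx FS w) (Sx fS w) \<rho> p (q, r)"
    by (simp add: upper_dir_def)
qed

abbreviation psiS where
  "psiS k w \<equiv> psi (\<lambda>x y. FS x y w) (\<lambda>x y. fS x y w) (rh k) (sg k) (de k)"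

lemma run_raw:
  assumes "\<omega> \<in> space M"
  shows "x 0 \<omega> = x0" "y 0 \<omega> = y0" "z 0 \<omega> = z0"
    "y (Suc k) \<omega> = closest_point Y (y k \<omega> + be k *\<^sub>R grad (\<lambda>v. psiS k (\<xi>u k \<omega>) (x k \<omega>) v (z k \<omega>)) (y k \<omega>))"
    "z (Suc k) \<omega> = closest_point Y (z k \<omega> - be k *\<^sub>R grad (\<lambda>v. psiS k (\<xi>u k \<omega>) (x k \<omega>) (y k \<omega>) v) (z k \<omega>))"
    "d 0 \<omega> = grad (\<lambda>v. psiS 0 (\<xi>x 0 \<omega>) v (y 1 \<omega>) (z 1 \<omega>)) (x 0 \<omega>)"
    "d (Suc k) \<omega> = grad (\<lambda>v. psiS (Suc k) (\<xi>x (Suc k) \<omega>) v (y (Suc (Suc k)) \<omega>) (z (Suc (Suc k)) \<omega>)) (x (Suc k) \<omega>)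
      + (1 - et (Suc k)) *\<^sub>R (d k \<omega> - grad (\<lambda>v. psiS k (\<xi>x (Suc k) \<omega>) v (y (Suc k) \<omega>) (z (Suc k) \<omega>)) (x k \<omega>))"
    "x (Suc k) \<omega> = closest_point X (x k \<omega> - al k *\<^sub>R d k \<omega>)"
  using run assms unfolding sto_sipba_def al_def be_def et_def rh_def sg_def de_def by blast+

lemma iterates_in:
  assumes "\<omega> \<in> space M"
  shows "x k \<omega> \<in> X" "y k \<omega> \<in> Y" "z k \<omega> \<in> Y" "u k \<omega> \<in> Y \<times> Y"
proof -
  show xk: "x k \<omega> \<in> X" and yk: "y k \<omega> \<in> Y" and zk: "z k \<omega> \<in> Y" for k
    by (cases k; simp add: run_raw(1-5,8)[OF assms] start closest_point_in_set closed_X X Y)+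
  show "u k \<omega> \<in> Y \<times> Y" using yk zk by (simp add: u_def)
qed

lemma u_0: "\<omega> \<in> space M \<Longrightarrow> u 0 \<omega> = (y0, z0)"
  by (simp add: u_def run_raw)

text \<open>Projection onto Y x Y acts componentwise, so the updates of y and z are one projected
  step for the variational inequality, with a sampled operator.\<close>

lemma u_Suc:
  assumes "\<omega> \<in> space M"
  shows "u (Suc k) \<omega> = closest_point (Y \<times> Y) (u k \<omega> - be k *\<^sub>R TS k (\<xi>u k \<omega>) (x k \<omega>) (u k \<omega>))"
proof -
  let ?T = "TS k (\<xi>u k \<omega>) (x k \<omega>) (u k \<omega>)"
  have "y (Suc k) \<omega> = closest_point Y (y k \<omega> - be k *\<^sub>R fst ?T)"
    "z (Suc k) \<omega> = closest_point Y (z k \<omega> - be k *\<^sub>R snd ?T)"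
    using run_raw(4,5)[OF assms, of k]
    by (simp_all add: grad_psi_sample[OF \<xi>_space(1)[OF assms] iterates_in(1-3)[OF assms]] TS_def u_def)
  moreover have "u k \<omega> - be k *\<^sub>R ?T = (y k \<omega> - be k *\<^sub>R fst ?T, z k \<omega> - be k *\<^sub>R snd ?T)"
    by (simp add: u_def prod_eq_iff)
  ultimately show ?thesis
    using Y by (simp add: u_def closest_point_Times)
qed

lemma d_0:
  assumes "\<omega> \<in> space M"
  shows "d 0 \<omega> = gS 0 (\<xi>x 0 \<omega>) (x 0 \<omega>) (u (Suc 0) \<omega>)"
  using run_raw(6)[OF assms]
  by (simp add: grad_psi_sample[OF \<xi>_space(2)[OF assms] iterates_in(1-3)[OF assms]] gS_def u_def)

lemma d_Suc:
  assumes "\<omega> \<in> space M"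
  shows "d (Suc k) \<omega> = gS (Suc k) (\<xi>x (Suc k) \<omega>) (x (Suc k) \<omega>) (u (Suc (Suc k)) \<omega>)
    + (1 - et (Suc k)) *\<^sub>R (d k \<omega> - gS k (\<xi>x (Suc k) \<omega>) (x k \<omega>) (u (Suc k) \<omega>))"
  using run_raw(7)[OF assms, of k]
  by (simp add: grad_psi_sample[OF \<xi>_space(2)[OF assms] iterates_in(1-3)[OF assms]] gS_def u_def)

lemma x_Suc:
  assumes "\<omega> \<in> space M"
  shows "x (Suc k) \<omega> = closest_point X (x k \<omega> - al k *\<^sub>R d k \<omega>)"
  using run_raw(8)[OF assms] .

lemma sample_measurable:
  assumes h: "oracle_fun Lh h" and G: "\<And>\<omega>. \<omega> \<in> space G \<Longrightarrow> xx \<omega> \<in> X" "\<And>\<omega>. \<omega> \<in> space G \<Longrightarrow> v \<omega> \<in> Y"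
    and m: "xx \<in> borel_measurable G" "v \<in> borel_measurable G" "\<xi> \<in> measurable G D"
  shows "(\<lambda>\<omega>. Sx h (\<xi> \<omega>) (xx \<omega>) (v \<omega>)) \<in> borel_measurable G"
    "(\<lambda>\<omega>. Sy h (\<xi> \<omega>) (xx \<omega>) (v \<omega>)) \<in> borel_measurable G"
proof -
  have p: "(\<lambda>\<omega>. ((xx \<omega>, v \<omega>), \<xi> \<omega>)) \<in> measurable G (restrict_space borel (X \<times> Y) \<Otimes>\<^sub>M D)"
    using measurable_pair_restrict[OF m(1,2) G] m(3) by (rule measurable_Pair)
  have "(\<lambda>((x, y), w). Sx h w x y) \<in> borel_measurable (restrict_space borel (X \<times> Y) \<Otimes>\<^sub>M D)"
    "(\<lambda>((x, y), w). Sy h w x y) \<in> borel_measurable (restrict_space borel (X \<times> Y) \<Otimes>\<^sub>M D)"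
    using h by (auto simp: oracle_fun_def sample_fun_def)
  from this[THEN measurable_compose[OF p]]
  show "(\<lambda>\<omega>. Sx h (\<xi> \<omega>) (xx \<omega>) (v \<omega>)) \<in> borel_measurable G"
    "(\<lambda>\<omega>. Sy h (\<xi> \<omega>) (xx \<omega>) (v \<omega>)) \<in> borel_measurable G"
    by simp_all
qed

lemma mean_grad_sq_int:
  assumes h: "oracle_fun Lh h" and G: "subalgebra M G"
    and xv: "\<And>\<omega>. \<omega> \<in> space M \<Longrightarrow> xx \<omega> \<in> X" "\<And>\<omega>. \<omega> \<in> space M \<Longrightarrow> v \<omega> \<in> Y"
    and m: "xx \<in> borel_measurable G" "v \<in> borel_measurable G" "sq_int M v"
  shows "(\<lambda>\<omega>. grad_x (mean_fun D h) (xx \<omega>) (v \<omega>)) \<in> borel_measurable G"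
    "(\<lambda>\<omega>. grad_y (mean_fun D h) (xx \<omega>) (v \<omega>)) \<in> borel_measurable G"
    "sq_int M (\<lambda>\<omega>. grad_x (mean_fun D h) (xx \<omega>) (v \<omega>))"
    "sq_int M (\<lambda>\<omega>. grad_y (mean_fun D h) (xx \<omega>) (v \<omega>))"
proof -
  have sp: "space G = space M" using G by (simp add: subalgebra_def)
  have sm: "smooth_on X Y L (mean_fun D h)" using h by (simp add: oracle_fun_def)
  show meas: "(\<lambda>\<omega>. grad_x (mean_fun D h) (xx \<omega>) (v \<omega>)) \<in> borel_measurable G"
    "(\<lambda>\<omega>. grad_y (mean_fun D h) (xx \<omega>) (v \<omega>)) \<in> borel_measurable G"
    by (rule measurable_comp_continuous_on[OF smooth_on_continuous(1)[OF sm L_nonneg] m(1,2)];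
        simp add: xv sp)
       (rule measurable_comp_continuous_on[OF smooth_on_continuous(2)[OF sm L_nonneg] m(1,2)];
        simp add: xv sp)
  obtain B where B: "\<And>p q. p \<in> X \<Longrightarrow> q \<in> Y \<Longrightarrow> norm (grad_x (mean_fun D h) p q) \<le> B + L * norm q"
    "\<And>p q. p \<in> X \<Longrightarrow> q \<in> Y \<Longrightarrow> norm (grad_y (mean_fun D h) p q) \<le> B + L * norm q"
    using smooth_on_growth[OF sm L_nonneg compact_imp_bounded[OF X(2)] X(1) Y(1)] by blast
  show "sq_int M (\<lambda>\<omega>. grad_x (mean_fun D h) (xx \<omega>) (v \<omega>))"
    "sq_int M (\<lambda>\<omega>. grad_y (mean_fun D h) (xx \<omega>) (v \<omega>))"
    by (rule sq_int_mono[OF M.finite_measure_axioms measurable_from_subalg[OF G meas(1)] m(3) B(1)[OF xv]];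
        simp)
       (rule sq_int_mono[OF M.finite_measure_axioms measurable_from_subalg[OF G meas(2)] m(3) B(2)[OF xv]];
        simp)
qed

lemma x_sq_int:
  assumes "subalgebra M G" "xx \<in> borel_measurable G" "\<And>\<omega>. \<omega> \<in> space M \<Longrightarrow> xx \<omega> \<in> X"
  shows "sq_int M xx"
proof -
  obtain A where A: "\<And>p. p \<in> X \<Longrightarrow> norm p \<le> A"
    using compact_imp_bounded[OF X(2)] by (auto simp: bounded_iff)
  show ?thesis
    by (rule sq_int_bounded[OF M.finite_measure_axioms measurable_from_subalg[OF assms(1,2)] A[OF assms(3)]])
qed

lemma noise_y:
  assumes h: "oracle_fun Lh h"
    and xv: "\<And>\<omega>. \<omega> \<in> space M \<Longrightarrow> xx \<omega> \<in> X" "\<And>\<omega>. \<omega> \<in> space M \<Longrightarrow> v \<omega> \<in> Y"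
    and m: "xx \<in> borel_measurable (Fk k)" "v \<in> borel_measurable (Fk k)" "sq_int M v"
  shows "noise M (Fk k) (\<Delta>\<^sup>2) (\<lambda>\<omega>. Sy h (\<xi>u k \<omega>) (xx \<omega>) (v \<omega>) - grad_y (mean_fun D h) (xx \<omega>) (v \<omega>))"
proof (rule unbiased_oracle_noise[where gS = "\<lambda>p q w. Sy h w p q" and g = "grad_y (mean_fun D h)"
      and x = xx and v = v and \<xi> = "\<xi>u k", OF prob_M filt_subalgebra(1)])
  show "unbiased_oracle M (Fk k) (\<xi>u k) X Y \<Delta> (\<lambda>x y w. Sy h w x y) (grad_y (mean_fun D h))"
    using h by (simp add: oracle_fun_def gradient_oracle_def)
  show "(\<lambda>\<omega>. Sy h (\<xi>u k \<omega>) (xx \<omega>) (v \<omega>)) \<in> borel_measurable M"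
    by (rule sample_measurable(2)[OF h xv m(1,2)[THEN measurable_from_subalg[OF filt_subalgebra(1)]] \<xi>_measurable(1)])
qed (use xv m mean_grad_sq_int[OF h filt_subalgebra(1) xv m]
    x_sq_int[OF filt_subalgebra(1) m(1) xv(1)] in \<open>simp_all (no_asm_simp)\<close>)

lemma noise_x:
  assumes h: "oracle_fun Lh h"
    and xv: "\<And>\<omega>. \<omega> \<in> space M \<Longrightarrow> xx \<omega> \<in> X" "\<And>\<omega>. \<omega> \<in> space M \<Longrightarrow> v \<omega> \<in> Y"
    and m: "xx \<in> borel_measurable (Fh k)" "v \<in> borel_measurable (Fh k)" "sq_int M v"
  shows "noise M (Fh k) (\<Delta>\<^sup>2) (\<lambda>\<omega>. Sx h (\<xi>x k \<omega>) (xx \<omega>) (v \<omega>) - grad_x (mean_fun D h) (xx \<omega>) (v \<omega>))"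
proof (rule unbiased_oracle_noise[where gS = "\<lambda>p q w. Sx h w p q" and g = "grad_x (mean_fun D h)"
      and x = xx and v = v and \<xi> = "\<xi>x k", OF prob_M filt_subalgebra(2)])
  show "unbiased_oracle M (Fh k) (\<xi>x k) X Y \<Delta> (\<lambda>x y w. Sx h w x y) (grad_x (mean_fun D h))"
    using h by (simp add: oracle_fun_def gradient_oracle_def)
  show "(\<lambda>\<omega>. Sx h (\<xi>x k \<omega>) (xx \<omega>) (v \<omega>)) \<in> borel_measurable M"
    by (rule sample_measurable(1)[OF h xv m(1,2)[THEN measurable_from_subalg[OF filt_subalgebra(2)]] \<xi>_measurable(2)])
qed (use xv m mean_grad_sq_int[OF h filt_subalgebra(2) xv m]
    x_sq_int[OF filt_subalgebra(2) m(1) xv(1)] in \<open>simp_all (no_asm_simp)\<close>)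

text \<open>In units of \<Delta>^2 the noise variance is bounded by 2 + 3 \<rho>^2 for the saddle
  operator and by 2 + 8 \<rho>^2 for the upper direction; 10 (1 + \<rho>^2) covers both, and 1 +
  \<rho> is of order k^t.\<close>

definition VC where "VC = 10 * K0\<^sup>2 * \<Delta>\<^sup>2"

lemma VC_nonneg: "0 \<le> VC" by (simp add: VC_def)

lemma rh_sq: "10 * \<Delta>\<^sup>2 + 10 * ((rh k)\<^sup>2 * \<Delta>\<^sup>2) \<le> VC * pw (2 * t) k'" if "k \<le> k'" 
proof -
  have "1 + (rh k)\<^sup>2 \<le> (1 + rh k)\<^sup>2" using par_pos[of k] by (simp add: power2_sum)
  also have "\<dots> \<le> (K0 * pw t k)\<^sup>2" using one_rh par_pos[of k] by (intro power_mono) auto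
  also have "\<dots> = K0\<^sup>2 * pw (2 * t) k" by (simp add: power_mult_distrib power2_eq_square pw_mult)
  also have "\<dots> \<le> K0\<^sup>2 * pw (2 * t) k'"
    unfolding pw_def using t_bounds that by (intro mult_left_mono powr_mono2) auto
  finally have "(1 + (rh k)\<^sup>2) * \<Delta>\<^sup>2 \<le> (K0\<^sup>2 * pw (2 * t) k') * \<Delta>\<^sup>2" by (intro mult_right_mono) auto
  then show ?thesis by (simp add: VC_def algebra_simps)
qed

lemma noise_T:
  assumes xv: "\<And>\<omega>. \<omega> \<in> space M \<Longrightarrow> xx \<omega> \<in> X" "\<And>\<omega>. \<omega> \<in> space M \<Longrightarrow> v \<omega> \<in> Y \<times> Y"
    and m: "xx \<in> borel_measurable (Fk k)" "v \<in> borel_measurable (Fk k)" "sq_int M v"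
  shows "noise M (Fk k) (VC * pw (2 * t) k) (\<lambda>\<omega>. TS k (\<xi>u k \<omega>) (xx \<omega>) (v \<omega>) - Tk k (xx \<omega>) (v \<omega>))"
proof -
  let ?N = "\<lambda>h v \<omega>. Sy h (\<xi>u k \<omega>) (xx \<omega>) (v \<omega>) - grad_y (mean_fun D h) (xx \<omega>) (v \<omega>)"
  have Y': "fst (v \<omega>) \<in> Y" "snd (v \<omega>) \<in> Y" if "\<omega> \<in> space M" for \<omega>
    using xv(2)[OF that] by (auto simp: mem_Times_iff)
  note m1 = measurable_fst_snd[OF m(2)] and sq = sq_int_fst[OF m(3)] sq_int_snd[OF m(3)]
  have "noise M (Fk k) ((2 * ((rh k)\<^sup>2 * \<Delta>\<^sup>2) + 2 * \<Delta>\<^sup>2) + (rh k)\<^sup>2 * \<Delta>\<^sup>2)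
    (\<lambda>\<omega>. (rh k *\<^sub>R ?N fS (\<lambda>\<omega>. fst (v \<omega>)) \<omega> - ?N FS (\<lambda>\<omega>. fst (v \<omega>)) \<omega>, rh k *\<^sub>R ?N fS (\<lambda>\<omega>. snd (v \<omega>)) \<omega>))"
    by (intro noise_Pair noise_diff noise_scaleR noise_y[OF oracle_funs(1)] noise_y[OF oracle_funs(2)] xv(1) Y' m(1) m1 sq)
  moreover have "(2 * ((rh k)\<^sup>2 * \<Delta>\<^sup>2) + 2 * \<Delta>\<^sup>2) + (rh k)\<^sup>2 * \<Delta>\<^sup>2 \<le> VC * pw (2 * t) k"
    using rh_sq[of k k] mult_nonneg_nonneg[OF zero_le_power2[of "rh k"] zero_le_power2[of \<Delta>]]
      zero_le_power2[of \<Delta>] by linarith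
  moreover have "(\<lambda>\<omega>. TS k (\<xi>u k \<omega>) (xx \<omega>) (v \<omega>) - Tk k (xx \<omega>) (v \<omega>))
    = (\<lambda>\<omega>. (rh k *\<^sub>R ?N fS (\<lambda>\<omega>. fst (v \<omega>)) \<omega> - ?N FS (\<lambda>\<omega>. fst (v \<omega>)) \<omega>, rh k *\<^sub>R ?N fS (\<lambda>\<omega>. snd (v \<omega>)) \<omega>))"
    by (simp add: TS_def Tk_def saddle_op_def fun_eq_iff algebra_simps)
  ultimately show ?thesis by (simp only: noise_mono)
qed

text \<open>Two indices, because the momentum step evaluates the previous objective, with parameters
  of index k, at the current sample k'.\<close>

lemma noise_g:
  assumes xv: "\<And>\<omega>. \<omega> \<in> space M \<Longrightarrow> xx \<omega> \<in> X" "\<And>\<omega>. \<omega> \<in> space M \<Longrightarrow> v \<omega> \<in> Y \<times> Y"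
    and m: "xx \<in> borel_measurable (Fh k')" "v \<in> borel_measurable (Fh k')" "sq_int M v"
    and k: "k \<le> k'"
  shows "noise M (Fh k') (VC * pw (2 * t) k') (\<lambda>\<omega>. gS k (\<xi>x k' \<omega>) (xx \<omega>) (v \<omega>) - gk k (xx \<omega>) (v \<omega>))"
proof -
  let ?N = "\<lambda>h v \<omega>. Sx h (\<xi>x k' \<omega>) (xx \<omega>) (v \<omega>) - grad_x (mean_fun D h) (xx \<omega>) (v \<omega>)"
  have Y': "fst (v \<omega>) \<in> Y" "snd (v \<omega>) \<in> Y" if "\<omega> \<in> space M" for \<omega>
    using xv(2)[OF that] by (auto simp: mem_Times_iff)
  note m1 = measurable_fst_snd[OF m(2)] and sq = sq_int_fst[OF m(3)] sq_int_snd[OF m(3)]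
  have "noise M (Fh k') (2 * \<Delta>\<^sup>2 + 2 * ((rh k)\<^sup>2 * (2 * \<Delta>\<^sup>2 + 2 * \<Delta>\<^sup>2)))
    (\<lambda>\<omega>. ?N FS (\<lambda>\<omega>. fst (v \<omega>)) \<omega> - rh k *\<^sub>R (?N fS (\<lambda>\<omega>. fst (v \<omega>)) \<omega> - ?N fS (\<lambda>\<omega>. snd (v \<omega>)) \<omega>))"
    by (intro noise_Pair noise_diff noise_scaleR noise_x[OF oracle_funs(1)] noise_x[OF oracle_funs(2)] xv(1) Y' m(1) m1 sq)
  moreover have "2 * ((rh k)\<^sup>2 * (2 * \<Delta>\<^sup>2 + 2 * \<Delta>\<^sup>2)) = 8 * ((rh k)\<^sup>2 * \<Delta>\<^sup>2)" by simp
  then have "2 * \<Delta>\<^sup>2 + 2 * ((rh k)\<^sup>2 * (2 * \<Delta>\<^sup>2 + 2 * \<Delta>\<^sup>2)) \<le> VC * pw (2 * t) k'"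
    using rh_sq[OF k] mult_nonneg_nonneg[OF zero_le_power2[of "rh k"] zero_le_power2[of \<Delta>]]
      zero_le_power2[of \<Delta>] by linarith
  moreover have "(\<lambda>\<omega>. gS k (\<xi>x k' \<omega>) (xx \<omega>) (v \<omega>) - gk k (xx \<omega>) (v \<omega>))
    = (\<lambda>\<omega>. ?N FS (\<lambda>\<omega>. fst (v \<omega>)) \<omega> - rh k *\<^sub>R (?N fS (\<lambda>\<omega>. fst (v \<omega>)) \<omega> - ?N fS (\<lambda>\<omega>. snd (v \<omega>)) \<omega>))"
    by (simp add: gS_def gk_def upper_dir_def fun_eq_iff algebra_simps)
  ultimately show ?thesis by (simp only: noise_mono)
qed

lemma mean_op_sq_int:
  assumes G: "subalgebra M G"
    and xv: "\<And>\<omega>. \<omega> \<in> space M \<Longrightarrow> xx \<omega> \<in> X" "\<And>\<omega>. \<omega> \<in> space M \<Longrightarrow> v \<omega> \<in> Y \<times> Y"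
    and m: "xx \<in> borel_measurable G" "v \<in> borel_measurable G" "sq_int M v"
  shows "(\<lambda>\<omega>. Tk k (xx \<omega>) (v \<omega>)) \<in> borel_measurable G" "sq_int M (\<lambda>\<omega>. Tk k (xx \<omega>) (v \<omega>))"
    "(\<lambda>\<omega>. gk k (xx \<omega>) (v \<omega>)) \<in> borel_measurable G" "sq_int M (\<lambda>\<omega>. gk k (xx \<omega>) (v \<omega>))"
proof -
  have Y': "fst (v \<omega>) \<in> Y" "snd (v \<omega>) \<in> Y" if "\<omega> \<in> space M" for \<omega>
    using xv(2)[OF that] by (auto simp: mem_Times_iff)
  note m1 = measurable_fst_snd[OF m(2)] and sq = sq_int_fst[OF m(3)] sq_int_snd[OF m(3)]
  note F = mean_grad_sq_int[OF oracle_funs(1) G xv(1) _ m(1)]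
    and f = mean_grad_sq_int[OF oracle_funs(2) G xv(1) _ m(1)]
  show "(\<lambda>\<omega>. Tk k (xx \<omega>) (v \<omega>)) \<in> borel_measurable G"
    unfolding Tk_def saddle_op_def diff_conv_add_uminus
    by (intro borel_measurable_Pair borel_measurable_add borel_measurable_uminus
        borel_measurable_scaleR borel_measurable_const F(2) f(2) m1 Y' sq)
  show "sq_int M (\<lambda>\<omega>. Tk k (xx \<omega>) (v \<omega>))"
  proof -
    have "Tk k (xx \<omega>) (v \<omega>) = ((rh k *\<^sub>R grad_y (mean_fun D fS) (xx \<omega>) (fst (v \<omega>)) - grad_y (mean_fun D FS) (xx \<omega>) (fst (v \<omega>))) +
        (sg k *\<^sub>R snd (v \<omega>) + de k *\<^sub>R fst (v \<omega>)),
        (rh k *\<^sub>R grad_y (mean_fun D fS) (xx \<omega>) (snd (v \<omega>)) + sg k *\<^sub>R snd (v \<omega>)) - sg k *\<^sub>R fst (v \<omega>))" for \<omega>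
      by (simp add: Tk_def saddle_op_def)
    then show ?thesis
      by (simp only:) (intro sq_int_Pair sq_int_add sq_int_diff sq_int_scaleR F(4) f(4) m1 Y' sq)
  qed
  show "(\<lambda>\<omega>. gk k (xx \<omega>) (v \<omega>)) \<in> borel_measurable G"
    unfolding gk_def upper_dir_def
    by (intro borel_measurable_diff borel_measurable_scaleR borel_measurable_const F(1) f(1) m1 Y' sq)
  show "sq_int M (\<lambda>\<omega>. gk k (xx \<omega>) (v \<omega>))"
    unfolding gk_def upper_dir_def
    by (intro sq_int_diff sq_int_scaleR F(3) f(3) m1 Y' sq)
qed

lemma sample_op_measurable:
  assumes G: "space G = space M" and xv: "\<And>\<omega>. \<omega> \<in> space M \<Longrightarrow> xx \<omega> \<in> X" "\<And>\<omega>. \<omega> \<in> space M \<Longrightarrow> v \<omega> \<in> Y \<times> Y"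
    and m: "xx \<in> borel_measurable G" "v \<in> borel_measurable G" "\<xi> \<in> measurable G D"
  shows "(\<lambda>\<omega>. TS k (\<xi> \<omega>) (xx \<omega>) (v \<omega>)) \<in> borel_measurable G"
    "(\<lambda>\<omega>. gS k (\<xi> \<omega>) (xx \<omega>) (v \<omega>)) \<in> borel_measurable G"
proof -
  have Y': "fst (v \<omega>) \<in> Y" "snd (v \<omega>) \<in> Y" "xx \<omega> \<in> X" if "\<omega> \<in> space G" for \<omega>
    using that xv[of \<omega>] by (auto simp: mem_Times_iff G)
  note m1 = measurable_fst_snd[OF m(2)]
  note F = sample_measurable[OF oracle_funs(1) Y'(3) _ m(1) _ m(3)]
    and f = sample_measurable[OF oracle_funs(2) Y'(3) _ m(1) _ m(3)]
  show "(\<lambda>\<omega>. TS k (\<xi> \<omega>) (xx \<omega>) (v \<omega>)) \<in> borel_measurable G"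
    unfolding TS_def saddle_op_def diff_conv_add_uminus
    by (intro borel_measurable_Pair borel_measurable_add borel_measurable_uminus
        borel_measurable_scaleR borel_measurable_const F(2) f(2) m1 Y')
  show "(\<lambda>\<omega>. gS k (\<xi> \<omega>) (xx \<omega>) (v \<omega>)) \<in> borel_measurable G"
    unfolding gS_def upper_dir_def
    by (intro borel_measurable_diff borel_measurable_scaleR borel_measurable_const F(1) f(1) m1 Y')
qed

section \<open>Adaptedness and square integrability of the iterates\<close>

text \<open>The oracle hypotheses speak only of square integrable points measurable in the past, so
  both properties have to be carried along the iteration.\<close>

definition adapted where
  "adapted k \<longleftrightarrow> x k \<in> borel_measurable (Fk k) \<and> u k \<in> borel_measurable (Fk k) \<and> sq_int M (u k)"

lemma adapted_u_Suc:
  assumes "adapted k"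
  shows "u (Suc k) \<in> borel_measurable (Fh k)" "sq_int M (u (Suc k))"
    "sq_int M (\<lambda>\<omega>. TS k (\<xi>u k \<omega>) (x k \<omega>) (u k \<omega>))"
proof -
  have m: "x k \<in> borel_measurable (Fk k)" "u k \<in> borel_measurable (Fk k)" "sq_int M (u k)"
    using assms by (auto simp: adapted_def)
  note mh = m(1,2)[THEN measurable_from_subalg[OF filt_subalgebra(3)]]
  have T: "(\<lambda>\<omega>. TS k (\<xi>u k \<omega>) (x k \<omega>) (u k \<omega>)) \<in> borel_measurable (Fh k)"
    by (intro sample_op_measurable filt_space iterates_in mh filt_measurable)
  have "(\<lambda>\<omega>. closest_point (Y \<times> Y) (u k \<omega> - be k *\<^sub>R TS k (\<xi>u k \<omega>) (x k \<omega>) (u k \<omega>))) \<in> borel_measurable (Fh k)"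
    using mh(2) T by (intro measurable_compose[OF _ borel_measurable_continuous_onI[OF continuous_on_closest_point[OF YY]]]) auto
  then show um: "u (Suc k) \<in> borel_measurable (Fh k)"
    by (rule measurable_cong[THEN iffD1, rotated]) (simp add: u_Suc filt_space)
  have "sq_int M (\<lambda>\<omega>. Tk k (x k \<omega>) (u k \<omega>))"
    by (rule mean_op_sq_int[OF filt_subalgebra(1) iterates_in(1) iterates_in(4) m])
  moreover have "noise M (Fk k) (VC * pw (2 * t) k) (\<lambda>\<omega>. TS k (\<xi>u k \<omega>) (x k \<omega>) (u k \<omega>) - Tk k (x k \<omega>) (u k \<omega>))"
    by (rule noise_T[OF iterates_in(1) iterates_in(4) m])
  ultimately show sT: "sq_int M (\<lambda>\<omega>. TS k (\<xi>u k \<omega>) (x k \<omega>) (u k \<omega>))"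
    using sq_int_add by (fastforce simp: noise_def)
  show "sq_int M (u (Suc k))"
  proof (rule sq_int_mono[OF M.finite_measure_axioms])
    show "u (Suc k) \<in> borel_measurable M" using um by (rule measurable_from_subalg[OF filt_subalgebra(2)])
    show "sq_int M (\<lambda>\<omega>. u k \<omega> - be k *\<^sub>R TS k (\<xi>u k \<omega>) (x k \<omega>) (u k \<omega>))"
      by (intro sq_int_diff sq_int_scaleR m sT)
    fix \<omega> assume \<omega>: "\<omega> \<in> space M"
    \<comment> \<open>Nonexpansiveness of the projection, with the projection of 0 as reference
      point.\<close>
    show "norm (u (Suc k) \<omega>) \<le> norm (closest_point (Y \<times> Y) 0)
        + 1 * norm (u k \<omega> - be k *\<^sub>R TS k (\<xi>u k \<omega>) (x k \<omega>) (u k \<omega>))"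
      using closest_point_nonexpansive[OF YY, of "u k \<omega> - be k *\<^sub>R TS k (\<xi>u k \<omega>) (x k \<omega>) (u k \<omega>)" 0]
        norm_triangle_sub[of "u (Suc k) \<omega>" "closest_point (Y \<times> Y) 0"]
      by (simp add: u_Suc[OF \<omega>])
  qed
qed

lemma gS_sq_int:
  assumes "xx \<in> borel_measurable (Fh k')" "v \<in> borel_measurable (Fh k')" "sq_int M v" "k \<le> k'"
    and xv: "\<And>\<omega>. \<omega> \<in> space M \<Longrightarrow> xx \<omega> \<in> X" "\<And>\<omega>. \<omega> \<in> space M \<Longrightarrow> v \<omega> \<in> Y \<times> Y"
  shows "(\<lambda>\<omega>. gS k (\<xi>x k' \<omega>) (xx \<omega>) (v \<omega>)) \<in> borel_measurable (Fk (Suc k'))"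
    "sq_int M (\<lambda>\<omega>. gS k (\<xi>x k' \<omega>) (xx \<omega>) (v \<omega>))"
proof -
  show "(\<lambda>\<omega>. gS k (\<xi>x k' \<omega>) (xx \<omega>) (v \<omega>)) \<in> borel_measurable (Fk (Suc k'))"
    by (intro sample_op_measurable filt_space xv assms(1,2)[THEN measurable_from_subalg[OF filt_subalgebra(4)]] filt_measurable)
  have "sq_int M (\<lambda>\<omega>. gk k (xx \<omega>) (v \<omega>))"
    by (rule mean_op_sq_int[OF filt_subalgebra(2) xv assms(1-3)])
  moreover have "noise M (Fh k') (VC * pw (2 * t) k') (\<lambda>\<omega>. gS k (\<xi>x k' \<omega>) (xx \<omega>) (v \<omega>) - gk k (xx \<omega>) (v \<omega>))"
    by (rule noise_g[OF xv assms(1-4)])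
  ultimately show "sq_int M (\<lambda>\<omega>. gS k (\<xi>x k' \<omega>) (xx \<omega>) (v \<omega>))"
    using sq_int_add by (fastforce simp: noise_def)
qed

text \<open>The direction is part of the induction because x (Suc k) is built from d k, which uses
  the sample that \<open>Fk (Suc k)\<close> adds to \<open>Fh k\<close>.\<close>

lemma adapted_all: "adapted k \<and> d k \<in> borel_measurable (Fk (Suc k)) \<and> sq_int M (d k)"
proof (induction k)
  case 0
  have "x 0 \<in> borel_measurable (Fk 0)" "u 0 \<in> borel_measurable (Fk 0)" 
    by (auto intro: measurable_cong[THEN iffD2, OF _ measurable_const] simp: run_raw u_0 filt_space)
  moreover from this(2) have "sq_int M (u 0)"
    by (intro sq_int_bounded[where B = "norm (y0, z0)"] M.finite_measure_axioms
        measurable_from_subalg[OF filt_subalgebra(1)]) (auto simp: u_0)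
  ultimately have a: "adapted 0" by (simp add: adapted_def)
  then have x0: "x 0 \<in> borel_measurable (Fh 0)"
    by (auto simp: adapted_def intro: measurable_from_subalg[OF filt_subalgebra(3)])
  note g = gS_sq_int[OF x0 adapted_u_Suc(1,2)[OF a] order_refl iterates_in(1) iterates_in(4)]
  have d0m: "d 0 \<in> borel_measurable (Fk (Suc 0))"
    by (rule measurable_cong[THEN iffD1, OF _ g(1)]) (simp_all add: d_0 filt_space)
  have "sq_int M (d 0)"
  proof (rule sq_int_mono[OF M.finite_measure_axioms measurable_from_subalg[OF filt_subalgebra(1) d0m] g(2)])
    show "norm (d 0 \<omega>) \<le> 0 + 1 * norm (gS 0 (\<xi>x 0 \<omega>) (x 0 \<omega>) (u (Suc 0) \<omega>))" if "\<omega> \<in> space M" for \<omega>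
      by (simp only: d_0[OF that] mult_1 add_0_left order_refl)
  qed
  with a d0m show ?case by blast
next
  case (Suc k)
  then have a: "adapted k" and dm: "d k \<in> borel_measurable (Fk (Suc k))" and ds: "sq_int M (d k)" by auto
  then have xk: "x k \<in> borel_measurable (Fk (Suc k))"
    by (auto simp: adapted_def intro: measurable_from_subalg[OF filt_subalgebra(3), THEN measurable_from_subalg[OF filt_subalgebra(4)]])
  have "(\<lambda>\<omega>. closest_point X (x k \<omega> - al k *\<^sub>R d k \<omega>)) \<in> borel_measurable (Fk (Suc k))"
    using xk dm by (intro measurable_compose[OF _ borel_measurable_continuous_onI[OF continuous_on_closest_point[OF X(3) closed_X X(1)]]]) auto
  then have "x (Suc k) \<in> borel_measurable (Fk (Suc k))"
    by (rule measurable_cong[THEN iffD1, rotated]) (simp add: x_Suc filt_space)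
  then have a': "adapted (Suc k)"
    using adapted_u_Suc[OF a] by (auto simp: adapted_def intro: measurable_from_subalg[OF filt_subalgebra(4)])
  then have m': "x (Suc k) \<in> borel_measurable (Fh (Suc k))" "u (Suc k) \<in> borel_measurable (Fh (Suc k))"
     "x k \<in> borel_measurable (Fh (Suc k))"
    using xk by (auto simp: adapted_def intro: measurable_from_subalg[OF filt_subalgebra(3)])
  note g1 = gS_sq_int[OF m'(1) adapted_u_Suc(1,2)[OF a'] order_refl iterates_in(1) iterates_in(4)]
    and g0 = gS_sq_int[OF m'(3,2) adapted_u_Suc(2)[OF a] le_SucI[OF order_refl] iterates_in(1) iterates_in(4)]
  have dm': "d k \<in> borel_measurable (Fk (Suc (Suc k)))"
    by (rule measurable_from_subalg[OF filt_subalgebra(4) measurable_from_subalg[OF filt_subalgebra(3) dm]])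
  let ?d = "\<lambda>\<omega>. gS (Suc k) (\<xi>x (Suc k) \<omega>) (x (Suc k) \<omega>) (u (Suc (Suc k)) \<omega>)
    + (1 - et (Suc k)) *\<^sub>R (d k \<omega> - gS k (\<xi>x (Suc k) \<omega>) (x k \<omega>) (u (Suc k) \<omega>))"
  have "?d \<in> borel_measurable (Fk (Suc (Suc k)))"
    by (intro borel_measurable_add borel_measurable_diff borel_measurable_scaleR borel_measurable_const g1(1) g0(1) dm')
  then have dm2: "d (Suc k) \<in> borel_measurable (Fk (Suc (Suc k)))"
    by (rule measurable_cong[THEN iffD1, rotated]) (simp add: d_Suc filt_space)
  have sd: "sq_int M ?d"
    by (intro sq_int_add sq_int_diff sq_int_scaleR g1(2) g0(2) ds)
  have "sq_int M (d (Suc k))"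
  proof (rule sq_int_mono[OF M.finite_measure_axioms measurable_from_subalg[OF filt_subalgebra(1) dm2] sd])
    show "norm (d (Suc k) \<omega>) \<le> 0 + 1 * norm (?d \<omega>)" if "\<omega> \<in> space M" for \<omega>
      by (simp only: d_Suc[OF that] mult_1 add_0_left order_refl)
  qed
  with a' dm2 show ?case by blast
qed

lemma run_measurable:
  "x k \<in> borel_measurable (Fk k)" "u k \<in> borel_measurable (Fk k)" "u (Suc k) \<in> borel_measurable (Fh k)"
  "d k \<in> borel_measurable (Fk (Suc k))"
  and run_sq_int: "sq_int M (u k)" "sq_int M (d k)" "sq_int M (\<lambda>\<omega>. TS k (\<xi>u k \<omega>) (x k \<omega>) (u k \<omega>))"
proof -
  have a: "adapted k" using adapted_all by blast
  then show "x k \<in> borel_measurable (Fk k)" "u k \<in> borel_measurable (Fk k)" "sq_int M (u k)"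
    unfolding adapted_def by blast+
  show "u (Suc k) \<in> borel_measurable (Fh k)" "sq_int M (\<lambda>\<omega>. TS k (\<xi>u k \<omega>) (x k \<omega>) (u k \<omega>))"
    by (rule adapted_u_Suc[OF a])+
  show "d k \<in> borel_measurable (Fk (Suc k))" "sq_int M (d k)"
    using adapted_all by blast+
qed

end

section \<open>Young's inequality and one inexact projected step\<close>

text \<open>Expand |\<theta> a - b|^2 / \<theta> \<ge> 0.\<close>

lemma norm_add_sq_Young:
  fixes a b :: "'a::real_inner"
  assumes \<theta>: "0 < \<theta>"
  shows "(norm (a + b))\<^sup>2 \<le> (1 + \<theta>) * (norm a)\<^sup>2 + (1 + 1 / \<theta>) * (norm b)\<^sup>2"
proof -
  have "0 \<le> (norm (\<theta> *\<^sub>R a - b))\<^sup>2 / \<theta>" using \<theta> by simp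
  also have "(norm (\<theta> *\<^sub>R a - b))\<^sup>2 = \<theta> * (\<theta> * (norm a)\<^sup>2) - \<theta> * (2 * (a \<bullet> b)) + (norm b)\<^sup>2"
    unfolding power2_norm_eq_inner by (simp add: algebra_simps inner_commute)
  also have "\<dots> / \<theta> = \<theta> * (norm a)\<^sup>2 - 2 * (a \<bullet> b) + 1 / \<theta> * (norm b)\<^sup>2"
    using \<theta> by (simp add: field_simps)
  finally have "2 * (a \<bullet> b) \<le> \<theta> * (norm a)\<^sup>2 + 1 / \<theta> * (norm b)\<^sup>2" by simp
  moreover have "(norm (a + b))\<^sup>2 = (norm a)\<^sup>2 + 2 * (a \<bullet> b) + (norm b)\<^sup>2"
    unfolding power2_norm_eq_inner by (simp add: algebra_simps inner_commute)
  ultimately show ?thesis unfolding distrib_right mult_1 by linarith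
qed

text \<open>The projection inequality yields a decrease n^2 / a. One quarter is lost to the
  curvature K and one to the error of d. Of the remaining half, one quarter is kept and the other
  pays for the projected gradient mapping, whose norm exceeds n / a by at most e.\<close>

lemma inexact_projected_descent:
  fixes S :: "'a::euclidean_space set"
  assumes S: "convex S" "closed S" "p \<in> S" and a: "0 < a" and K: "4 * (a * K) \<le> 1"
    and p': "p' = closest_point S (p - a *\<^sub>R d)"
    and model: "\<phi>' \<le> \<phi> + (p' - p) \<bullet> g + K * (norm (p' - p))\<^sup>2"
  shows "\<phi>' + 1 / (4 * a) * (norm (p' - p))\<^sup>2
      + a / 8 * (norm ((1 / a) *\<^sub>R (p - closest_point S (p - a *\<^sub>R g))))\<^sup>2
    \<le> \<phi> + 5 / 4 * a * (norm (d - g))\<^sup>2"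
proof -
  define n where "n = norm (p' - p)"
  define e where "e = norm (d - g)"
  define G where "G = (1 / a) *\<^sub>R (p - closest_point S (p - a *\<^sub>R g))"
  have n0: "0 \<le> n" "0 \<le> e" by (auto simp: n_def e_def)
  have "((p - a *\<^sub>R d) - p') \<bullet> (p - p') \<le> 0"
    unfolding p' using S by (intro closest_point_dot)
  then have "n\<^sup>2 \<le> a * (d \<bullet> (p - p'))"
    unfolding n_def power2_norm_eq_inner by (simp add: algebra_simps inner_commute)
  then have d: "d \<bullet> (p' - p) \<le> - (n\<^sup>2 / a)"
    using a by (simp add: field_simps inner_diff_right)
  have "(p' - p) \<bullet> (g - d) \<le> n * e"
    unfolding n_def e_def using norm_cauchy_schwarz[of "p' - p" "g - d"] by (simp add: norm_minus_commute)
  moreover have "n * e \<le> n\<^sup>2 / (4 * a) + a * e\<^sup>2"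
  proof -
    have "0 \<le> (n - 2 * a * e)\<^sup>2 / (4 * a)" using a by simp
    also have "\<dots> = n\<^sup>2 / (4 * a) + a * e\<^sup>2 - n * e"
      using a by (simp add: power2_diff field_simps power2_eq_square)
    finally show ?thesis by simp
  qed
  moreover have "(p' - p) \<bullet> g = d \<bullet> (p' - p) + (p' - p) \<bullet> (g - d)"
    by (simp add: inner_diff_right inner_commute)
  moreover have "K * n\<^sup>2 \<le> n\<^sup>2 / (4 * a)"
  proof -
    have "K \<le> 1 / (4 * a)" using K a by (simp add: field_simps)
    from mult_right_mono[OF this, of "n\<^sup>2"] show ?thesis by simp
  qed
  ultimately have 1: "\<phi>' \<le> \<phi> - n\<^sup>2 / a + n\<^sup>2 / (4 * a) + a * e\<^sup>2 + n\<^sup>2 / (4 * a)"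
    using model d unfolding n_def[symmetric] by linarith
  have "norm (a *\<^sub>R G) \<le> n + a * e"
  proof -
    have "a *\<^sub>R G = (p - p') + (p' - closest_point S (p - a *\<^sub>R g))" using a by (simp add: G_def)
    moreover have "norm (p' - closest_point S (p - a *\<^sub>R g)) \<le> norm ((p - a *\<^sub>R d) - (p - a *\<^sub>R g))"
      unfolding p' using S by (intro closest_point_nonexpansive) auto
    moreover have "norm ((p - a *\<^sub>R d) - (p - a *\<^sub>R g)) = a * e"
      using a norm_scaleR[of a "g - d"] by (simp add: e_def norm_minus_commute scaleR_right_diff_distrib)
    ultimately show ?thesis
      using norm_triangle_ineq[of "p - p'" "p' - closest_point S (p - a *\<^sub>R g)"]
      by (simp add: n_def norm_minus_commute)
  qed
  then have "(norm (a *\<^sub>R G))\<^sup>2 \<le> (n + a * e)\<^sup>2" by (rule power_mono) simp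
  also have "\<dots> \<le> 2 * n\<^sup>2 + 2 * (a * e)\<^sup>2"
    using sum_squares_bound[of n "a * e"] by (simp add: power2_sum)
  finally have "a * (a * (norm G)\<^sup>2) \<le> a * (2 * (n\<^sup>2 / a) + 2 * a * e\<^sup>2)"
    using a by (simp add: power_mult_distrib power2_eq_square algebra_simps)
  then have 2: "a * (norm G)\<^sup>2 \<le> 2 * (n\<^sup>2 / a) + 2 * a * e\<^sup>2" using a by simp
  have "n\<^sup>2 / (4 * a) = (n\<^sup>2 / a) / 4" by simp
  with 1 2 have "\<phi>' + n\<^sup>2 / (4 * a) + a * (norm G)\<^sup>2 / 8 \<le> \<phi> + 5 / 4 * (a * e\<^sup>2)"
    by linarith
  then show ?thesis by (simp add: n_def e_def G_def mult.assoc)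
qed

context sipba_run
begin

text \<open>
  \<open>r\<close> and \<open>w\<close> are the distances to the current saddle point before and after the inner step, \<open>st\<close> and
  \<open>du\<close> the increments of \<open>x\<close> and \<open>u\<close>, \<open>er\<close> the error of the search direction, and \<open>pg\<close> the projected
  gradient mapping.
\<close>

definition r where "r k \<omega> = u k \<omega> - usk k (x k \<omega>)"
definition w where "w k \<omega> = u (Suc k) \<omega> - usk k (x k \<omega>)"
definition st where "st k \<omega> = x (Suc k) \<omega> - x k \<omega>"
definition du where "du k \<omega> = u (Suc k) \<omega> - u k \<omega>"
definition er where "er k \<omega> = d k \<omega> - gk k (x k \<omega>) (u (Suc k) \<omega>)"
definition pg where "pg k \<omega> = proj_grad_map X (al k) (phik k) (x k \<omega>)"

definition msq :: "('o \<Rightarrow> 'z::euclidean_space) \<Rightarrow> real" where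
  "msq v = (\<integral>\<omega>. (norm (v \<omega>))\<^sup>2 \<partial>M)"

lemma msq_nonneg [simp]: "0 \<le> msq v" by (simp add: msq_def)

lemma usk_continuous: "continuous_on X (usk k)"
proof (rule lipschitz_on_continuous_on[of "C * pw (2 * t) k"], rule lipschitz_onI)
  show "0 \<le> C * pw (2 * t) k" using C_ge by simp
  show "dist (usk k p) (usk k q) \<le> C * pw (2 * t) k * dist p q" if "p \<in> X" "q \<in> X" for p q
    unfolding dist_norm using that by (rule usk_lip)
qed

lemma measurable_comp_X:
  fixes h :: "real^'n \<Rightarrow> 'z::euclidean_space"
  assumes "continuous_on X h" "x k \<in> borel_measurable G" "space G = space M"
  shows "(\<lambda>\<omega>. h (x k \<omega>)) \<in> borel_measurable G"
proof -
  have "x k \<in> measurable G (restrict_space borel X)"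
    by (rule measurable_restrict_space2) (use assms(2,3) in \<open>simp_all add: Pi_iff iterates_in(1)\<close>)
  from measurable_compose[OF this borel_measurable_continuous_on_restrict[OF assms(1)]]
  show ?thesis .
qed

lemma usk_x: "(\<lambda>\<omega>. usk k (x k \<omega>)) \<in> borel_measurable (Fk k)" "sq_int M (\<lambda>\<omega>. usk k (x k \<omega>))"
proof -
  show m: "(\<lambda>\<omega>. usk k (x k \<omega>)) \<in> borel_measurable (Fk k)"
    by (rule measurable_comp_X[OF usk_continuous run_measurable(1) filt_space(1)])
  show "sq_int M (\<lambda>\<omega>. usk k (x k \<omega>))"
    by (rule sq_int_bounded[OF M.finite_measure_axioms measurable_from_subalg[OF filt_subalgebra(1) m]
          usk_bounded[OF iterates_in(1)]])
qed

lemma x_sq: "sq_int M (x k)"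
  by (rule x_sq_int[OF filt_subalgebra(1) run_measurable(1) iterates_in(1)])

lemma run_measurable_half: "x k \<in> borel_measurable (Fh k)" "u k \<in> borel_measurable (Fh k)"
    "x k \<in> borel_measurable (Fh (Suc k))" "d k \<in> borel_measurable (Fh (Suc k))"
proof -
  show "x k \<in> borel_measurable (Fh k)" "u k \<in> borel_measurable (Fh k)"
    by (rule measurable_from_subalg[OF filt_subalgebra(3)], rule run_measurable)+
  then have "x k \<in> borel_measurable (Fk (Suc k))"
    by (rule_tac measurable_from_subalg[OF filt_subalgebra(4)])
  then show "x k \<in> borel_measurable (Fh (Suc k))"
    by (rule measurable_from_subalg[OF filt_subalgebra(3)])
  show "d k \<in> borel_measurable (Fh (Suc k))"
    by (rule measurable_from_subalg[OF filt_subalgebra(3) run_measurable(4)])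
qed

lemma gk_x_sq: "sq_int M (\<lambda>\<omega>. gk k (x k \<omega>) (u (Suc k) \<omega>))"
    "(\<lambda>\<omega>. gk k (x k \<omega>) (u (Suc k) \<omega>)) \<in> borel_measurable (Fh k)"
  by (rule mean_op_sq_int(3,4)[OF filt_subalgebra(2) iterates_in(1) iterates_in(4)
        run_measurable_half(1) run_measurable(3) run_sq_int(1)]; assumption)+

lemma sq_ints: "sq_int M (r k)" "sq_int M (w k)" "sq_int M (st k)" "sq_int M (du k)" "sq_int M (er k)"
  unfolding r_def[abs_def] w_def[abs_def] st_def[abs_def] du_def[abs_def] er_def[abs_def]
  by (intro sq_int_diff run_sq_int usk_x x_sq gk_x_sq)+

lemma msq_mono:
  assumes "sq_int M v" "integrable M g" "\<And>\<omega>. \<omega> \<in> space M \<Longrightarrow> (norm (v \<omega>))\<^sup>2 \<le> g \<omega>"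
  shows "msq v \<le> (\<integral>\<omega>. g \<omega> \<partial>M)"
  unfolding msq_def using assms by (intro integral_mono) (auto simp: sq_int_def)

subsection \<open>Tracking of the saddle point\<close>

text \<open>The saddle point is a fixed point of the mean step, so w is a difference of two
  projections. Before projection this difference is a contracted vector measurable in
  \<open>Fk k\<close> plus noise, and orthogonality removes the cross term.\<close>

lemma inner_step:
  assumes small: "be k * (C * pw t k)\<^sup>2 \<le> m0 * pw (- t) k"
  shows "msq (w k) \<le> (1 - be k * (m0 * pw (- t) k)) * msq (r k) + (be k)\<^sup>2 * (VC * pw (2 * t) k)"
proof -
  define q where "q \<omega> = (u k \<omega> - be k *\<^sub>R Tk k (x k \<omega>) (u k \<omega>))
    - (usk k (x k \<omega>) - be k *\<^sub>R Tk k (x k \<omega>) (usk k (x k \<omega>)))" for \<omega>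
  define N where "N \<omega> = TS k (\<xi>u k \<omega>) (x k \<omega>) (u k \<omega>) - Tk k (x k \<omega>) (u k \<omega>)" for \<omega>
  have us_in: "usk k (x k \<omega>) \<in> Y \<times> Y" if "\<omega> \<in> space M" for \<omega>
    using usk_in[OF iterates_in(1)[OF that]] .
  note Tu = mean_op_sq_int(1,2)[OF filt_subalgebra(1) iterates_in(1) iterates_in(4) run_measurable(1,2) run_sq_int(1)]
    and Ts = mean_op_sq_int(1,2)[OF filt_subalgebra(1) iterates_in(1) us_in run_measurable(1) usk_x]
  have qm: "q \<in> borel_measurable (Fk k)"
    unfolding q_def[abs_def]
    by (intro borel_measurable_diff borel_measurable_scaleR borel_measurable_const run_measurable Tu Ts usk_x; assumption)
  have qs: "sq_int M q"
    unfolding q_def[abs_def] by (intro sq_int_diff sq_int_scaleR run_sq_int Tu Ts usk_x; assumption)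
  have N: "noise M (Fk k) (VC * pw (2 * t) k) N"
    unfolding N_def[abs_def] by (rule noise_T[OF iterates_in(1) iterates_in(4) run_measurable(1,2) run_sq_int(1)])
  note bN = noise_scaleR[OF N, of "- be k"]
  have "(norm (w k \<omega>))\<^sup>2 \<le> (norm (q \<omega> + (- be k) *\<^sub>R N \<omega>))\<^sup>2" if \<omega>: "\<omega> \<in> space M" for \<omega>
  proof (rule power_mono)
    have eq: "w k \<omega> = closest_point (Y \<times> Y) (u k \<omega> - be k *\<^sub>R TS k (\<xi>u k \<omega>) (x k \<omega>) (u k \<omega>))
      - closest_point (Y \<times> Y) (usk k (x k \<omega>) - be k *\<^sub>R Tk k (x k \<omega>) (usk k (x k \<omega>)))"
      by (simp add: w_def u_Suc[OF \<omega>] usk_step[OF iterates_in(1)[OF \<omega>] step_pos(2)])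
    have eq': "(u k \<omega> - be k *\<^sub>R TS k (\<xi>u k \<omega>) (x k \<omega>) (u k \<omega>))
      - (usk k (x k \<omega>) - be k *\<^sub>R Tk k (x k \<omega>) (usk k (x k \<omega>))) = q \<omega> + (- be k) *\<^sub>R N \<omega>"
      by (simp add: q_def N_def algebra_simps)
    show "norm (w k \<omega>) \<le> norm (q \<omega> + (- be k) *\<^sub>R N \<omega>)"
      unfolding eq eq'[symmetric] by (rule closest_point_nonexpansive[OF YY])
  qed simp
  moreover have "sq_int M (\<lambda>\<omega>. q \<omega> + (- be k) *\<^sub>R N \<omega>)"
    using qs bN by (intro sq_int_add) (auto simp: noise_def)
  ultimately have "msq (w k) \<le> (\<integral>\<omega>. (norm (q \<omega> + (- be k) *\<^sub>R N \<omega>))\<^sup>2 \<partial>M)"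
    by (intro msq_mono sq_ints) (auto simp: sq_int_def)
  also have "\<dots> = msq q + (\<integral>\<omega>. (norm ((- be k) *\<^sub>R N \<omega>))\<^sup>2 \<partial>M)"
    unfolding msq_def by (rule noise_orthogonal[OF bN qm qs])
  also have "(\<integral>\<omega>. (norm ((- be k) *\<^sub>R N \<omega>))\<^sup>2 \<partial>M) \<le> (be k)\<^sup>2 * (VC * pw (2 * t) k)"
    using bN by (simp add: noise_def)
  also have "msq q \<le> (\<integral>\<omega>. (1 - be k * (m0 * pw (- t) k)) * (norm (r k \<omega>))\<^sup>2 \<partial>M)"
  proof (rule msq_mono[OF qs])
    show "integrable M (\<lambda>\<omega>. (1 - be k * (m0 * pw (- t) k)) * (norm (r k \<omega>))\<^sup>2)"
      using sq_ints(1) by (simp add: sq_int_def)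
    fix \<omega> assume \<omega>: "\<omega> \<in> space M"
    note xX = iterates_in(1)[OF \<omega>, of k] and uY = iterates_in(4)[OF \<omega>, of k]
    show "(norm (q \<omega>))\<^sup>2 \<le> (1 - be k * (m0 * pw (- t) k)) * (norm (r k \<omega>))\<^sup>2"
      unfolding q_def r_def
    proof (rule gradient_step_contraction[where L = "C * pw t k"])
      show "m0 * pw (- t) k * (norm (u k \<omega> - usk k (x k \<omega>)))\<^sup>2
        \<le> (Tk k (x k \<omega>) (u k \<omega>) - Tk k (x k \<omega>) (usk k (x k \<omega>))) \<bullet> (u k \<omega> - usk k (x k \<omega>))"
        by (rule Tk_strongly_monotone[OF xX uY us_in[OF \<omega>]])
      show "norm (Tk k (x k \<omega>) (u k \<omega>) - Tk k (x k \<omega>) (usk k (x k \<omega>))) \<le> C * pw t k * norm (u k \<omega> - usk k (x k \<omega>))"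
        using Tk_lip[OF xX xX uY us_in[OF \<omega>], of k] by simp
    qed (use small step_pos(2)[of k] in auto)
  qed
  also have "\<dots> = (1 - be k * (m0 * pw (- t) k)) * msq (r k)" by (simp add: msq_def)
  finally show ?thesis by simp
qed

text \<open>The saddle point moves with x, by k^(2t) |st|, and with the parameters, by k^(2t-1).
  \<theta> stays free so that it can be matched to the contraction later.\<close>

lemma drift_step:
  assumes \<theta>: "0 < \<theta>"
  shows "msq (r (Suc k)) \<le> (1 + \<theta>) * msq (w k)
    + (1 + 1 / \<theta>) * (2 * C\<^sup>2 * (pw (4 * t) k * msq (st k) + pw (4 * t - 2) k))"
proof -
  let ?g = "\<lambda>\<omega>. (1 + \<theta>) * (norm (w k \<omega>))\<^sup>2
    + (1 + 1 / \<theta>) * (2 * C\<^sup>2 * (pw (4 * t) k * (norm (st k \<omega>))\<^sup>2 + pw (4 * t - 2) k))"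
  have "msq (r (Suc k)) \<le> (\<integral>\<omega>. ?g \<omega> \<partial>M)"
  proof (rule msq_mono[OF sq_ints(1)])
    show "integrable M ?g" using sq_ints(2,3)[of k] by (auto simp: sq_int_def)
    fix \<omega> assume \<omega>: "\<omega> \<in> space M"
    define v where "v = usk k (x k \<omega>) - usk (Suc k) (x (Suc k) \<omega>)"
    have "norm v \<le> norm (usk k (x k \<omega>) - usk k (x (Suc k) \<omega>)) + norm (usk k (x (Suc k) \<omega>) - usk (Suc k) (x (Suc k) \<omega>))"
      unfolding v_def using norm_triangle_ineq[of "usk k (x k \<omega>) - usk k (x (Suc k) \<omega>)" "usk k (x (Suc k) \<omega>) - usk (Suc k) (x (Suc k) \<omega>)"] by simp
    also have "\<dots> \<le> C * pw (2 * t) k * norm (st k \<omega>) + C * pw (2 * t - 1) k"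
      using usk_lip[OF iterates_in(1)[OF \<omega>, of k] iterates_in(1)[OF \<omega>, of "Suc k"], of k]
        usk_drift[OF iterates_in(1)[OF \<omega>, of "Suc k"], of k]
      by (simp add: st_def norm_minus_commute)
    finally have "(norm v)\<^sup>2 \<le> (C * pw (2 * t) k * norm (st k \<omega>) + C * pw (2 * t - 1) k)\<^sup>2"
      by (rule power_mono) simp
    also have "\<dots> \<le> 2 * (C * pw (2 * t) k * norm (st k \<omega>))\<^sup>2 + 2 * (C * pw (2 * t - 1) k)\<^sup>2"
      using sum_squares_bound[of "C * pw (2 * t) k * norm (st k \<omega>)" "C * pw (2 * t - 1) k"] by (simp add: power2_sum)
    also have "\<dots> = 2 * C\<^sup>2 * ((pw (2 * t) k * pw (2 * t) k) * (norm (st k \<omega>))\<^sup>2 + pw (2 * t - 1) k * pw (2 * t - 1) k)"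
      by (simp add: power2_eq_square algebra_simps)
    also have "\<dots> = 2 * C\<^sup>2 * (pw (4 * t) k * (norm (st k \<omega>))\<^sup>2 + pw (4 * t - 2) k)"
      by (simp add: pw_mult)
    finally have v: "(norm v)\<^sup>2 \<le> 2 * C\<^sup>2 * (pw (4 * t) k * (norm (st k \<omega>))\<^sup>2 + pw (4 * t - 2) k)" .
    have "r (Suc k) \<omega> = w k \<omega> + v" by (simp add: r_def w_def v_def)
    then have "(norm (r (Suc k) \<omega>))\<^sup>2 \<le> (1 + \<theta>) * (norm (w k \<omega>))\<^sup>2 + (1 + 1 / \<theta>) * (norm v)\<^sup>2"
      using norm_add_sq_Young[OF \<theta>] by simp
    also have "\<dots> \<le> ?g \<omega>" using v \<theta> by (intro add_left_mono mult_left_mono) auto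
    finally show "(norm (r (Suc k) \<omega>))\<^sup>2 \<le> ?g \<omega>" .
  qed
  also have "\<dots> = (1 + \<theta>) * msq (w k) + (1 + 1 / \<theta>) * (2 * C\<^sup>2 * (pw (4 * t) k * msq (st k) + pw (4 * t - 2) k))"
    using sq_ints(2,3)[of k] by (simp add: sq_int_def msq_def M.prob_space)
  finally show ?thesis .
qed

text \<open>The step size times the squared Lipschitz constant has exponent -2t - s, strictly below
  the exponent -t of the modulus.\<close>

lemma be_small: "\<forall>\<^sub>F k in sequentially. be k * (C * pw t k)\<^sup>2 \<le> m0 * pw (- t) k"
proof -
  have "\<forall>\<^sub>F k in sequentially. (\<beta>0 * C\<^sup>2) * pw (- 2 * t - s) k \<le> m0 * pw (- t) k"
    using exps t_bounds m0_pos by (intro pw_eventually_le) auto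
  then show ?thesis
  proof eventually_elim
    case (elim k)
    have "be k * (C * pw t k)\<^sup>2 = (\<beta>0 * C\<^sup>2) * (pw (- 4 * t - s) k * (pw t k * pw t k))"
      by (simp add: be_def pow_seq_eq power2_eq_square)
    also have "pw (- 4 * t - s) k * (pw t k * pw t k) = pw (- 2 * t - s) k"
      unfolding pw_mult by (rule arg_cong[where f = "\<lambda>e. pw e k"]) simp
    finally show ?case using elim by simp
  qed
qed

lemma be_mu: "be k * (m0 * pw (- t) k) = \<beta>0 * m0 * pw (- 5 * t - s) k"
proof -
  have "be k * (m0 * pw (- t) k) = \<beta>0 * m0 * (pw (- 4 * t - s) k * pw (- t) k)"
    by (simp add: be_def pow_seq_eq)
  also have "pw (- 4 * t - s) k * pw (- t) k = pw (- 5 * t - s) k"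
    unfolding pw_mult by (rule arg_cong[where f = "\<lambda>e. pw e k"]) simp
  finally show ?thesis .
qed

lemma be_sq: "(be k)\<^sup>2 * pw (2 * t) k = \<beta>0\<^sup>2 * pw (- 6 * t - 2 * s) k"
proof -
  have "(be k)\<^sup>2 * pw (2 * t) k = \<beta>0\<^sup>2 * (pw (- 4 * t - s) k * pw (- 4 * t - s) k * pw (2 * t) k)"
    by (simp add: be_def pow_seq_eq power2_eq_square)
  also have "pw (- 4 * t - s) k * pw (- 4 * t - s) k * pw (2 * t) k = pw (- 6 * t - 2 * s) k"
    unfolding pw_mult by (rule arg_cong[where f = "\<lambda>e. pw e k"]) simp
  finally show ?thesis .
qed

lemma inner_step_rate: "\<forall>\<^sub>F k in sequentially.
    msq (w k) \<le> (1 - \<beta>0 * m0 * pw (- 5 * t - s) k) * msq (r k) + \<beta>0\<^sup>2 * VC * pw (- 6 * t - 2 * s) k"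
  using be_small
proof eventually_elim
  case (elim k)
  have "(be k)\<^sup>2 * (VC * pw (2 * t) k) = VC * ((be k)\<^sup>2 * pw (2 * t) k)" by simp
  also have "\<dots> = \<beta>0\<^sup>2 * VC * pw (- 6 * t - 2 * s) k" unfolding be_sq by (simp add: mult_ac)
  finally have eq: "(be k)\<^sup>2 * (VC * pw (2 * t) k) = \<beta>0\<^sup>2 * VC * pw (- 6 * t - 2 * s) k" .
  show ?case using inner_step[OF elim] by (simp only: be_mu eq)
qed

text \<open>Half of the contraction h is spent on the drift. The price 3 / h, of order k^(5t+s),
  turns k^(4t) |st|^2 into k^(9t+s) |st|^2, the order of 1 / \<alpha>_k.\<close>

lemma tracking_recursion: "\<exists>c>0. \<exists>K\<ge>0. \<forall>\<^sub>F k in sequentially.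
    msq (r (Suc k)) \<le> (1 - c * pw (- 5 * t - s) k) * msq (r k)
      + K * (pw (- 6 * t - 2 * s) k + pw (9 * t + s) k * msq (st k) + pw (9 * t + s - 2) k)"
proof -
  define b where "b = \<beta>0 * m0"
  have b: "0 < b" using step_params m0_pos by (simp add: b_def)
  define K where "K = max (2 * \<beta>0\<^sup>2 * VC) (6 * C\<^sup>2 / b)"
  have K: "2 * \<beta>0\<^sup>2 * VC \<le> K" "6 * C\<^sup>2 / b \<le> K" "0 \<le> K"
    using b by (auto simp: K_def le_max_iff_disj)
  have "\<forall>\<^sub>F k in sequentially. b * pw (- 5 * t - s) k \<le> 1 * pw 0 k"
    using exps t_bounds by (intro pw_eventually_le) auto
  with inner_step_rate have "\<forall>\<^sub>F k in sequentially. msq (r (Suc k)) \<le> (1 - b / 2 * pw (- 5 * t - s) k) * msq (r k)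
      + K * (pw (- 6 * t - 2 * s) k + pw (9 * t + s) k * msq (st k) + pw (9 * t + s - 2) k)"
  proof eventually_elim
    case (elim k)
    define h where "h = b * pw (- 5 * t - s) k"
    have h: "0 < h" "h \<le> 1" using b elim by (auto simp: h_def)
    define D where "D = 2 * C\<^sup>2 * (pw (4 * t) k * msq (st k) + pw (4 * t - 2) k)"
    have D: "0 \<le> D" by (simp add: D_def)
    have W: "msq (w k) \<le> (1 - h) * msq (r k) + \<beta>0\<^sup>2 * VC * pw (- 6 * t - 2 * s) k"
      using elim by (simp add: h_def b_def)
    \<comment> \<open>\<theta> = h / 2, for which (1 + h / 2) (1 - h) \<le> 1 - h / 2, and h \<le> 1
      gives 1 + 2 / h \<le> 3 / h.\<close>
    have "msq (r (Suc k)) \<le> (1 + h / 2) * msq (w k) + (1 + 1 / (h / 2)) * D"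
      unfolding D_def using h by (intro drift_step) simp
    also have "\<dots> \<le> (1 + h / 2) * ((1 - h) * msq (r k) + \<beta>0\<^sup>2 * VC * pw (- 6 * t - 2 * s) k) + 3 / h * D"
    proof (intro add_mono mult_left_mono[OF W] mult_right_mono)
      show "1 + 1 / (h / 2) \<le> 3 / h" using h by (simp add: field_simps)
    qed (use h D in auto)
    also have "\<dots> = ((1 + h / 2) * (1 - h)) * msq (r k) + (1 + h / 2) * (\<beta>0\<^sup>2 * VC * pw (- 6 * t - 2 * s) k) + 3 / h * D"
      by (simp add: distrib_left mult.assoc)
    also have "\<dots> \<le> (1 - h / 2) * msq (r k) + 2 * (\<beta>0\<^sup>2 * VC * pw (- 6 * t - 2 * s) k) + 3 / h * D"
    proof (intro add_mono mult_right_mono order_refl)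
      show "(1 + h / 2) * (1 - h) \<le> 1 - h / 2" using h by (simp add: algebra_simps)
    qed (use h VC_nonneg D in auto)
    also have "3 / h * D = 6 * C\<^sup>2 / b * (pw (9 * t + s) k * msq (st k) + pw (9 * t + s - 2) k)"
    proof -
      have "pw (- 5 * t - s) k = 1 / pw (5 * t + s) k"
        using pw_minus[of "5 * t + s" k] by simp
      then have "3 / h = 3 / b * pw (5 * t + s) k" by (simp add: h_def)
      then have "3 / h * D = 6 * C\<^sup>2 / b * ((pw (5 * t + s) k * pw (4 * t) k) * msq (st k) + pw (5 * t + s) k * pw (4 * t - 2) k)"
        by (simp add: D_def algebra_simps)
      also have "pw (5 * t + s) k * pw (4 * t) k = pw (9 * t + s) k"
        unfolding pw_mult by (rule arg_cong[where f = "\<lambda>e. pw e k"]) simp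
      also have "pw (5 * t + s) k * pw (4 * t - 2) k = pw (9 * t + s - 2) k"
        unfolding pw_mult by (rule arg_cong[where f = "\<lambda>e. pw e k"]) simp
      finally show ?thesis .
    qed
    also have "(1 - h / 2) * msq (r k) + 2 * (\<beta>0\<^sup>2 * VC * pw (- 6 * t - 2 * s) k)
        + 6 * C\<^sup>2 / b * (pw (9 * t + s) k * msq (st k) + pw (9 * t + s - 2) k)
      \<le> (1 - h / 2) * msq (r k) + K * pw (- 6 * t - 2 * s) k
        + K * (pw (9 * t + s) k * msq (st k) + pw (9 * t + s - 2) k)"
    proof (intro add_mono mult_right_mono order_refl K)
      show "2 * (\<beta>0\<^sup>2 * VC * pw (- 6 * t - 2 * s) k) \<le> K * pw (- 6 * t - 2 * s) k"
        using mult_right_mono[OF K(1) pw_nonneg[of "- 6 * t - 2 * s" k]] by simp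
    qed auto
    finally show ?case by (simp add: h_def distrib_left add.assoc)
  qed
  then show ?thesis using b K by (intro exI[of _ "b / 2"] conjI exI[of _ K]) auto
qed

end

text \<open>The arithmetic that closes \<open>momentum_recursion\<close>: e is the fresh variance,
  m1 and m2 are the mean squares of the sampled and of the mean gradient increments.\<close>

lemma add_error_terms:
  fixes a b b' e e' m m1 m2 z :: real
  assumes "b \<le> b'" "3 * (e' + m) \<le> z" "a \<le> b + 3 * (e + m1 + m2)" "e \<le> e'" "m1 + m2 \<le> m"
  shows "a \<le> b' + z"
proof -
  have "3 * (e + m1 + m2) \<le> 3 * (e' + m)" using assms(4,5) by simp
  with assms(1-3) show ?thesis by simp
qed

context sipba_run
begin

subsection \<open>The momentum estimator\<close>

text \<open>Both points are determined before \<xi>x k is drawn. By independence they can be frozen,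
  so the bound for fixed points applies inside the integral; U collects the two points.\<close>

lemma sample_difference:
  assumes h: "oracle_fun Lh h"
    and in1: "\<And>\<omega>. \<omega> \<in> space M \<Longrightarrow> p \<omega> \<in> X" "\<And>\<omega>. \<omega> \<in> space M \<Longrightarrow> v \<omega> \<in> Y"
    and in2: "\<And>\<omega>. \<omega> \<in> space M \<Longrightarrow> p' \<omega> \<in> X" "\<And>\<omega>. \<omega> \<in> space M \<Longrightarrow> v' \<omega> \<in> Y"
    and m: "p \<in> borel_measurable (Fh k)" "v \<in> borel_measurable (Fh k)"
      "p' \<in> borel_measurable (Fh k)" "v' \<in> borel_measurable (Fh k)"
    and sq: "sq_int M (\<lambda>\<omega>. p \<omega> - p' \<omega>)" "sq_int M (\<lambda>\<omega>. v \<omega> - v' \<omega>)"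
  shows "sq_int M (\<lambda>\<omega>. Sx h (\<xi>x k \<omega>) (p \<omega>) (v \<omega>) - Sx h (\<xi>x k \<omega>) (p' \<omega>) (v' \<omega>))"
    "msq (\<lambda>\<omega>. Sx h (\<xi>x k \<omega>) (p \<omega>) (v \<omega>) - Sx h (\<xi>x k \<omega>) (p' \<omega>) (v' \<omega>))
      \<le> Lh\<^sup>2 * (msq (\<lambda>\<omega>. p \<omega> - p' \<omega>) + msq (\<lambda>\<omega>. v \<omega> - v' \<omega>))"
proof -
  let ?R = "restrict_space borel (X \<times> Y) :: ((real^'n) \<times> (real^'m)) measure"
  let ?D = "\<lambda>\<omega>. Sx h (\<xi>x k \<omega>) (p \<omega>) (v \<omega>) - Sx h (\<xi>x k \<omega>) (p' \<omega>) (v' \<omega>)"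
  let ?g = "\<lambda>\<omega>. Lh\<^sup>2 * ((norm (p \<omega> - p' \<omega>))\<^sup>2 + (norm (v \<omega> - v' \<omega>))\<^sup>2)"
  let ?H = "\<lambda>q. ennreal ((norm (Sx h (snd q) (fst (fst (fst q))) (snd (fst (fst q)))
      - Sx h (snd q) (fst (snd (fst q))) (snd (snd (fst q)))))\<^sup>2)"
  define U where "U \<omega> = ((p \<omega>, v \<omega>), (p' \<omega>, v' \<omega>))" for \<omega>
  have UM: "U \<in> measurable (Fh k) (?R \<Otimes>\<^sub>M ?R)"
    unfolding U_def[abs_def]
    by (intro measurable_Pair measurable_pair_restrict m) (simp_all add: filt_space in1 in2)
  have sm: "(\<lambda>((x, y), w). Sx h w x y) \<in> borel_measurable (?R \<Otimes>\<^sub>M D)"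
    using h by (auto simp: oracle_fun_def sample_fun_def)
  have "(\<lambda>q. (fst (fst q), snd q)) \<in> measurable ((?R \<Otimes>\<^sub>M ?R) \<Otimes>\<^sub>M D) (?R \<Otimes>\<^sub>M D)"
    "(\<lambda>q. (snd (fst q), snd q)) \<in> measurable ((?R \<Otimes>\<^sub>M ?R) \<Otimes>\<^sub>M D) (?R \<Otimes>\<^sub>M D)"
    by measurable
  from this[THEN measurable_compose, OF sm]
  have m1: "(\<lambda>q. Sx h (snd q) (fst (fst (fst q))) (snd (fst (fst q)))) \<in> borel_measurable ((?R \<Otimes>\<^sub>M ?R) \<Otimes>\<^sub>M D)"
    and m2: "(\<lambda>q. Sx h (snd q) (fst (snd (fst q))) (snd (snd (fst q)))) \<in> borel_measurable ((?R \<Otimes>\<^sub>M ?R) \<Otimes>\<^sub>M D)"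
    by (simp_all add: case_prod_beta)
  have HM: "?H \<in> borel_measurable ((?R \<Otimes>\<^sub>M ?R) \<Otimes>\<^sub>M D)"
    using m1 m2 by measurable
  have ind: "M.indep_set (sets (vimage_algebra (space M) (\<xi>x k) D)) (sets (Fh k))"
    and ds: "distr M D (\<xi>x k) = D"
    using samples by (auto simp: samples_def)
  have gi: "integrable M ?g" using sq by (auto simp: sq_int_def)
  have Dm: "?D \<in> borel_measurable M"
    by (intro borel_measurable_diff; rule sample_measurable(1)[OF h])
       (simp_all add: in1 in2 \<xi>_measurable m[THEN measurable_from_subalg[OF filt_subalgebra(2)]])
  have "(\<integral>\<^sup>+\<omega>. ennreal ((norm (?D \<omega>))\<^sup>2) \<partial>M) = (\<integral>\<^sup>+\<omega>. ?H (U \<omega>, \<xi>x k \<omega>) \<partial>M)"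
    by (simp add: U_def)
  also have "\<dots> = (\<integral>\<^sup>+\<omega>. (\<integral>\<^sup>+w. ?H (U \<omega>, w) \<partial>D) \<partial>M)"
    by (rule indep_nn_integral_iterated[OF prob_M filt_subalgebra(2) \<xi>_measurable(2) ds ind UM HM])
  also have "\<dots> \<le> (\<integral>\<^sup>+\<omega>. ennreal (?g \<omega>) \<partial>M)"
  proof (rule nn_integral_mono)
    fix \<omega> assume \<omega>: "\<omega> \<in> space M"
    have "mean_square_lipschitz D X Y Lh h" using h by (simp add: oracle_fun_def)
    then show "(\<integral>\<^sup>+w. ?H (U \<omega>, w) \<partial>D) \<le> ennreal (?g \<omega>)"
      unfolding mean_square_lipschitz_def U_def
      using in1[OF \<omega>] in2[OF \<omega>] by simp
  qed
  also have "\<dots> = ennreal (\<integral>\<omega>. ?g \<omega> \<partial>M)"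
    by (rule nn_integral_eq_integral[OF gi]) simp
  finally have le: "(\<integral>\<^sup>+\<omega>. ennreal ((norm (?D \<omega>))\<^sup>2) \<partial>M) \<le> ennreal (\<integral>\<omega>. ?g \<omega> \<partial>M)" .
  have int: "integrable M (\<lambda>\<omega>. (norm (?D \<omega>))\<^sup>2)"
  proof (rule integrableI_bounded)
    show "(\<lambda>\<omega>. (norm (?D \<omega>))\<^sup>2) \<in> borel_measurable M" using Dm by measurable
    show "(\<integral>\<^sup>+\<omega>. ennreal (norm ((norm (?D \<omega>))\<^sup>2)) \<partial>M) < \<infinity>"
      using le by (simp add: le_less_trans)
  qed
  then show "sq_int M ?D" using Dm by (simp add: sq_int_def)
  have "msq ?D \<le> (\<integral>\<omega>. ?g \<omega> \<partial>M)"
    using le unfolding nn_integral_eq_integral[OF int AE_I2[OF zero_le_power2]] msq_def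
    by (subst (asm) ennreal_le_iff) (auto intro!: integral_nonneg)
  then show "msq ?D \<le> Lh\<^sup>2 * (msq (\<lambda>\<omega>. p \<omega> - p' \<omega>) + msq (\<lambda>\<omega>. v \<omega> - v' \<omega>))"
    using sq by (simp add: msq_def sq_int_def)
qed

lemma msq_scaleR: "msq (\<lambda>\<omega>. c *\<^sub>R v \<omega>) = c\<^sup>2 * msq v"
  by (simp add: msq_def power_mult_distrib)

lemma msq_add:
  assumes "sq_int M v" "sq_int M v'"
  shows "msq (\<lambda>\<omega>. v \<omega> + v' \<omega>) \<le> 2 * msq v + 2 * msq v'"
proof -
  have "msq (\<lambda>\<omega>. v \<omega> + v' \<omega>) \<le> (\<integral>\<omega>. 2 * (norm (v \<omega>))\<^sup>2 + 2 * (norm (v' \<omega>))\<^sup>2 \<partial>M)"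
    using assms by (intro msq_mono sq_int_add) (auto simp: sq_int_def norm_add_sq_le)
  also have "\<dots> = 2 * msq v + 2 * msq v'" using assms by (simp add: msq_def sq_int_def)
  finally show ?thesis .
qed

lemma msq_fst_snd: 
  assumes "sq_int M v"
  shows "msq (\<lambda>\<omega>. fst (v \<omega>)) \<le> msq v" "msq (\<lambda>\<omega>. snd (v \<omega>)) \<le> msq v"
    "msq (\<lambda>\<omega>. fst (v \<omega>) - snd (v \<omega>)) \<le> 2 * msq v"
proof -
  have i: "integrable M (\<lambda>\<omega>. (norm (v \<omega>))\<^sup>2)" using assms by (simp add: sq_int_def)
  show "msq (\<lambda>\<omega>. fst (v \<omega>)) \<le> msq v" "msq (\<lambda>\<omega>. snd (v \<omega>)) \<le> msq v"
    using msq_mono[OF sq_int_fst[OF assms] i] msq_mono[OF sq_int_snd[OF assms] i]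
    by (auto simp: msq_def power_mono norm_fst_bound norm_snd_bound)
  have "(norm (fst q - snd q))\<^sup>2 \<le> 2 * (norm q)\<^sup>2" for q :: "'z::euclidean_space \<times> 'z"
    using norm_diff_sq_le[of "fst q" "snd q"] norm_Pair[of "fst q" "snd q"] by simp
  then have "msq (\<lambda>\<omega>. fst (v \<omega>) - snd (v \<omega>)) \<le> (\<integral>\<omega>. 2 * (norm (v \<omega>))\<^sup>2 \<partial>M)"
    by (intro msq_mono sq_int_diff sq_int_fst sq_int_snd assms integrable_mult_right i)
  then show "msq (\<lambda>\<omega>. fst (v \<omega>) - snd (v \<omega>)) \<le> 2 * msq v" by (simp add: msq_def)
qed

text \<open>L is included so that the same constant serves the increments of the mean
  gradients.\<close>

definition LL where "LL = LF\<^sup>2 + Lf\<^sup>2 + L\<^sup>2"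

text \<open>At one sample the direction changes for two reasons. The points move, which gives D1, D2
  and D3 with the new penalty; and the penalty changes, which gives D4, a difference of f-gradients
  between y and z bounded through |y - z|^2 \<le> 2 |u|^2.\<close>

lemma sample_gradient_step:
  fixes k :: nat
  defines "\<rho>' \<equiv> rh (Suc k)" and "d\<rho> \<equiv> rh (Suc k) - rh k"
  shows "sq_int M (\<lambda>\<omega>. gS (Suc k) (\<xi>x (Suc k) \<omega>) (x (Suc k) \<omega>) (u (Suc (Suc k)) \<omega>)
      - gS k (\<xi>x (Suc k) \<omega>) (x k \<omega>) (u (Suc k) \<omega>))"
    "msq (\<lambda>\<omega>. gS (Suc k) (\<xi>x (Suc k) \<omega>) (x (Suc k) \<omega>) (u (Suc (Suc k)) \<omega>)
      - gS k (\<xi>x (Suc k) \<omega>) (x k \<omega>) (u (Suc k) \<omega>))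
    \<le> 8 * LL * (1 + \<rho>'\<^sup>2) * (msq (st k) + msq (du (Suc k))) + 8 * LL * d\<rho>\<^sup>2 * msq (u (Suc k))"
proof -
  let ?K = "Suc k"
  let ?S = "\<lambda>h. \<lambda>\<omega>. Sx h (\<xi>x ?K \<omega>)"
  have Y': "fst (u j \<omega>) \<in> Y" "snd (u j \<omega>) \<in> Y" if "\<omega> \<in> space M" for j \<omega>
    using iterates_in(4)[OF that, of j] by (auto simp: mem_Times_iff)
  note um2 = measurable_fst_snd[OF run_measurable(3)[of ?K]]
    and um1 = measurable_fst_snd[OF run_measurable_half(2)[of ?K]]
    and xm1 = run_measurable_half(1)[of ?K] and xm0 = run_measurable_half(3)[of k]
  have s1: "sq_int M (\<lambda>\<omega>. x ?K \<omega> - x k \<omega>)" using sq_ints(3)[of k] by (simp add: st_def[abs_def])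
  have s2: "sq_int M (\<lambda>\<omega>. fst (u (Suc ?K) \<omega>) - fst (u ?K \<omega>))" "sq_int M (\<lambda>\<omega>. snd (u (Suc ?K) \<omega>) - snd (u ?K \<omega>))"
    by (intro sq_int_diff sq_int_fst sq_int_snd run_sq_int)+
  have s3: "sq_int M (\<lambda>\<omega>. x k \<omega> - x k \<omega>)" by (intro sq_int_diff x_sq)
  have s4: "sq_int M (\<lambda>\<omega>. fst (u ?K \<omega>) - snd (u ?K \<omega>))"
    by (intro sq_int_diff sq_int_fst sq_int_snd run_sq_int)
  define D1 where "D1 \<omega> = ?S FS \<omega> (x ?K \<omega>) (fst (u (Suc ?K) \<omega>)) - ?S FS \<omega> (x k \<omega>) (fst (u ?K \<omega>))" for \<omega>
  define D2 where "D2 \<omega> = ?S fS \<omega> (x ?K \<omega>) (fst (u (Suc ?K) \<omega>)) - ?S fS \<omega> (x k \<omega>) (fst (u ?K \<omega>))" for \<omega>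
  define D3 where "D3 \<omega> = ?S fS \<omega> (x ?K \<omega>) (snd (u (Suc ?K) \<omega>)) - ?S fS \<omega> (x k \<omega>) (snd (u ?K \<omega>))" for \<omega>
  define D4 where "D4 \<omega> = ?S fS \<omega> (x k \<omega>) (fst (u ?K \<omega>)) - ?S fS \<omega> (x k \<omega>) (snd (u ?K \<omega>))" for \<omega>
  note r1 = sample_difference[OF oracle_funs(1) iterates_in(1) Y'(1) iterates_in(1) Y'(1) xm1 um2(1) xm0 um1(1) s1 s2(1), folded D1_def]
    and r2 = sample_difference[OF oracle_funs(2) iterates_in(1) Y'(1) iterates_in(1) Y'(1) xm1 um2(1) xm0 um1(1) s1 s2(1), folded D2_def]
    and r3 = sample_difference[OF oracle_funs(2) iterates_in(1) Y'(2) iterates_in(1) Y'(2) xm1 um2(2) xm0 um1(2) s1 s2(2), folded D3_def]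
    and r4 = sample_difference[OF oracle_funs(2) iterates_in(1) Y'(1) iterates_in(1) Y'(2) xm0 um1(1) xm0 um1(2) s3 s4, folded D4_def]
  define Q where "Q = msq (st k) + msq (du ?K)"
  have Q0: "0 \<le> Q" by (simp add: Q_def)
  have LL: "LF\<^sup>2 \<le> LL" "Lf\<^sup>2 \<le> LL" by (auto simp: LL_def)
  then have LL0: "0 \<le> LL" by (meson order_trans zero_le_power2)
  have du: "msq (\<lambda>\<omega>. fst (u (Suc ?K) \<omega>) - fst (u ?K \<omega>)) \<le> msq (du ?K)"
    "msq (\<lambda>\<omega>. snd (u (Suc ?K) \<omega>) - snd (u ?K \<omega>)) \<le> msq (du ?K)"
    using msq_fst_snd(1,2)[OF sq_ints(4)[of ?K]] by (simp_all add: du_def)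
  have stQ: "msq (\<lambda>\<omega>. x ?K \<omega> - x k \<omega>) = msq (st k)" by (simp add: st_def[abs_def])
  have D: "msq D1 \<le> LL * Q" "msq D2 \<le> LL * Q" "msq D3 \<le> LL * Q"
    using du LL LL0 by (auto intro!: order_trans[OF r1(2)] order_trans[OF r2(2)] order_trans[OF r3(2)] mult_mono
        simp: Q_def stQ)
  have D4: "msq D4 \<le> LL * (2 * msq (u ?K))"
  proof -
    have "msq D4 \<le> Lf\<^sup>2 * msq (\<lambda>\<omega>. fst (u ?K \<omega>) - snd (u ?K \<omega>))"
      using r4(2) by (simp add: msq_def)
    also have "\<dots> \<le> LL * (2 * msq (u ?K))"
      using LL LL0 msq_fst_snd(3)[OF run_sq_int(1)[of ?K]] by (intro mult_mono) auto
    finally show ?thesis .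
  qed
  have eq: "(\<lambda>\<omega>. gS ?K (\<xi>x ?K \<omega>) (x ?K \<omega>) (u (Suc ?K) \<omega>) - gS k (\<xi>x ?K \<omega>) (x k \<omega>) (u ?K \<omega>))
    = (\<lambda>\<omega>. (D1 \<omega> + (- d\<rho>) *\<^sub>R D4 \<omega>) + ((- \<rho>') *\<^sub>R D2 \<omega> + \<rho>' *\<^sub>R D3 \<omega>))"
    by (simp add: gS_def upper_dir_def D1_def D2_def D3_def D4_def \<rho>'_def d\<rho>_def fun_eq_iff algebra_simps)
  have si: "sq_int M D1" "sq_int M D2" "sq_int M D3" "sq_int M D4"
    using r1(1) r2(1) r3(1) r4(1) by (simp_all add: D1_def[abs_def] D2_def[abs_def] D3_def[abs_def] D4_def[abs_def])
  show "sq_int M (\<lambda>\<omega>. gS ?K (\<xi>x ?K \<omega>) (x ?K \<omega>) (u (Suc ?K) \<omega>) - gS k (\<xi>x ?K \<omega>) (x k \<omega>) (u ?K \<omega>))"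
    unfolding eq by (intro sq_int_add sq_int_scaleR si)
  have "msq (\<lambda>\<omega>. (D1 \<omega> + (- d\<rho>) *\<^sub>R D4 \<omega>) + ((- \<rho>') *\<^sub>R D2 \<omega> + \<rho>' *\<^sub>R D3 \<omega>))
    \<le> 2 * (2 * msq D1 + 2 * (d\<rho>\<^sup>2 * msq D4)) + 2 * (2 * (\<rho>'\<^sup>2 * msq D2) + 2 * (\<rho>'\<^sup>2 * msq D3))"
  proof -
    have A: "msq (\<lambda>\<omega>. D1 \<omega> + (- d\<rho>) *\<^sub>R D4 \<omega>) \<le> 2 * msq D1 + 2 * (d\<rho>\<^sup>2 * msq D4)"
      using msq_add[OF si(1) sq_int_scaleR[OF si(4), of "- d\<rho>"]]
      by (simp only: msq_scaleR power2_minus)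
    have B: "msq (\<lambda>\<omega>. (- \<rho>') *\<^sub>R D2 \<omega> + \<rho>' *\<^sub>R D3 \<omega>) \<le> 2 * (\<rho>'\<^sup>2 * msq D2) + 2 * (\<rho>'\<^sup>2 * msq D3)"
      using msq_add[OF sq_int_scaleR[OF si(2), of "- \<rho>'"] sq_int_scaleR[OF si(3), of "\<rho>'"]]
      by (simp only: msq_scaleR power2_minus)
    show ?thesis
      by (intro order_trans[OF msq_add add_mono[OF mult_left_mono[OF A] mult_left_mono[OF B]]]
          sq_int_add sq_int_scaleR si) simp_all
  qed
  also have "\<dots> \<le> 2 * (2 * (LL * Q) + 2 * (d\<rho>\<^sup>2 * (LL * (2 * msq (u ?K))))) + 2 * (2 * (\<rho>'\<^sup>2 * (LL * Q)) + 2 * (\<rho>'\<^sup>2 * (LL * Q)))"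
    using D D4 by (intro add_mono mult_left_mono) auto
  also have "\<dots> \<le> 8 * LL * (1 + \<rho>'\<^sup>2) * Q + 8 * LL * d\<rho>\<^sup>2 * msq (u ?K)"
    using mult_nonneg_nonneg[OF LL0 Q0] by (simp add: algebra_simps)
  finally show "msq (\<lambda>\<omega>. gS ?K (\<xi>x ?K \<omega>) (x ?K \<omega>) (u (Suc ?K) \<omega>) - gS k (\<xi>x ?K \<omega>) (x k \<omega>) (u ?K \<omega>))
    \<le> 8 * LL * (1 + \<rho>'\<^sup>2) * (msq (st k) + msq (du ?K)) + 8 * LL * d\<rho>\<^sup>2 * msq (u ?K)"
    unfolding eq Q_def .
qed

text \<open>The same splitting for the mean direction: a collects the moving points, b the change of
  the penalty.\<close>

lemma mean_gradient_step:
  "msq (\<lambda>\<omega>. gk (Suc k) (x (Suc k) \<omega>) (u (Suc (Suc k)) \<omega>) - gk k (x k \<omega>) (u (Suc k) \<omega>))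
    \<le> 4 * C\<^sup>2 * pw (2 * t) (Suc k) * (msq (st k) + msq (du (Suc k)))
      + 4 * LL * (rh (Suc k) - rh k)\<^sup>2 * msq (u (Suc k))"
proof -
  let ?K = "Suc k"
  let ?g = "\<lambda>\<omega>. 4 * C\<^sup>2 * pw (2 * t) ?K * ((norm (st k \<omega>))\<^sup>2 + (norm (du ?K \<omega>))\<^sup>2)
      + 4 * LL * (rh ?K - rh k)\<^sup>2 * (norm (u ?K \<omega>))\<^sup>2"
  have "sq_int M (\<lambda>\<omega>. gk ?K (x ?K \<omega>) (u (Suc ?K) \<omega>) - gk k (x k \<omega>) (u ?K \<omega>))"
    by (intro sq_int_diff gk_x_sq)
  then have "msq (\<lambda>\<omega>. gk ?K (x ?K \<omega>) (u (Suc ?K) \<omega>) - gk k (x k \<omega>) (u ?K \<omega>)) \<le> (\<integral>\<omega>. ?g \<omega> \<partial>M)"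
  proof (rule msq_mono)
    show "integrable M ?g"
      using sq_intD(2)[OF sq_ints(3)[of k]] sq_intD(2)[OF sq_ints(4)[of ?K]] sq_intD(2)[OF run_sq_int(1)[of ?K]] by simp
    fix \<omega> assume \<omega>: "\<omega> \<in> space M"
    note xX = iterates_in(1)[OF \<omega>] and uY = iterates_in(4)[OF \<omega>]
    have yz: "fst (u ?K \<omega>) \<in> Y" "snd (u ?K \<omega>) \<in> Y" using uY[of ?K] by (auto simp: mem_Times_iff)
    define a where "a = gk ?K (x ?K \<omega>) (u (Suc ?K) \<omega>) - gk ?K (x k \<omega>) (u ?K \<omega>)"
    define b where "b = gk ?K (x k \<omega>) (u ?K \<omega>) - gk k (x k \<omega>) (u ?K \<omega>)"
    have "norm a \<le> C * pw t ?K * (norm (st k \<omega>) + norm (du ?K \<omega>))"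
      unfolding a_def st_def du_def by (rule gk_lip[OF xX xX uY uY])
    then have "(norm a)\<^sup>2 \<le> (C * pw t ?K * (norm (st k \<omega>) + norm (du ?K \<omega>)))\<^sup>2"
      by (rule power_mono) simp
    also have "\<dots> = C\<^sup>2 * pw (2 * t) ?K * (norm (st k \<omega>) + norm (du ?K \<omega>))\<^sup>2"
      by (simp add: power_mult_distrib pw_mult power2_eq_square[of "pw t ?K"])
    also have "\<dots> \<le> C\<^sup>2 * pw (2 * t) ?K * (2 * (norm (st k \<omega>))\<^sup>2 + 2 * (norm (du ?K \<omega>))\<^sup>2)"
      using sum_squares_bound[of "norm (st k \<omega>)" "norm (du ?K \<omega>)"]
      by (intro mult_left_mono) (auto simp: power2_sum)
    finally have a: "(norm a)\<^sup>2 \<le> C\<^sup>2 * pw (2 * t) ?K * (2 * (norm (st k \<omega>))\<^sup>2 + 2 * (norm (du ?K \<omega>))\<^sup>2)" .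
    have b_eq: "b = - (rh ?K - rh k) *\<^sub>R (grad_x (mean_fun D fS) (x k \<omega>) (fst (u ?K \<omega>)) - grad_x (mean_fun D fS) (x k \<omega>) (snd (u ?K \<omega>)))"
      by (simp add: b_def gk_def upper_dir_def algebra_simps)
    have "(norm b)\<^sup>2 \<le> (rh ?K - rh k)\<^sup>2 * (LL * (2 * (norm (u ?K \<omega>))\<^sup>2))"
    proof -
      let ?v = "grad_x (mean_fun D fS) (x k \<omega>) (fst (u ?K \<omega>)) - grad_x (mean_fun D fS) (x k \<omega>) (snd (u ?K \<omega>))"
      have "norm ?v \<le> L * norm (fst (u ?K \<omega>) - snd (u ?K \<omega>))"
        using lip_f_x[OF xX yz(1) xX yz(2), of k k] by simp
      then have "(norm ?v)\<^sup>2 \<le> (L * norm (fst (u ?K \<omega>) - snd (u ?K \<omega>)))\<^sup>2" by (rule power_mono) simp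
      also have "\<dots> \<le> LL * (2 * (norm (u ?K \<omega>))\<^sup>2)"
        using norm_diff_sq_le[of "fst (u ?K \<omega>)" "snd (u ?K \<omega>)"] norm_Pair[of "fst (u ?K \<omega>)" "snd (u ?K \<omega>)"]
        unfolding power_mult_distrib by (intro mult_mono) (auto simp: LL_def)
      finally show ?thesis
        unfolding b_eq norm_scaleR power_mult_distrib power2_abs power2_minus
        by (rule mult_left_mono) simp
    qed
    moreover have "gk ?K (x ?K \<omega>) (u (Suc ?K) \<omega>) - gk k (x k \<omega>) (u ?K \<omega>) = a + b" by (simp add: a_def b_def)
    ultimately have "(norm (gk ?K (x ?K \<omega>) (u (Suc ?K) \<omega>) - gk k (x k \<omega>) (u ?K \<omega>)))\<^sup>2
      \<le> 2 * (C\<^sup>2 * pw (2 * t) ?K * (2 * (norm (st k \<omega>))\<^sup>2 + 2 * (norm (du ?K \<omega>))\<^sup>2))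
       + 2 * ((rh ?K - rh k)\<^sup>2 * (LL * (2 * (norm (u ?K \<omega>))\<^sup>2)))"
      using norm_add_sq_le[of a b] a by simp
    then show "(norm (gk ?K (x ?K \<omega>) (u (Suc ?K) \<omega>) - gk k (x k \<omega>) (u ?K \<omega>)))\<^sup>2 \<le> ?g \<omega>"
      by (simp add: algebra_simps)
  qed
  also have "\<dots> = 4 * C\<^sup>2 * pw (2 * t) ?K * (msq (st k) + msq (du ?K)) + 4 * LL * (rh ?K - rh k)\<^sup>2 * msq (u ?K)"
    using sq_intD(2)[OF sq_ints(3)[of k]] sq_intD(2)[OF sq_ints(4)[of ?K]] sq_intD(2)[OF run_sq_int(1)[of ?K]]
    by (simp add: msq_def)
  finally show ?thesis .
qed

text \<open>The iterates themselves need not be bounded, but the saddle points are, so the second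
  moment of u is controlled by that of r.\<close>

lemma msq_u: "msq (u k) \<le> 2 * C\<^sup>2 * (1 + msq (r k))"
proof -
  have "msq (u k) = msq (\<lambda>\<omega>. r k \<omega> + usk k (x k \<omega>))" by (simp add: r_def msq_def)
  also have "\<dots> \<le> 2 * msq (r k) + 2 * msq (\<lambda>\<omega>. usk k (x k \<omega>))"
    by (intro msq_add sq_ints usk_x)
  also have "msq (\<lambda>\<omega>. usk k (x k \<omega>)) \<le> (\<integral>\<omega>. C\<^sup>2 \<partial>M)"
    using usk_bounded[OF iterates_in(1)] by (intro msq_mono usk_x) (auto intro: power_mono)
  also have "\<dots> = C\<^sup>2" by (simp add: M.prob_space)
  also have "2 * msq (r k) + 2 * C\<^sup>2 \<le> 2 * C\<^sup>2 * (1 + msq (r k))"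
    using mult_right_mono[of 1 "C\<^sup>2" "msq (r k)"] C_ge by (simp add: algebra_simps)
  finally show ?thesis by simp
qed

text \<open>u k is feasible, so nonexpansiveness bounds the increment by \<beta>_k times the sampled
  operator. The latter is noise plus the mean operator, which is of order k^t at the saddle point
  and Lipschitz away from it.\<close>

lemma msq_du: "msq (du k) \<le> (4 * C\<^sup>2 + 2 * VC) * \<beta>0\<^sup>2 * pw (- 6 * t - 2 * s) k * (1 + msq (r k))"
proof -
  let ?T = "\<lambda>\<omega>. TS k (\<xi>u k \<omega>) (x k \<omega>) (u k \<omega>)" and ?m = "\<lambda>\<omega>. Tk k (x k \<omega>) (u k \<omega>)"
  have N: "noise M (Fk k) (VC * pw (2 * t) k) (\<lambda>\<omega>. ?T \<omega> - ?m \<omega>)"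
    by (rule noise_T[OF iterates_in(1) iterates_in(4) run_measurable(1,2) run_sq_int(1)])
  have ms: "sq_int M ?m"
    by (rule mean_op_sq_int(2)[OF filt_subalgebra(1) iterates_in(1) iterates_in(4) run_measurable(1,2) run_sq_int(1)])
  have "msq ?m \<le> (\<integral>\<omega>. 2 * C\<^sup>2 * pw (2 * t) k * (1 + (norm (r k \<omega>))\<^sup>2) \<partial>M)"
  proof (rule msq_mono[OF ms])
    show "integrable M (\<lambda>\<omega>. 2 * C\<^sup>2 * pw (2 * t) k * (1 + (norm (r k \<omega>))\<^sup>2))"
      using sq_intD(2)[OF sq_ints(1)[of k]] by simp
    fix \<omega> assume \<omega>: "\<omega> \<in> space M"
    note xX = iterates_in(1)[OF \<omega>, of k]
    have "norm (?m \<omega> - Tk k (x k \<omega>) (usk k (x k \<omega>))) \<le> C * pw t k * norm (r k \<omega>)"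
      using Tk_lip[OF xX xX iterates_in(4)[OF \<omega>] usk_in[OF xX], of k k k] by (simp add: r_def)
    then have "norm (?m \<omega>) \<le> C * pw t k * (1 + norm (r k \<omega>))"
      using Tk_usk_le[OF xX, of k] norm_triangle_sub[of "?m \<omega>" "Tk k (x k \<omega>) (usk k (x k \<omega>))"]
      by (simp add: distrib_left)
    then have "(norm (?m \<omega>))\<^sup>2 \<le> (C * pw t k * (1 + norm (r k \<omega>)))\<^sup>2" by (rule power_mono) simp
    also have "\<dots> = C\<^sup>2 * pw (2 * t) k * (1 + norm (r k \<omega>))\<^sup>2"
      by (simp add: power_mult_distrib pw_mult power2_eq_square[of "pw t k"])
    also have "\<dots> \<le> C\<^sup>2 * pw (2 * t) k * (2 * (1 + (norm (r k \<omega>))\<^sup>2))"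
      using sum_squares_bound[of 1 "norm (r k \<omega>)"] by (intro mult_left_mono) (auto simp: power2_sum)
    finally show "(norm (?m \<omega>))\<^sup>2 \<le> 2 * C\<^sup>2 * pw (2 * t) k * (1 + (norm (r k \<omega>))\<^sup>2)"
      by (simp only: mult_ac)
  qed
  also have "\<dots> = 2 * C\<^sup>2 * pw (2 * t) k * (1 + msq (r k))"
    using sq_intD(2)[OF sq_ints(1)[of k]] by (simp add: msq_def M.prob_space)
  finally have m: "msq ?m \<le> 2 * C\<^sup>2 * pw (2 * t) k * (1 + msq (r k))" .
  have "msq ?T \<le> 2 * msq ?m + 2 * msq (\<lambda>\<omega>. ?T \<omega> - ?m \<omega>)"
    using msq_add[OF ms, of "\<lambda>\<omega>. ?T \<omega> - ?m \<omega>"] N by (simp add: noise_def)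
  also have "msq (\<lambda>\<omega>. ?T \<omega> - ?m \<omega>) \<le> VC * pw (2 * t) k" using N by (simp add: noise_def msq_def)
  also have "2 * msq ?m + 2 * (VC * pw (2 * t) k) \<le> (4 * C\<^sup>2 + 2 * VC) * pw (2 * t) k * (1 + msq (r k))"
    using m mult_nonneg_nonneg[OF mult_nonneg_nonneg[OF VC_nonneg pw_nonneg[of "2 * t" k]] msq_nonneg[of "r k"]]
    by (simp add: algebra_simps)
  finally have T: "msq ?T \<le> (4 * C\<^sup>2 + 2 * VC) * pw (2 * t) k * (1 + msq (r k))" by simp
  have "msq (du k) \<le> (\<integral>\<omega>. (be k)\<^sup>2 * (norm (?T \<omega>))\<^sup>2 \<partial>M)"
  proof (rule msq_mono[OF sq_ints(4)])
    show "integrable M (\<lambda>\<omega>. (be k)\<^sup>2 * (norm (?T \<omega>))\<^sup>2)"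
      using sq_intD(2)[OF run_sq_int(3)[of k]] by simp
    fix \<omega> assume \<omega>: "\<omega> \<in> space M"
    have "norm (du k \<omega>) = norm (closest_point (Y \<times> Y) (u k \<omega> - be k *\<^sub>R ?T \<omega>) - closest_point (Y \<times> Y) (u k \<omega>))"
      by (simp add: du_def u_Suc[OF \<omega>] closest_point_self[OF iterates_in(4)[OF \<omega>]])
    also have "\<dots> \<le> norm (u k \<omega> - be k *\<^sub>R ?T \<omega> - u k \<omega>)"
      by (rule closest_point_nonexpansive[OF YY])
    also have "\<dots> = be k * norm (?T \<omega>)" using step_pos(2)[of k] by simp
    finally have "(norm (du k \<omega>))\<^sup>2 \<le> (be k * norm (?T \<omega>))\<^sup>2" by (rule power_mono) simp
    then show "(norm (du k \<omega>))\<^sup>2 \<le> (be k)\<^sup>2 * (norm (?T \<omega>))\<^sup>2" by (simp add: power_mult_distrib)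
  qed
  also have "\<dots> = (be k)\<^sup>2 * msq ?T" by (simp add: msq_def)
  also have "\<dots> \<le> (be k)\<^sup>2 * ((4 * C\<^sup>2 + 2 * VC) * pw (2 * t) k * (1 + msq (r k)))"
    using T by (intro mult_left_mono) auto
  also have "\<dots> = (4 * C\<^sup>2 + 2 * VC) * ((be k)\<^sup>2 * pw (2 * t) k) * (1 + msq (r k))" by simp
  also have "\<dots> = (4 * C\<^sup>2 + 2 * VC) * \<beta>0\<^sup>2 * pw (- 6 * t - 2 * s) k * (1 + msq (r k))"
    unfolding be_sq by (simp add: mult.assoc)
  finally show ?thesis .
qed

text \<open>The error obeys er (Suc k) = c er k + N with N centered given everything before the new
  sample, so no cross term appears, and c^2 \<le> c.\<close>

lemma estimator_step:
  "msq (er (Suc k)) \<le> (1 - et (Suc k)) * msq (er k)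
    + 3 * ((et (Suc k))\<^sup>2 * (VC * pw (2 * t) (Suc k))
      + msq (\<lambda>\<omega>. gS (Suc k) (\<xi>x (Suc k) \<omega>) (x (Suc k) \<omega>) (u (Suc (Suc k)) \<omega>) - gS k (\<xi>x (Suc k) \<omega>) (x k \<omega>) (u (Suc k) \<omega>))
      + msq (\<lambda>\<omega>. gk (Suc k) (x (Suc k) \<omega>) (u (Suc (Suc k)) \<omega>) - gk k (x k \<omega>) (u (Suc k) \<omega>)))"
proof -
  let ?K = "Suc k"
  define g1 where "g1 \<omega> = gk ?K (x ?K \<omega>) (u (Suc ?K) \<omega>)" for \<omega>
  define g0 where "g0 \<omega> = gk k (x k \<omega>) (u ?K \<omega>)" for \<omega>
  define s1 where "s1 \<omega> = gS ?K (\<xi>x ?K \<omega>) (x ?K \<omega>) (u (Suc ?K) \<omega>)" for \<omega>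
  define s0 where "s0 \<omega> = gS k (\<xi>x ?K \<omega>) (x k \<omega>) (u ?K \<omega>)" for \<omega>
  define c where "c = 1 - et ?K"
  have et1: "et ?K \<le> 1"
    using step_params exps t_bounds mult_mono[of \<eta>0 1 "pw (- 5 * t - s) ?K" 1] pw_le_1[of "- 5 * t - s" ?K]
    by (simp add: et_def pow_seq_eq)
  then have c: "0 \<le> c" "c \<le> 1" "et ?K = 1 - c" using step_pos(3)[of ?K] by (auto simp: c_def)
  have N1: "noise M (Fh ?K) (VC * pw (2 * t) ?K) (\<lambda>\<omega>. s1 \<omega> - g1 \<omega>)"
    unfolding s1_def g1_def
    by (rule noise_g[OF iterates_in(1) iterates_in(4) run_measurable_half(1) run_measurable(3) run_sq_int(1) order_refl])
  have N0: "noise M (Fh ?K) (VC * pw (2 * t) ?K) (\<lambda>\<omega>. s0 \<omega> - g0 \<omega>)"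
    unfolding s0_def g0_def
    by (rule noise_g[OF iterates_in(1) iterates_in(4) run_measurable_half(3) run_measurable_half(2) run_sq_int(1) le_SucI[OF order_refl]])
  define N where "N \<omega> = (s1 \<omega> - g1 \<omega>) - c *\<^sub>R (s0 \<omega> - g0 \<omega>)" for \<omega>
  have N: "noise M (Fh ?K) (2 * (VC * pw (2 * t) ?K) + 2 * (c\<^sup>2 * (VC * pw (2 * t) ?K))) N"
    unfolding N_def[abs_def] by (rule noise_diff[OF N1 noise_scaleR[OF N0]])
  have em: "er k \<in> borel_measurable (Fh ?K)"
    unfolding er_def[abs_def]
    by (intro borel_measurable_diff run_measurable_half(4)
        mean_op_sq_int(3)[OF filt_subalgebra(2) iterates_in(1) iterates_in(4) run_measurable_half(3) run_measurable_half(2) run_sq_int(1)])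
  have "er ?K \<omega> = c *\<^sub>R er k \<omega> + N \<omega>" if "\<omega> \<in> space M" for \<omega>
    by (simp add: er_def d_Suc[OF that] N_def s1_def s0_def g1_def g0_def c_def algebra_simps)
  then have "msq (er ?K) = (\<integral>\<omega>. (norm (c *\<^sub>R er k \<omega> + N \<omega>))\<^sup>2 \<partial>M)"
    unfolding msq_def by (intro Bochner_Integration.integral_cong) auto
  also have "\<dots> = msq (\<lambda>\<omega>. c *\<^sub>R er k \<omega>) + msq N"
    unfolding msq_def
    by (rule noise_orthogonal[OF N]) (use em sq_int_scaleR[OF sq_ints(5)] in auto)
  also have "msq (\<lambda>\<omega>. c *\<^sub>R er k \<omega>) \<le> c * msq (er k)"
    unfolding msq_scaleR power2_eq_square using c mult_right_mono[OF mult_left_le[of c c], of "msq (er k)"] by simp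
  also have "msq N \<le> 3 * ((et ?K)\<^sup>2 * (VC * pw (2 * t) ?K) + msq (\<lambda>\<omega>. s1 \<omega> - s0 \<omega>) + msq (\<lambda>\<omega>. g1 \<omega> - g0 \<omega>))"
  proof -
    have s10: "sq_int M (\<lambda>\<omega>. s1 \<omega> - s0 \<omega>)"
      unfolding s1_def s0_def by (rule sample_gradient_step)
    have g10: "sq_int M (\<lambda>\<omega>. g1 \<omega> - g0 \<omega>)"
      unfolding g1_def g0_def by (intro sq_int_diff gk_x_sq)
    have n1: "sq_int M (\<lambda>\<omega>. s1 \<omega> - g1 \<omega>)" using N1 by (simp add: noise_def)
    note ii = sq_intD(2)[OF s10] sq_intD(2)[OF g10] sq_intD(2)[OF n1]
    have "msq N \<le> (\<integral>\<omega>. 3 * ((et ?K)\<^sup>2 * (norm (s1 \<omega> - g1 \<omega>))\<^sup>2 + (norm (s1 \<omega> - s0 \<omega>))\<^sup>2 + (norm (g1 \<omega> - g0 \<omega>))\<^sup>2) \<partial>M)"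
    proof (rule msq_mono)
      show "sq_int M N" using N by (simp add: noise_def)
      show "integrable M (\<lambda>\<omega>. 3 * ((et ?K)\<^sup>2 * (norm (s1 \<omega> - g1 \<omega>))\<^sup>2 + (norm (s1 \<omega> - s0 \<omega>))\<^sup>2 + (norm (g1 \<omega> - g0 \<omega>))\<^sup>2))"
        using ii by simp
      fix \<omega>
      \<comment> \<open>The point of the momentum correction: the full variance enters with the
        factor \<eta>^2 only, and the rest consists of increments, which are small with the
        steps.\<close>
      have "N \<omega> = et ?K *\<^sub>R (s1 \<omega> - g1 \<omega>) + (c *\<^sub>R (s1 \<omega> - s0 \<omega>) + (- c) *\<^sub>R (g1 \<omega> - g0 \<omega>))"
        unfolding c(3) N_def by (simp add: algebra_simps)
      then have "norm (N \<omega>) \<le> norm (et ?K *\<^sub>R (s1 \<omega> - g1 \<omega>)) + (norm (c *\<^sub>R (s1 \<omega> - s0 \<omega>)) + norm ((- c) *\<^sub>R (g1 \<omega> - g0 \<omega>)))"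
        by (simp only:) (intro norm_triangle_mono norm_triangle_ineq order_refl)
      also have "\<dots> \<le> et ?K * norm (s1 \<omega> - g1 \<omega>) + (norm (s1 \<omega> - s0 \<omega>) + norm (g1 \<omega> - g0 \<omega>))"
        using c step_pos(3)[of ?K] mult_right_mono[OF c(2), of "norm (s1 \<omega> - s0 \<omega>)"] mult_right_mono[OF c(2), of "norm (g1 \<omega> - g0 \<omega>)"]
        by simp
      finally have "(norm (N \<omega>))\<^sup>2 \<le> (et ?K * norm (s1 \<omega> - g1 \<omega>) + (norm (s1 \<omega> - s0 \<omega>) + norm (g1 \<omega> - g0 \<omega>)))\<^sup>2"
        by (rule power_mono) simp
      also have "\<dots> \<le> 3 * ((et ?K * norm (s1 \<omega> - g1 \<omega>))\<^sup>2 + (norm (s1 \<omega> - s0 \<omega>))\<^sup>2 + (norm (g1 \<omega> - g0 \<omega>))\<^sup>2)"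
      proof -
        have "(a + (b + c))\<^sup>2 \<le> 3 * (a\<^sup>2 + b\<^sup>2 + c\<^sup>2)" for a b c :: real
          using sum_squares_bound[of a b] sum_squares_bound[of a c] sum_squares_bound[of b c]
          by (simp add: power2_eq_square algebra_simps)
        then show ?thesis .
      qed
      finally show "(norm (N \<omega>))\<^sup>2 \<le> 3 * ((et ?K)\<^sup>2 * (norm (s1 \<omega> - g1 \<omega>))\<^sup>2 + (norm (s1 \<omega> - s0 \<omega>))\<^sup>2 + (norm (g1 \<omega> - g0 \<omega>))\<^sup>2)"
        by (simp add: power_mult_distrib)
    qed
    also have "\<dots> = 3 * ((et ?K)\<^sup>2 * msq (\<lambda>\<omega>. s1 \<omega> - g1 \<omega>) + msq (\<lambda>\<omega>. s1 \<omega> - s0 \<omega>) + msq (\<lambda>\<omega>. g1 \<omega> - g0 \<omega>))"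
      using ii by (simp add: msq_def)
    also have "\<dots> \<le> 3 * ((et ?K)\<^sup>2 * (VC * pw (2 * t) ?K) + msq (\<lambda>\<omega>. s1 \<omega> - s0 \<omega>) + msq (\<lambda>\<omega>. g1 \<omega> - g0 \<omega>))"
      using N1 by (intro mult_left_mono add_right_mono) (auto simp: noise_def msq_def)
    finally show ?thesis .
  qed
  finally show ?thesis unfolding s1_def s0_def g1_def g0_def c_def by simp
qed

text \<open>Three sources meet: \<eta>^2 k^(2t) has exponent -8t - 2s, k^(2t) times the inner
  increment has -4t - 2s, and the squared change of \<rho> has 2t - 2. All are at most -4t -
  2s.\<close>

lemma momentum_recursion: "\<exists>c>0. \<exists>K\<ge>0. \<forall>k.
    msq (er (Suc k)) \<le> (1 - c * pw (- 5 * t - s) k) * msq (er k)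
      + K * (pw (- 4 * t - 2 * s) k * (1 + msq (r (Suc k))) + pw (2 * t) k * msq (st k))"
proof -
  \<comment> \<open>\<eta> acts at index k + 1; the power of 2 shifts it back to k.\<close>
  define c where "c = \<eta>0 * 2 powr (- 5 * t - s)"
  have c: "0 < c" using step_params by (simp add: c_def)
  define A where "A = 8 * LL * (1 + \<rho>0\<^sup>2) + 4 * C\<^sup>2"
  \<comment> \<open>12 = 8 + 4 adds the penalty terms of \<open>sample_gradient_step\<close> and
    \<open>mean_gradient_step\<close>; the factor 2 C^2 comes from \<open>msq_u\<close>.\<close>
  define B where "B = 12 * LL * K0\<^sup>2 * (2 * C\<^sup>2)"
  define E where "E = (4 * C\<^sup>2 + 2 * VC) * \<beta>0\<^sup>2"
  have LL0: "0 \<le> LL" by (simp add: LL_def)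
  have pos: "0 \<le> A" "0 \<le> B" "0 \<le> E" using LL0 VC_nonneg by (auto simp: A_def B_def E_def)
  \<comment> \<open>The 3 comes from splitting N into three parts, the 4 bounds the shift factor 2
    powr (2 * t).\<close>
  define K where "K = 3 * (\<eta>0\<^sup>2 * VC + A * 4 * (1 + E) + B)"
  have K: "0 \<le> K" using pos VC_nonneg by (simp add: K_def)
  have "msq (er (Suc k)) \<le> (1 - c * pw (- 5 * t - s) k) * msq (er k)
      + K * (pw (- 4 * t - 2 * s) k * (1 + msq (r (Suc k))) + pw (2 * t) k * msq (st k))" for k
  proof -
    let ?K = "Suc k"
    define R where "R = 1 + msq (r ?K)"
    have R: "1 \<le> R" by (simp add: R_def)
    define S where "S = msq (st k)"
    have S: "0 \<le> S" by (simp add: S_def)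
    define p4 where "p4 = pw (- 4 * t - 2 * s) k"
    define q where "q = pw (2 * t) k"
    have q: "0 < q" "0 < p4" by (auto simp: q_def p4_def)
    have e_lower: "c * pw (- 5 * t - s) k \<le> et ?K"
      using mult_left_mono[OF pw_Suc_ge[of "- 5 * t - s" k], of \<eta>0] step_params exps t_bounds
      by (simp add: c_def et_def pow_seq_eq)
    have e_sq: "(et ?K)\<^sup>2 * (VC * pw (2 * t) ?K) \<le> \<eta>0\<^sup>2 * VC * (p4 * R)"
    proof -
      have "(et ?K)\<^sup>2 * (VC * pw (2 * t) ?K) = \<eta>0\<^sup>2 * VC * (pw (- 5 * t - s) ?K * pw (- 5 * t - s) ?K * pw (2 * t) ?K)"
        by (simp add: et_def pow_seq_eq power2_eq_square)
      also have "pw (- 5 * t - s) ?K * pw (- 5 * t - s) ?K * pw (2 * t) ?K = pw (- 8 * t - 2 * s) ?K"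
        unfolding pw_mult by (rule arg_cong[where f = "\<lambda>e. pw e ?K"]) simp
      also have "pw (- 8 * t - 2 * s) ?K \<le> p4 * R"
      proof -
        have "pw (- 8 * t - 2 * s) ?K \<le> pw (- 8 * t - 2 * s) k" using exps t_bounds by (intro pw_Suc_le) auto
        also have "\<dots> \<le> p4" unfolding p4_def using t_bounds by (intro pw_mono) auto
        also have "\<dots> \<le> p4 * R" using R q by simp
        finally show ?thesis .
      qed
      finally show ?thesis using VC_nonneg by (simp add: mult_left_mono)
    qed
    have q': "pw (2 * t) ?K \<le> 4 * q"
    proof -
      have "2 powr (2 * t) \<le> (2::real) powr 2" using t_bounds by (intro powr_mono) auto
      then have "2 powr (2 * t) * q \<le> 4 * q" using q by (intro mult_right_mono) auto
      moreover have "pw (2 * t) ?K \<le> 2 powr (2 * t) * q"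
        unfolding q_def using t_bounds by (intro pw_Suc_le') simp
      ultimately show ?thesis by linarith
    qed
    have d\<rho>: "(rh ?K - rh k)\<^sup>2 \<le> K0\<^sup>2 * p4"
    proof -
      have "\<bar>rh ?K - rh k\<bar> \<le> K0 * pw (t - 1) k"
        using par_drift[of k] by linarith
      then have "\<bar>rh ?K - rh k\<bar>\<^sup>2 \<le> (K0 * pw (t - 1) k)\<^sup>2" by (rule power_mono) simp
      also have "\<dots> = K0\<^sup>2 * pw (2 * (t - 1)) k"
        by (simp add: power_mult_distrib power2_eq_square[of "pw (t - 1) k"] pw_mult)
      also have "\<dots> \<le> K0\<^sup>2 * p4"
        unfolding p4_def using exps t_bounds by (intro mult_left_mono pw_mono) auto
      finally show ?thesis by simp
    qed
    have dub: "msq (du ?K) \<le> E * (pw (- 6 * t - 2 * s) k * R)"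
    proof -
      have "msq (du ?K) \<le> E * pw (- 6 * t - 2 * s) ?K * R"
        using msq_du[of ?K] by (simp add: E_def R_def)
      also have "\<dots> \<le> E * pw (- 6 * t - 2 * s) k * R"
        using pos R exps t_bounds by (intro mult_right_mono mult_left_mono pw_Suc_le) auto
      finally show ?thesis by (simp add: mult.assoc)
    qed
    have uR: "msq (u ?K) \<le> 2 * C\<^sup>2 * R" using msq_u[of ?K] by (simp add: R_def)
    have rho: "1 + (rh ?K)\<^sup>2 \<le> (1 + \<rho>0\<^sup>2) * pw (2 * t) ?K"
      using pw_ge_1[of "2 * t" ?K] t_bounds
      by (simp add: par_eq power_mult_distrib power2_eq_square[of "pw t ?K"] pw_mult algebra_simps)
    have LA: "8 * LL * (1 + (rh ?K)\<^sup>2) + 4 * C\<^sup>2 * pw (2 * t) ?K \<le> A * pw (2 * t) ?K"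
      using mult_left_mono[OF rho, of "8 * LL"] LL0 by (simp add: A_def algebra_simps)
    have "msq (\<lambda>\<omega>. gS ?K (\<xi>x ?K \<omega>) (x ?K \<omega>) (u (Suc ?K) \<omega>) - gS k (\<xi>x ?K \<omega>) (x k \<omega>) (u ?K \<omega>))
      + msq (\<lambda>\<omega>. gk ?K (x ?K \<omega>) (u (Suc ?K) \<omega>) - gk k (x k \<omega>) (u ?K \<omega>))
      \<le> (8 * LL * (1 + (rh ?K)\<^sup>2) + 4 * C\<^sup>2 * pw (2 * t) ?K) * (S + msq (du ?K)) + 12 * LL * (rh ?K - rh k)\<^sup>2 * msq (u ?K)"
      using sample_gradient_step(2)[of k] mean_gradient_step[of k] by (simp add: S_def algebra_simps)
    also have "\<dots> \<le> (A * (4 * q)) * (S + E * (pw (- 6 * t - 2 * s) k * R)) + 12 * LL * (K0\<^sup>2 * p4) * (2 * C\<^sup>2 * R)"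
    proof (intro add_mono mult_mono)
      show "8 * LL * (1 + (rh ?K)\<^sup>2) + 4 * C\<^sup>2 * pw (2 * t) ?K \<le> A * (4 * q)"
        by (rule order_trans[OF LA mult_left_mono[OF q' pos(1)]])
    qed (use LL0 d\<rho> uR dub S pos q R in auto)
    also have "\<dots> = A * 4 * (q * S) + A * 4 * E * ((q * pw (- 6 * t - 2 * s) k) * R) + B * (p4 * R)"
      by (simp add: B_def algebra_simps)
    also have "q * pw (- 6 * t - 2 * s) k = p4"
      unfolding q_def p4_def pw_mult by (rule arg_cong[where f = "\<lambda>e. pw e k"]) simp
    finally have M: "msq (\<lambda>\<omega>. gS ?K (\<xi>x ?K \<omega>) (x ?K \<omega>) (u (Suc ?K) \<omega>) - gS k (\<xi>x ?K \<omega>) (x k \<omega>) (u ?K \<omega>))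
      + msq (\<lambda>\<omega>. gk ?K (x ?K \<omega>) (u (Suc ?K) \<omega>) - gk k (x k \<omega>) (u ?K \<omega>))
      \<le> A * 4 * (q * S) + A * 4 * E * (p4 * R) + B * (p4 * R)" .
    have "(1 - et ?K) * msq (er k) \<le> (1 - c * pw (- 5 * t - s) k) * msq (er k)"
      using e_lower by (intro mult_right_mono) auto
    moreover have "3 * (\<eta>0\<^sup>2 * VC * (p4 * R) + (A * 4 * (q * S) + A * 4 * E * (p4 * R) + B * (p4 * R))) \<le> K * (p4 * R + q * S)"
    proof -
      have "0 \<le> \<eta>0\<^sup>2 * VC * (q * S)" "0 \<le> A * E * (q * S)" "0 \<le> B * (q * S)" "0 \<le> A * (p4 * R)"
        using pos VC_nonneg q S R by auto
      then show ?thesis unfolding K_def by (simp add: algebra_simps)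
    qed
    ultimately show ?thesis
      using estimator_step[of k] e_sq M unfolding R_def[symmetric] S_def[symmetric] p4_def[symmetric] q_def[symmetric]
      by (rule add_error_terms)
  qed
  then show ?thesis using c K by blast
qed

subsection \<open>Descent of the value function\<close>

definition PHI where "PHI k = (\<integral>\<omega>. phik k (x k \<omega>) \<partial>M)"

lemma phik_continuous: "continuous_on X (phik k)"
  unfolding phik_def using phi_has_derivative[OF _ par_pos] by (rule has_derivative_continuous_on)

lemma phik_integrable:
  "integrable M (\<lambda>\<omega>. phik k (x j \<omega>))"
proof -
  have "bounded (phik k ` X)"
    by (rule compact_imp_bounded[OF compact_continuous_image[OF phik_continuous X(2)]])
  then obtain B where B: "\<And>p. p \<in> X \<Longrightarrow> norm (phik k p) \<le> B" by (auto simp: bounded_iff)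
  show ?thesis
  proof (rule M.integrable_const_bound[where B = B])
    show "AE \<omega> in M. norm (phik k (x j \<omega>)) \<le> B"
      by (rule AE_I2) (rule B[OF iterates_in(1)])
    show "(\<lambda>\<omega>. phik k (x j \<omega>)) \<in> borel_measurable M"
      by (rule measurable_comp_X[OF phik_continuous measurable_from_subalg[OF filt_subalgebra(1) run_measurable(1)] refl])
  qed
qed

lemma pg_eq:
  assumes "\<omega> \<in> space M"
  shows "pg k \<omega> = (1 / al k) *\<^sub>R (x k \<omega> - closest_point X (x k \<omega> - al k *\<^sub>R gk k (x k \<omega>) (usk k (x k \<omega>))))"
  unfolding pg_def by (rule proj_grad_map_phik[OF iterates_in(1)[OF assms]])

text \<open>The mapping is defined through a choice of gradient; its measurability comes from the
  explicit formula \<open>pg_eq\<close>.\<close>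

lemma pg_sq_int: "sq_int M (pg k)"
proof -
  let ?q = "\<lambda>\<omega>. closest_point X (x k \<omega> - al k *\<^sub>R gk k (x k \<omega>) (usk k (x k \<omega>)))"
  have xm: "x k \<in> borel_measurable M" by (rule measurable_from_subalg[OF filt_subalgebra(1) run_measurable(1)])
  have "(\<lambda>\<omega>. gk k (x k \<omega>) (usk k (x k \<omega>))) \<in> borel_measurable (Fk k)"
    by (rule mean_op_sq_int(3)[OF filt_subalgebra(1) iterates_in(1) usk_in[OF iterates_in(1)] run_measurable(1) usk_x])
  note gm = measurable_from_subalg[OF filt_subalgebra(1) this]
  have qm: "?q \<in> borel_measurable M"
    by (rule measurable_compose[OF _ borel_measurable_continuous_onI[OF continuous_on_closest_point[OF X(3) closed_X X(1)]]])
       (intro borel_measurable_diff borel_measurable_scaleR borel_measurable_const xm gm)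
  have "sq_int M ?q"
    by (rule x_sq_int[OF _ qm]) (simp_all add: subalgebra_def closest_point_in_set[OF closed_X X(1)])
  then have s: "sq_int M (\<lambda>\<omega>. (1 / al k) *\<^sub>R (x k \<omega> - ?q \<omega>))"
    by (intro sq_int_scaleR sq_int_diff x_sq)
  have "pg k \<in> borel_measurable M"
    by (rule measurable_cong[THEN iffD1, OF _ sq_intD(1)[OF s]]) (simp add: pg_eq)
  then show ?thesis
  proof (rule sq_int_bound[OF _ sq_intD(2)[OF s]])
    show "(norm (pg k \<omega>))\<^sup>2 \<le> (norm ((1 / al k) *\<^sub>R (x k \<omega> - ?q \<omega>)))\<^sup>2" if "\<omega> \<in> space M" for \<omega>
      unfolding pg_eq[OF that] by (rule order_refl)
  qed
qed

text \<open>The error of d against the true gradient has two parts: that of the estimator, and that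
  of using u (Suc k) instead of the saddle point, of size k^t |w|. The change of parameters is paid
  for at the new iterate.\<close>

lemma descent_step:
  assumes small: "4 * (al k * (C * pw (3 * t) k)) \<le> 1"
  shows "PHI (Suc k) + 1 / (4 * al k) * msq (st k) + al k / 8 * msq (pg k)
    \<le> PHI k + C * pw (t - 1) k + 5 / 4 * al k * (2 * msq (er k) + 2 * (C\<^sup>2 * pw (2 * t) k * msq (w k)))"
proof -
  let ?l = "\<lambda>\<omega>. phik (Suc k) (x (Suc k) \<omega>) + 1 / (4 * al k) * (norm (st k \<omega>))\<^sup>2 + al k / 8 * (norm (pg k \<omega>))\<^sup>2"
  let ?r = "\<lambda>\<omega>. phik k (x k \<omega>) + C * pw (t - 1) k
      + 5 / 4 * al k * (2 * (norm (er k \<omega>))\<^sup>2 + 2 * (C\<^sup>2 * pw (2 * t) k * (norm (w k \<omega>))\<^sup>2))"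
  note ii = sq_intD(2)[OF sq_ints(3)[of k]] sq_intD(2)[OF pg_sq_int[of k]] sq_intD(2)[OF sq_ints(5)[of k]]
    sq_intD(2)[OF sq_ints(2)[of k]] phik_integrable
  have "(\<integral>\<omega>. ?l \<omega> \<partial>M) \<le> (\<integral>\<omega>. ?r \<omega> \<partial>M)"
  proof (rule integral_mono)
    show "integrable M ?l" "integrable M ?r" using ii by simp_all
    fix \<omega> assume \<omega>: "\<omega> \<in> space M"
    note xX = iterates_in(1)[OF \<omega>, of k] and xX' = iterates_in(1)[OF \<omega>, of "Suc k"]
    define g where "g = gk k (x k \<omega>) (usk k (x k \<omega>))"
    have model: "phik k (x (Suc k) \<omega>) \<le> phik k (x k \<omega>) + (x (Suc k) \<omega> - x k \<omega>) \<bullet> g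
        + C * pw (3 * t) k * (norm (x (Suc k) \<omega> - x k \<omega>))\<^sup>2"
      using phik_quad[OF xX xX', of k] unfolding g_def by linarith
    have "phik k (x (Suc k) \<omega>) + 1 / (4 * al k) * (norm (st k \<omega>))\<^sup>2 + al k / 8 * (norm (pg k \<omega>))\<^sup>2
      \<le> phik k (x k \<omega>) + 5 / 4 * al k * (norm (d k \<omega> - g))\<^sup>2"
      using inexact_projected_descent[OF X(3) closed_X xX step_pos(1) small x_Suc[OF \<omega>] model]
      by (simp only: st_def pg_eq[OF \<omega>] g_def)
    moreover have "phik (Suc k) (x (Suc k) \<omega>) \<le> phik k (x (Suc k) \<omega>) + C * pw (t - 1) k"
      by (rule phik_drift[OF xX'])
    moreover have "5 / 4 * al k * (norm (d k \<omega> - g))\<^sup>2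
      \<le> 5 / 4 * al k * (2 * (norm (er k \<omega>))\<^sup>2 + 2 * (C\<^sup>2 * pw (2 * t) k * (norm (w k \<omega>))\<^sup>2))"
    proof (rule mult_left_mono)
      define h where "h = gk k (x k \<omega>) (u (Suc k) \<omega>) - g"
      have "norm h \<le> C * pw t k * norm (w k \<omega>)"
        using gk_lip[OF xX xX iterates_in(4)[OF \<omega>] usk_in[OF xX], of k "Suc k" k]
        by (simp add: h_def g_def w_def)
      then have "(norm h)\<^sup>2 \<le> (C * pw t k * norm (w k \<omega>))\<^sup>2" by (rule power_mono) simp
      also have "\<dots> = C\<^sup>2 * pw (2 * t) k * (norm (w k \<omega>))\<^sup>2"
        by (simp add: power_mult_distrib pw_mult power2_eq_square[of "pw t k"])
      finally have "(norm h)\<^sup>2 \<le> C\<^sup>2 * pw (2 * t) k * (norm (w k \<omega>))\<^sup>2" .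
      moreover have "d k \<omega> - g = er k \<omega> + h" by (simp add: er_def h_def)
      ultimately show "(norm (d k \<omega> - g))\<^sup>2 \<le> 2 * (norm (er k \<omega>))\<^sup>2 + 2 * (C\<^sup>2 * pw (2 * t) k * (norm (w k \<omega>))\<^sup>2)"
        using norm_add_sq_le[of "er k \<omega>" h] by simp
    qed (use step_pos(1)[of k] in simp)
    ultimately show "?l \<omega> \<le> ?r \<omega>" by linarith
  qed
  then show ?thesis
    using ii by (simp add: PHI_def msq_def M.prob_space)
qed

text \<open>\<open>inner_step_rate\<close> trades w for r, and the noise it adds, with exponent -13t
  - 3s, is below -8t - 2s. The smallness needed in \<open>descent_step\<close> holds eventually
  because \<alpha>_k k^(3t) has exponent -6t - s.\<close>

lemma descent_recursion: "\<exists>c>0. \<exists>K\<ge>0. \<forall>\<^sub>F k in sequentially.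
    PHI (Suc k) + c * pw (9 * t + s) k * msq (st k) + c * pw (- 9 * t - s) k * msq (pg k)
    \<le> PHI k + K * pw (- 9 * t - s) k * msq (er k) + K * pw (- 7 * t - s) k * msq (r k)
      + K * (pw (- 8 * t - 2 * s) k + pw (t - 1) k)"
proof -
  define c where "c = min (1 / (4 * \<alpha>0)) (\<alpha>0 / 8)"
  have c: "0 < c" "c \<le> 1 / (4 * \<alpha>0)" "c \<le> \<alpha>0 / 8" using step_params by (auto simp: c_def)
  define a where "a = 5 / 2 * \<alpha>0"
  define V where "V = \<beta>0\<^sup>2 * VC"
  define K where "K = a + a * C\<^sup>2 + a * C\<^sup>2 * V + C"
  have pos: "0 \<le> a" "0 \<le> a * C\<^sup>2" "0 \<le> a * C\<^sup>2 * V" "0 \<le> C" "0 \<le> V"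
    using step_params VC_nonneg C_ge by (auto simp: a_def V_def)
  have K: "0 \<le> K" "a \<le> K" "a * C\<^sup>2 \<le> K" "a * C\<^sup>2 * V \<le> K" "C \<le> K"
    using pos by (simp_all add: K_def)
  have "\<forall>\<^sub>F k in sequentially. (4 * \<alpha>0 * C) * pw (- 6 * t - s) k \<le> 1 * pw 0 k"
    using exps t_bounds by (intro pw_eventually_le) auto
  with inner_step_rate have "\<forall>\<^sub>F k in sequentially.
    PHI (Suc k) + c * pw (9 * t + s) k * msq (st k) + c * pw (- 9 * t - s) k * msq (pg k)
    \<le> PHI k + K * pw (- 9 * t - s) k * msq (er k) + K * pw (- 7 * t - s) k * msq (r k)
      + K * (pw (- 8 * t - 2 * s) k + pw (t - 1) k)"
  proof eventually_elim
    case (elim k)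
    define p9 where "p9 = pw (- 9 * t - s) k"
    have p9: "0 < p9" by (simp add: p9_def)
    have al: "al k = \<alpha>0 * p9" by (simp add: al_def pow_seq_eq p9_def)
    have "p9 * pw (3 * t) k = pw (- 6 * t - s) k"
      unfolding p9_def pw_mult by (rule arg_cong[where f = "\<lambda>e. pw e k"]) simp
    then have eq: "4 * (al k * (C * pw (3 * t) k)) = (4 * \<alpha>0 * C) * pw (- 6 * t - s) k"
      unfolding al by (metis mult.assoc mult.left_commute)
    have small: "4 * (al k * (C * pw (3 * t) k)) \<le> 1" unfolding eq using elim by simp
    have inv: "1 / (4 * al k) = 1 / (4 * \<alpha>0) * pw (9 * t + s) k"
    proof -
      have "p9 = 1 / pw (9 * t + s) k" using pw_minus[of "9 * t + s" k] by (simp add: p9_def)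
      then show ?thesis by (simp add: al)
    qed
    have "msq (w k) \<le> msq (r k) + V * pw (- 6 * t - 2 * s) k"
    proof -
      have "(1 - \<beta>0 * m0 * pw (- 5 * t - s) k) * msq (r k) \<le> 1 * msq (r k)"
        using step_params m0_pos by (intro mult_right_mono) auto
      then show ?thesis using elim by (simp add: V_def)
    qed
    then have "a * C\<^sup>2 * pw (- 7 * t - s) k * msq (w k) \<le> a * C\<^sup>2 * pw (- 7 * t - s) k * (msq (r k) + V * pw (- 6 * t - 2 * s) k)"
      using pos by (intro mult_left_mono) auto
    also have "\<dots> = a * C\<^sup>2 * (pw (- 7 * t - s) k * msq (r k)) + a * C\<^sup>2 * V * (pw (- 7 * t - s) k * pw (- 6 * t - 2 * s) k)"
      by (simp add: algebra_simps)
    also have "\<dots> \<le> K * (pw (- 7 * t - s) k * msq (r k)) + K * pw (- 8 * t - 2 * s) k"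
    proof (intro add_mono mult_mono K)
      show "pw (- 7 * t - s) k * pw (- 6 * t - 2 * s) k \<le> pw (- 8 * t - 2 * s) k"
        unfolding pw_mult using exps t_bounds by (intro pw_mono) auto
    qed (use K in auto)
    finally have W: "a * C\<^sup>2 * pw (- 7 * t - s) k * msq (w k) \<le> K * (pw (- 7 * t - s) k * msq (r k)) + K * pw (- 8 * t - 2 * s) k" .
    have p7: "p9 * pw (2 * t) k = pw (- 7 * t - s) k"
      unfolding p9_def pw_mult by (rule arg_cong[where f = "\<lambda>e. pw e k"]) simp
    have "5 / 4 * al k * (2 * msq (er k) + 2 * (C\<^sup>2 * pw (2 * t) k * msq (w k)))
      = a * (p9 * msq (er k)) + a * C\<^sup>2 * (p9 * pw (2 * t) k) * msq (w k)"
      by (simp add: al a_def algebra_simps)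
    also have "\<dots> \<le> K * (p9 * msq (er k)) + (K * (pw (- 7 * t - s) k * msq (r k)) + K * pw (- 8 * t - 2 * s) k)"
      unfolding p7 using p9 by (intro add_mono W mult_right_mono K) auto
    finally have E: "5 / 4 * al k * (2 * msq (er k) + 2 * (C\<^sup>2 * pw (2 * t) k * msq (w k)))
      \<le> K * (p9 * msq (er k)) + (K * (pw (- 7 * t - s) k * msq (r k)) + K * pw (- 8 * t - 2 * s) k)" .
    have "c * pw (9 * t + s) k * msq (st k) \<le> 1 / (4 * al k) * msq (st k)"
      unfolding inv using c by (intro mult_right_mono) auto
    moreover have "c * p9 * msq (pg k) \<le> al k / 8 * msq (pg k)"
      using mult_right_mono[OF c(3), of p9] p9 by (intro mult_right_mono) (auto simp: al)
    moreover have "C * pw (t - 1) k \<le> K * pw (t - 1) k" using K by (intro mult_right_mono) auto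
    ultimately have "PHI (Suc k) + c * pw (9 * t + s) k * msq (st k) + c * p9 * msq (pg k)
      \<le> PHI k + K * pw (t - 1) k + (K * (p9 * msq (er k)) + (K * (pw (- 7 * t - s) k * msq (r k)) + K * pw (- 8 * t - 2 * s) k))"
      using descent_step[OF small] E by linarith
    then show ?case by (simp add: p9_def algebra_simps)
  qed
  then show ?thesis using c K by blast
qed

lemma PHI_lower: "- C \<le> PHI k"
proof -
  have "(\<integral>\<omega>. - C \<partial>M) \<le> PHI k"
    unfolding PHI_def using phik_lower[OF iterates_in(1)] by (intro integral_mono phik_integrable) auto
  then show ?thesis by (simp add: M.prob_space)
qed

lemma rates:
  "(\<lambda>K. MIN k\<in>{0..K}. msq (pg k)) \<in> O(\<lambda>K. 1 / real K powr (1 - 11 * t - s) + 1 / real K powr (s - 2 * t))"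
  "(\<lambda>K. MIN k\<in>{0..K}. msq (r k)) \<in> O(\<lambda>K. 1 / real K powr (1 - 8 * t - s) + 1 / real K powr (s + t))"
proof -
  obtain c1 K1 where 1: "0 < c1" "0 \<le> K1" "\<forall>\<^sub>F k in sequentially.
    PHI (Suc k) + c1 * pw (9 * t + s) k * msq (st k) + c1 * pw (- 9 * t - s) k * msq (pg k)
    \<le> PHI k + K1 * pw (- 9 * t - s) k * msq (er k) + K1 * pw (- 7 * t - s) k * msq (r k)
      + K1 * (pw (- 8 * t - 2 * s) k + pw (t - 1) k)"
    using descent_recursion by blast
  obtain c2 K2 where 2: "0 < c2" "0 \<le> K2" "\<forall>\<^sub>F k in sequentially.
    msq (r (Suc k)) \<le> (1 - c2 * pw (- 5 * t - s) k) * msq (r k)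
      + K2 * (pw (- 6 * t - 2 * s) k + pw (9 * t + s) k * msq (st k) + pw (9 * t + s - 2) k)"
    using tracking_recursion by blast
  obtain c3 K3 where 3: "0 < c3" "0 \<le> K3" "\<And>k. msq (er (Suc k)) \<le> (1 - c3 * pw (- 5 * t - s) k) * msq (er k)
      + K3 * (pw (- 4 * t - 2 * s) k * (1 + msq (r (Suc k))) + pw (2 * t) k * msq (st k))"
    using momentum_recursion by blast
  obtain k0 where k0: "\<And>k. k0 \<le> k \<Longrightarrow> PHI (Suc k) + c1 * pw (9 * t + s) k * msq (st k) + c1 * pw (- 9 * t - s) k * msq (pg k)
    \<le> PHI k + K1 * pw (- 9 * t - s) k * msq (er k) + K1 * pw (- 7 * t - s) k * msq (r k)
      + K1 * (pw (- 8 * t - 2 * s) k + pw (t - 1) k)"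
    "\<And>k. k0 \<le> k \<Longrightarrow> msq (r (Suc k)) \<le> (1 - c2 * pw (- 5 * t - s) k) * msq (r k)
      + K2 * (pw (- 6 * t - 2 * s) k + pw (9 * t + s) k * msq (st k) + pw (9 * t + s - 2) k)"
    using eventually_conj[OF 1(3) 2(3)] unfolding eventually_sequentially by blast
  \<comment> \<open>A smaller c and a larger K only weaken each recursion, so one pair of constants
    fits all three.\<close>
  define c where "c = min c1 (min c2 c3)"
  define K where "K = C + K1 + K2 + K3"
  have c: "0 < c" "c \<le> c1" "c \<le> c2" "c \<le> c3" using 1 2 3 by (auto simp: c_def)
  have K: "0 < K" "C \<le> K" "K1 \<le> K" "K2 \<le> K" "K3 \<le> K" using 1 2 3 C_ge by (auto simp: K_def)
  interpret rate_recursion s t c K PHI "\<lambda>k. msq (r k)" "\<lambda>k. msq (er k)" "\<lambda>k. msq (st k)" "\<lambda>k. msq (pg k)" k0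
  proof
    show "- K \<le> PHI k" for k using PHI_lower[of k] K by simp
    fix k assume k: "k0 \<le> k"
    have "c * pw (9 * t + s) k * msq (st k) \<le> c1 * pw (9 * t + s) k * msq (st k)"
      "c * pw (- 9 * t - s) k * msq (pg k) \<le> c1 * pw (- 9 * t - s) k * msq (pg k)"
      using c by (intro mult_right_mono; simp)+
    moreover have "K1 * pw (- 9 * t - s) k * msq (er k) \<le> K * pw (- 9 * t - s) k * msq (er k)"
      "K1 * pw (- 7 * t - s) k * msq (r k) \<le> K * pw (- 7 * t - s) k * msq (r k)"
      "K1 * (pw (- 8 * t - 2 * s) k + pw (t - 1) k) \<le> K * (pw (- 8 * t - 2 * s) k + pw (t - 1) k)"
      using K by (intro mult_right_mono add_nonneg_nonneg; simp)+
    ultimately show "PHI (Suc k) + c * pw (9 * t + s) k * msq (st k) + c * pw (- 9 * t - s) k * msq (pg k)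
      \<le> PHI k + K * pw (- 9 * t - s) k * msq (er k) + K * pw (- 7 * t - s) k * msq (r k)
        + K * (pw (- 8 * t - 2 * s) k + pw (t - 1) k)"
      using k0(1)[OF k] by linarith
    have "(1 - c2 * pw (- 5 * t - s) k) * msq (r k) \<le> (1 - c * pw (- 5 * t - s) k) * msq (r k)"
      using c by (intro mult_right_mono) (auto intro: mult_right_mono)
    moreover have "K2 * (pw (- 6 * t - 2 * s) k + pw (9 * t + s) k * msq (st k) + pw (9 * t + s - 2) k)
        \<le> K * (pw (- 6 * t - 2 * s) k + pw (9 * t + s) k * msq (st k) + pw (9 * t + s - 2) k)"
      using K by (intro mult_right_mono add_nonneg_nonneg mult_nonneg_nonneg) auto
    ultimately show "msq (r (Suc k)) \<le> (1 - c * pw (- 5 * t - s) k) * msq (r k)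
        + K * (pw (- 6 * t - 2 * s) k + pw (9 * t + s) k * msq (st k) + pw (9 * t + s - 2) k)"
      using k0(2)[OF k] by linarith
    have "(1 - c3 * pw (- 5 * t - s) k) * msq (er k) \<le> (1 - c * pw (- 5 * t - s) k) * msq (er k)"
      using c by (intro mult_right_mono) (auto intro: mult_right_mono)
    moreover have "K3 * (pw (- 4 * t - 2 * s) k * (1 + msq (r (Suc k))) + pw (2 * t) k * msq (st k))
        \<le> K * (pw (- 4 * t - 2 * s) k * (1 + msq (r (Suc k))) + pw (2 * t) k * msq (st k))"
      using K by (intro mult_right_mono add_nonneg_nonneg mult_nonneg_nonneg) auto
    ultimately show "msq (er (Suc k)) \<le> (1 - c * pw (- 5 * t - s) k) * msq (er k)
        + K * (pw (- 4 * t - 2 * s) k * (1 + msq (r (Suc k))) + pw (2 * t) k * msq (st k))"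
      using 3(3)[of k] by linarith
  qed (use exps t_bounds c K in auto)
  show "(\<lambda>K. MIN k\<in>{0..K}. msq (pg k)) \<in> O(\<lambda>K. 1 / real K powr (1 - 11 * t - s) + 1 / real K powr (s - 2 * t))"
    by (rule gradient_rate)
  show "(\<lambda>K. MIN k\<in>{0..K}. msq (r k)) \<in> O(\<lambda>K. 1 / real K powr (1 - 8 * t - s) + 1 / real K powr (s + t))"
    by (rule tracking_rate)
qed

end

theorem theorem7:
  fixes X :: "(real^'n) set" and Y :: "(real^'m) set"
    and D :: "'w measure" and M :: "'o measure"
    and FS fS :: "real^'n \<Rightarrow> real^'m \<Rightarrow> 'w \<Rightarrow> real"
    and \<xi>u \<xi>x :: "nat \<Rightarrow> 'o \<Rightarrow> 'w"
    and F f :: "real^'n \<Rightarrow> real^'m \<Rightarrow> real"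
    and \<Delta> LF Lf \<alpha>0 \<eta>0 \<delta>0 \<rho>0 s t :: real
  defines "F \<equiv> mean_fun D FS" and "f \<equiv> mean_fun D fS"
  assumes X: "X \<noteq> {}" "closed X" "convex X"
    and Y: "Y \<noteq> {}" "closed Y" "convex Y"
    and prob: "prob_space D" "prob_space M"
    and sample_funs: "sample_fun D X Y FS" "sample_fun D X Y fS"
    and A1: "upper_level_assm X Y F"
    and A2: "lower_level_assm X Y f"
    and A4: "compact X"
    and A5_samples: "samples M D \<xi>u \<xi>x"
    and A5_oracle: "\<Delta> > 0" "gradient_oracle M D \<xi>u \<xi>x X Y \<Delta> FS"
      "gradient_oracle M D \<xi>u \<xi>x X Y \<Delta> fS"
    and A6: "LF > 0" "mean_square_lipschitz D X Y LF FS"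
      "Lf > 0" "mean_square_lipschitz D X Y Lf fS"
    and phi_bdd: "bdd_below (value_fun F f Y ` X)"
    and params: "\<alpha>0 > 0" "\<delta>0 > 0" "\<rho>0 > 0" "0 < \<eta>0" "\<eta>0 \<le> 1"
    and exps: "0 < 2 * t" "2 * t < s" "s < 1" "11 * t + s < 1" "9 * t + 2 * s \<noteq> 1"
  shows "\<exists>c>0. \<forall>\<beta>0>0. \<forall>\<sigma>0>0. \<beta>0 / \<sigma>0 < c \<longrightarrow>
    (let \<alpha> = pow_seq \<alpha>0 (- 9 * t - s); \<beta> = pow_seq \<beta>0 (- 4 * t - s);
         \<eta> = pow_seq \<eta>0 (- 5 * t - s); \<sigma> = pow_seq \<sigma>0 (- t);
         \<delta> = pow_seq \<delta>0 (- t); \<rho> = pow_seq \<rho>0 t;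
         \<psi> = (\<lambda>k. psi F f (\<rho> k) (\<sigma> k) (\<delta> k));
         \<psi>S = (\<lambda>k w. psi (\<lambda>x y. FS x y w) (\<lambda>x y. fS x y w) (\<rho> k) (\<sigma> k) (\<delta> k));
         G = (\<lambda>k. proj_grad_map X (\<alpha> k) (min_max Y (\<psi> k)));
         ustar = (\<lambda>k. saddle Y (\<psi> k))
     in \<forall>x0\<in>X. \<forall>y0\<in>Y. \<forall>z0\<in>Y. \<forall>x y z d.
          sto_sipba M X Y \<psi>S \<xi>u \<xi>x \<alpha> \<beta> \<eta> x0 y0 z0 x y z d \<longrightarrow>
          (\<forall>k. integrable M (\<lambda>\<omega>. (norm (G k (x k \<omega>)))\<^sup>2)) \<and>
          (\<forall>k. integrable M (\<lambda>\<omega>. (norm ((y k \<omega>, z k \<omega>) - ustar k (x k \<omega>)))\<^sup>2)) \<and>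
          (\<lambda>K. MIN k\<in>{0..K}. \<integral>\<omega>. (norm (G k (x k \<omega>)))\<^sup>2 \<partial>M)
            \<in> O(\<lambda>K. 1 / real K powr (1 - 11 * t - s) + 1 / real K powr (s - 2 * t)) \<and>
          (\<lambda>K. MIN k\<in>{0..K}. \<integral>\<omega>. (norm ((y k \<omega>, z k \<omega>) - ustar k (x k \<omega>)))\<^sup>2 \<partial>M)
            \<in> O(\<lambda>K. 1 / real K powr (1 - 8 * t - s) + 1 / real K powr (s + t)))"
proof -
  \<comment> \<open>The local boundedness of lower-level solutions is applied to X itself, bounded
    by compactness.\<close>
  have bd: "\<exists>Dy\<subseteq>Y. bounded Dy \<and> (\<forall>x\<in>X. lower_sol f Y x \<inter> Dy \<noteq> {})"
    using A2 A4 by (auto simp: lower_level_assm_def dest: compact_imp_bounded)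
  have C1: "C1_lipschitz_grad X Y F" "C1_lipschitz_grad X Y f"
    using A1 A2 by (auto simp: upper_level_assm_def lower_level_assm_def)
  obtain L1 where L1: "smooth_on X Y L1 F" by (rule C1_lipschitz_grad_imp_smooth_on[OF C1(1)])
  obtain L2 where L2: "smooth_on X Y L2 f" by (rule C1_lipschitz_grad_imp_smooth_on[OF C1(2)])
  define L where "L = max 1 (max L1 L2)"
  have bil: "bilevel X Y F f L"
    using X Y A1 A2 A4 bd smooth_on_mono[OF L1, of L] smooth_on_mono[OF L2, of L]
    by unfold_locales (auto simp: L_def upper_level_assm_def lower_level_assm_def)
  have main: "(\<forall>k. integrable M (\<lambda>\<omega>. (norm (proj_grad_map X (pow_seq \<alpha>0 (- 9 * t - s) k)
          (min_max Y (psi F f (pow_seq \<rho>0 t k) (pow_seq \<sigma>0 (- t) k) (pow_seq \<delta>0 (- t) k))) (x k \<omega>)))\<^sup>2)) \<and>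
      (\<forall>k. integrable M (\<lambda>\<omega>. (norm ((y k \<omega>, z k \<omega>)
          - saddle Y (psi F f (pow_seq \<rho>0 t k) (pow_seq \<sigma>0 (- t) k) (pow_seq \<delta>0 (- t) k)) (x k \<omega>)))\<^sup>2)) \<and>
      (\<lambda>K. MIN k\<in>{0..K}. \<integral>\<omega>. (norm (proj_grad_map X (pow_seq \<alpha>0 (- 9 * t - s) k)
          (min_max Y (psi F f (pow_seq \<rho>0 t k) (pow_seq \<sigma>0 (- t) k) (pow_seq \<delta>0 (- t) k))) (x k \<omega>)))\<^sup>2 \<partial>M)
        \<in> O(\<lambda>K. 1 / real K powr (1 - 11 * t - s) + 1 / real K powr (s - 2 * t)) \<and>
      (\<lambda>K. MIN k\<in>{0..K}. \<integral>\<omega>. (norm ((y k \<omega>, z k \<omega>)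
          - saddle Y (psi F f (pow_seq \<rho>0 t k) (pow_seq \<sigma>0 (- t) k) (pow_seq \<delta>0 (- t) k)) (x k \<omega>)))\<^sup>2 \<partial>M)
        \<in> O(\<lambda>K. 1 / real K powr (1 - 8 * t - s) + 1 / real K powr (s + t))"
    if pos: "0 < \<beta>0" "0 < \<sigma>0" and start: "x0 \<in> X" "y0 \<in> Y" "z0 \<in> Y"
      and run: "sto_sipba M X Y
        (\<lambda>k w. psi (\<lambda>x y. FS x y w) (\<lambda>x y. fS x y w) (pow_seq \<rho>0 t k) (pow_seq \<sigma>0 (- t) k) (pow_seq \<delta>0 (- t) k))
        \<xi>u \<xi>x (pow_seq \<alpha>0 (- 9 * t - s)) (pow_seq \<beta>0 (- 4 * t - s)) (pow_seq \<eta>0 (- 5 * t - s)) x0 y0 z0 x y z d"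
    for \<beta>0 \<sigma>0 x0 y0 z0 x y z d
  proof -
    interpret bilevel_path X Y F f L \<sigma>0 \<delta>0 \<rho>0 t
      by (intro bilevel_path.intro bil bilevel_path_axioms.intro) (use params exps pos in auto)
    obtain C where "bounded_path_axioms X Y F f \<sigma>0 \<delta>0 \<rho>0 t C"
      by (rule uniform_bounds) (rule that, rule bounded_path_axioms.intro; assumption)
    then have bp: "bounded_path X Y F f L \<sigma>0 \<delta>0 \<rho>0 t C"
      by (intro bounded_path.intro bilevel_path_axioms)
    interpret R: sipba_run X Y D FS fS L \<sigma>0 \<delta>0 \<rho>0 t C M \<xi>u \<xi>x \<Delta> LF Lf \<alpha>0 \<beta>0 \<eta>0 s x0 y0 z0 x d y z
      using bp unfolding F_def f_def
      by (rule sipba_run.intro)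
         (rule sipba_run_axioms.intro; use prob sample_funs A5_samples A5_oracle A6 params exps pos start run in simp)
    note defs = R.pg_def R.r_def R.al_def R.u_def R.phik_def R.usk_def R.rh_def R.sg_def R.de_def R.msq_def
    note gi = sq_intD(2)[OF R.pg_sq_int, unfolded defs] and ri = sq_intD(2)[OF R.sq_ints(1), unfolded defs]
    show ?thesis
      using gi ri R.rates[unfolded defs] unfolding F_def f_def by blast
  qed
  show ?thesis
    unfolding Let_def by (rule exI[of _ 1]) (use main in auto)
qed

end
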